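(* Let $\alpha,\beta,\gamma,a_1,\dots,a_n,b,c,d,x_1,\dots,x_n$ be complex parameters such that either $$\max\{|\alpha c|,|\alpha d|,|\alpha a_{1}\cdots a_{n}q^{1-n}|,|\alpha\beta a_{1}\cdots a_{n}/q^{n}|,|\alpha\gamma a_{1}\cdots a_{n}/q^{n}|\}<1\quad\text{and}\quad \max\{|\alpha bx_{r}|:1\leq r\leq n\}<1,$$ or $a_r=q^{N_r}$ with $N_r$ a positive integer for $r=1,\dots,n$ (so that the series terminates). Suppose that none of the denominators in the following identity vanishes. Then $$\begin{aligned} & \frac{(\alpha q,\ \alpha a_{1}\cdots a_{n}c/q^{n},\ \alpha a_{1}\cdots a_{n}d/q^{n},\ \alpha\beta,\ \alpha\gamma)_{\infty}}{(\alpha a_{1}\cdots a_{n}q^{1-n},\ \alpha c,\ \alpha d,\ \alpha a_{1}\cdots a_{n}\beta/q^{n},\ \alpha a_{1}\cdots a_{n}\gamma/q^{n})_{\infty}}\prod_{r=1}^{n}\frac{(\alpha a_{r}bx_{r}/q)_{\infty}}{(\alpha bx_{r})_{\infty}}\\ &=\sum_{k_1,\dots,k_n\ge0}\ \prod_{1\leq r<s\leq n}\frac{1-q^{k_{r}-k_{s}}x_{r}/x_{s}}{1-x_{r}/x_{s}}\prod_{r,s=1}^{n}\frac{(qx_{r}/(x_{s}a_{s}))_{k_{r}}}{(qx_{r}/x_{s})_{k_{r}}}\\ &\quad\times\frac{(1-\alpha q^{2|\boldsymbol{k}|})(\alpha)_{|\boldsymbol{k}|}}{(1-\alpha)(\alpha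 a_{1}\cdots a_{n}q^{1-n})_{|\boldsymbol{k}|}}(a_{1}\cdots a_{n})^{|\boldsymbol{k}|}q^{\sum_{r=1}^{n}(r-1)k_{r}-n|\boldsymbol{k}|}\\ &\quad\times\sum_{\substack{0\leq m_{r}\leq k_{r}\\ r=1,\dots,n}}\ \prod_{1\leq r<s\leq n}\frac{1-q^{m_{r}-m_{s}}x_{r}/x_{s}}{1-x_{r}/x_{s}}\prod_{r,s=1}^{n}\frac{(q^{-k_{s}}x_{r}/x_{s})_{m_{r}}}{(qx_{r}/x_{s})_{m_{r}}}\cdot\frac{(\alpha q^{|\boldsymbol{k}|},\alpha\beta,\alpha\gamma)_{|\boldsymbol{m}|}}{(\alpha c,\alpha d)_{|\boldsymbol{m}|}\prod_{r=1}^{n}(\alpha bx_{r})_{m_{r}}}q^{\sum_{r=1}^{n}rm_{r}}. \end{aligned}$$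
   Context: $q$ is a complex number with $0<|q|<1$ and $n\ge1$ is an integer. $(z)_\infty=\prod_{i\ge0}(1-zq^i)$ and $(z)_k=(z)_\infty/(zq^k)_\infty=\prod_{i=0}^{k-1}(1-zq^i)$; $(c_1,\dots,c_p)_k=(c_1)_k\cdots(c_p)_k$ for $k$ a nonnegative integer or $\infty$. Bold letters denote multi-indices of nonnegative integers, $\boldsymbol k=(k_1,\dots,k_n)$, with $|\boldsymbol k|=k_1+\cdots+k_n$. If some $a_s=0$, the expression $\prod_{r,s}(qx_r/(x_sa_s))_{k_r}(a_1\cdots a_n)^{|\boldsymbol k|}$, which is polynomial in the $a_s$, is understood by continuity. *)

theory Defs
  imports "HOL-Analysis.Analysis"
begin

definition qpoch :: "complex \<Rightarrow> complex \<Rightarrow> nat \<Rightarrow> complex" where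
  "qpoch q z k = (\<Prod>i<k. 1 - z * q ^ i)"

definition qpoch_inf :: "complex \<Rightarrow> complex \<Rightarrow> complex" where
  "qpoch_inf q z = (\<Prod>i. 1 - z * q ^ i)"

definition qpochs :: "complex \<Rightarrow> complex list \<Rightarrow> nat \<Rightarrow> complex" where
  "qpochs q zs k = (\<Prod>z\<leftarrow>zs. qpoch q z k)"

definition qpochs_inf :: "complex \<Rightarrow> complex list \<Rightarrow> complex" where
  "qpochs_inf q zs = (\<Prod>z\<leftarrow>zs. qpoch_inf q z)"

text \<open>A multi-index is an extensional function on \<open>{1..n}\<close>, so that distinct multi-indices are
  distinct functions and sums over them count each one once.\<close>

definition multi_indices :: "nat \<Rightarrow> (nat \<Rightarrow> nat) set" where
  "multi_indices n = {1..n} \<rightarrow>\<^sub>E UNIV"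

definition multi_indices_le :: "nat \<Rightarrow> (nat \<Rightarrow> nat) \<Rightarrow> (nat \<Rightarrow> nat) set" where
  "multi_indices_le n k = (\<Pi>\<^sub>E r\<in>{1..n}. {0..k r})"

definition msize :: "nat \<Rightarrow> (nat \<Rightarrow> nat) \<Rightarrow> nat" where
  "msize n k = (\<Sum>r=1..n. k r)"

definition vandermonde_ratio :: "complex \<Rightarrow> nat \<Rightarrow> (nat \<Rightarrow> complex) \<Rightarrow> (nat \<Rightarrow> nat) \<Rightarrow> complex" where
  "vandermonde_ratio q n x k =
     (\<Prod>s=1..n. \<Prod>r=1..<s.
        (1 - q powi (int (k r) - int (k s)) * (x r / x s)) / (1 - x r / x s))"

text \<open>The product of all \<open>(q x\<^sub>r / (x\<^sub>s a\<^sub>s))\<^bsub>k\<^sub>r\<^esub>\<close>, \<open>1 \<le> r, s \<le> n\<close>, times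
  \<open>(a\<^sub>1 \<dots> a\<^sub>n)\<^bsup>|k|\<^esup>\<close>. Since division by zero is totalised to zero, the quotient
  form would give the wrong value when some \<open>a\<^sub>s = 0\<close>. Multiplying \<open>a\<^sub>s\<close> into each factor
  \<open>1 - q\<^bsup>i+1\<^esup> x\<^sub>r / (x\<^sub>s a\<^sub>s)\<close> gives the polynomial below, which is the continuous
  extension of the quotient form: see the two lemmas that follow.\<close>

definition numer_poly ::
  "complex \<Rightarrow> nat \<Rightarrow> (nat \<Rightarrow> complex) \<Rightarrow> (nat \<Rightarrow> complex) \<Rightarrow> (nat \<Rightarrow> nat) \<Rightarrow> complex" where
  "numer_poly q n x a k =
     (\<Prod>r=1..n. \<Prod>s=1..n. \<Prod>i<k r. a s - q * x r / x s * q ^ i)"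

lemma numer_poly_eq:
  assumes "\<forall>s\<in>{1..n}. a s \<noteq> 0"
  shows "numer_poly q n x a k =
    (\<Prod>r=1..n. \<Prod>s=1..n. qpoch q (q * x r / (x s * a s)) (k r)) * (\<Prod>s=1..n. a s) ^ msize n k"
proof -
  have "(\<Prod>s=1..n. a s) ^ msize n k = (\<Prod>r=1..n. \<Prod>s=1..n. a s ^ k r)"
    by (simp add: msize_def power_sum prod_power_distrib)
  moreover have "(\<Prod>i<k r. a s - q * x r / x s * q ^ i)
      = qpoch q (q * x r / (x s * a s)) (k r) * a s ^ k r" if "s \<in> {1..n}" for r s
  proof -
    have "a s \<noteq> 0" using assms that by blast
    then have "a s - q * x r / x s * q ^ i = (1 - q * x r / (x s * a s) * q ^ i) * a s" for i
      by (simp add: left_diff_distrib)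
    then show ?thesis
      by (simp add: qpoch_def prod.distrib)
  qed
  ultimately show ?thesis
    by (simp add: numer_poly_def prod.distrib)
qed

lemma continuous_numer_poly: "continuous_on UNIV (\<lambda>a. numer_poly q n x a k)"
  unfolding numer_poly_def
  by (intro continuous_intros continuous_on_product_coordinates)

definition inner_sum ::
  "complex \<Rightarrow> nat \<Rightarrow> complex \<Rightarrow> complex \<Rightarrow> complex \<Rightarrow> complex \<Rightarrow> complex \<Rightarrow> complex
    \<Rightarrow> (nat \<Rightarrow> complex) \<Rightarrow> (nat \<Rightarrow> nat) \<Rightarrow> complex" where
  "inner_sum q n \<alpha> \<beta> \<gamma> b c d x k =
     (\<Sum>m\<in>multi_indices_le n k.
        vandermonde_ratio q n x m
        * (\<Prod>r=1..n. \<Prod>s=1..n.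
             qpoch q (q powi (- int (k s)) * (x r / x s)) (m r) / qpoch q (q * x r / x s) (m r))
        * (qpochs q [\<alpha> * q ^ msize n k, \<alpha> * \<beta>, \<alpha> * \<gamma>] (msize n m)
           / (qpochs q [\<alpha> * c, \<alpha> * d] (msize n m) * (\<Prod>r=1..n. qpoch q (\<alpha> * b * x r) (m r))))
        * q ^ (\<Sum>r=1..n. r * m r))"

definition outer_term ::
  "complex \<Rightarrow> nat \<Rightarrow> complex \<Rightarrow> complex \<Rightarrow> complex \<Rightarrow> (nat \<Rightarrow> complex)
    \<Rightarrow> complex \<Rightarrow> complex \<Rightarrow> complex \<Rightarrow> (nat \<Rightarrow> complex) \<Rightarrow> (nat \<Rightarrow> nat) \<Rightarrow> complex" where
  "outer_term q n \<alpha> \<beta> \<gamma> a b c d x k =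
     vandermonde_ratio q n x k
     * (numer_poly q n x a k / (\<Prod>r=1..n. \<Prod>s=1..n. qpoch q (q * x r / x s) (k r)))
     * ((1 - \<alpha> * q ^ (2 * msize n k)) * qpoch q \<alpha> (msize n k)
        / ((1 - \<alpha>) * qpoch q (\<alpha> * (\<Prod>r=1..n. a r) * q powi (1 - int n)) (msize n k)))
     * q powi ((\<Sum>r=1..n. (int r - 1) * int (k r)) - int n * int (msize n k))
     * inner_sum q n \<alpha> \<beta> \<gamma> b c d x k"

end

theory Submission
  imports Defs "HOL-Complex_Analysis.Complex_Analysis"
begin

text \<open>If \<open>a\<^sub>r = q\<^bsup>\<nu>\<^sub>r + 1\<^esup>\<close>, interchanging the two multiple sums leaves an inner sum over \<open>k\<close> that
  depends on \<open>k - m\<close> only through \<open>|k - m|\<close> and a kernel which Milne's fundamental lemma reduces to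
  one dimension. There it telescopes to \<open>0\<close> unless \<open>m = \<nu>\<close>, so the double sum collapses to the
  single term \<open>m = \<nu>\<close>, which is the product side.

  For general \<open>a\<close> both sides are analytic in each \<open>a\<^sub>j\<close>, and the points \<open>q\<^sup>N\<close> accumulate at \<open>0\<close>.
  Convergence requires a bound \<open>C \<rho>\<^bsup>|k|\<^esup>\<close> for the inner sum, for any
  \<open>\<rho> > max(|\<alpha>\<beta>|, |\<alpha>\<gamma>|)\<close>, although its individual terms grow superexponentially. The
  cancellation becomes visible by writing the inner sum as a product of first-order operators in
  the q-difference \<open>h \<mapsto> (h\<^sub>M - h\<^bsub>M+1\<^esub>) / q\<^sup>M\<close>, applied to a one-dimensional sequence.\<close>

section \<open>Finite q-shifted factorials\<close>

text \<open>One triangular array governs both sums: it is the parameter-free part of the inner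
  summand, taken at (k, m), and for a_r = q^(\<nu>_r + 1) also the a-dependent part of the outer
  summand, taken at (\<nu>, k). All information about it comes from one recurrence for its sums over
  a level |m| = M, whose coefficients are partial fractions in the nodes x_r q^(m_r). An extra
  denominator (u x_r)_(m_r) makes the recurrence send u to u q. The operators of the growth estimate
  satisfy the same recurrence; there is one for each point u x_s q^i with i < k_s. The estimate then
  rests on three facts: (c)_M is an eigenvector of the q-difference with eigenvalue c, so (\<alpha>
  q^|k|)_M has rapidly shrinking differences; multiplication by (c)_M is harmless for any rate above
  |c|; division by (c)_M keeps the rate. Hence the convergence conditions with \<beta> and \<gamma>:
  \<rho> |a_1 ... a_n / q^n| has to be less than 1 for some admissible \<rho>.\<close>

lemma qpoch_0 [simp]: "qpoch q z 0 = 1"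
  by (simp add: qpoch_def)

lemma qpoch_Suc: "qpoch q z (Suc k) = qpoch q z k * (1 - z * q ^ k)"
  by (simp add: qpoch_def)

lemma qpoch_zero_left [simp]: "qpoch q 0 k = 1"
  by (simp add: qpoch_def)

lemma qpoch_add: "qpoch q z (j + k) = qpoch q z j * qpoch q (z * q ^ j) k"
  by (induction k) (simp_all add: qpoch_Suc power_add mult_ac)

lemma qpoch_Suc': "qpoch q z (Suc k) = (1 - z) * qpoch q (z * q) k"
  using qpoch_add[of q z 1 k] by (simp add: qpoch_Suc)

lemma qpoch_eq_0_iff: "qpoch q z k = 0 \<longleftrightarrow> (\<exists>i<k. z * q ^ i = 1)"
  by (auto simp: qpoch_def)

text \<open>The factor of index i on the left is paired with the one of index M - 1 - i on the
  right; their quotient is - w q^i.\<close>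

lemma qpoch_reverse:
  assumes "q \<noteq> 0" "w \<noteq> 0"
  shows "qpoch q w M = (\<Prod>i<M. - w * q ^ i) * qpoch q (q powi (1 - int M) / w) M"
proof -
  have "qpoch q (q powi (1 - int M) / w) M = (\<Prod>i<M. 1 - q powi (1 - int M) / w * q ^ (M - Suc i))"
    unfolding qpoch_def by (rule prod.nat_diff_reindex[symmetric])
  moreover have "1 - w * q ^ i = (- w * q ^ i) * (1 - q powi (1 - int M) / w * q ^ (M - Suc i))"
    if "i < M" for i
  proof -
    have "q powi (1 - int M) * q ^ (M - Suc i) = q powi ((1 - int M) + int (M - Suc i))"
      using assms by (simp add: power_int_add)
    also have "(1 - int M) + int (M - Suc i) = - int i"
      using that by auto
    finally show ?thesis
      using assms by (simp add: field_simps power_int_minus)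
  qed
  ultimately show ?thesis
    by (simp add: qpoch_def flip: prod.distrib)
qed

text \<open>Reversing both factorials of length M leaves, on either side, the factorial of length M
  + j with base v = q^(1-M)/w, cut once after j factors and once after M. In the composition of two
  kernels this removes the shift j from the factorial of length M.\<close>

lemma qpoch_shift_exchange:
  assumes "q \<noteq> 0" "w \<noteq> 0"
  shows "qpoch q (w * q powi (- int j)) M * qpoch q (q powi (1 - int M) / w) j * q ^ (M * j)
    = qpoch q w M * qpoch q (q / w) j"
proof -
  define v where "v = q powi (1 - int M) / w"
  have 1: "q powi (1 - int M) / (w * q powi (- int j)) = v * q ^ j"
    using assms by (simp add: v_def power_int_minus field_simps)
  have 2: "v * q ^ M = q / w"
    using assms by (simp add: v_def power_int_diff)
  have 3: "(\<Prod>i<M. - (w * q powi (- int j)) * q ^ i) * q ^ (M * j) = (\<Prod>i<M. - w * q ^ i)"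
  proof -
    have "q ^ (M * j) = (\<Prod>i<M. q ^ j)" by (simp add: mult.commute flip: power_mult)
    then have "(\<Prod>i<M. - (w * q powi (- int j)) * q ^ i) * q ^ (M * j)
      = (\<Prod>i<M. - (w * q powi (- int j)) * q ^ i * q ^ j)"
      by (simp only: prod.distrib)
    also have "\<dots> = (\<Prod>i<M. - w * q ^ i)"
      using assms by (intro prod.cong) (auto simp: power_int_minus)
    finally show ?thesis .
  qed
  have "qpoch q (w * q powi (- int j)) M * qpoch q v j * q ^ (M * j)
     = (\<Prod>i<M. - w * q ^ i) * (qpoch q v j * qpoch q (v * q ^ j) M)"
    unfolding 3[symmetric] using qpoch_reverse[of q "w * q powi (- int j)" M] assms by (simp add: 1)
  also have "\<dots> = (\<Prod>i<M. - w * q ^ i) * (qpoch q v M * qpoch q (v * q ^ M) j)"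
    by (simp add: add.commute flip: qpoch_add)
  also have "\<dots> = qpoch q w M * qpoch q (q / w) j"
    using qpoch_reverse[of q w M] assms 2 by (simp add: v_def)
  finally show ?thesis by (simp add: v_def)
qed

section \<open>Partial fractions\<close>

text \<open>The partial fraction expansion of a quotient of monic polynomials of equal degree; the 1
  is its value at infinity. A new node j multiplies each old residue by (y_r - p_j)/(y_r - y_j),
  which splits into a part in 1/(t - y_r) and a part in 1/(y_r - y_j). By the induction hypothesis
  at t = y_j the latter parts cancel against the residue at the new node.\<close>

lemma partial_fractions:
  fixes y p :: "'i \<Rightarrow> 'a :: field"
  assumes "finite I" "inj_on y I" "t \<notin> y ` I"
  shows "(\<Sum>r\<in>I. (\<Prod>s\<in>I. y r - p s) / (\<Prod>s\<in>I - {r}. y r - y s) / (t - y r))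
    = (\<Prod>s\<in>I. (t - p s) / (t - y s)) - 1"
  using assms
proof (induction I arbitrary: t rule: finite_induct)
  case (insert j I)
  define c where "c r = (\<Prod>s\<in>I. y r - p s) / (\<Prod>s\<in>I - {r}. y r - y s)" for r
  have IH: "(\<Sum>r\<in>I. c r / (t - y r)) = (\<Prod>s\<in>I. (t - p s) / (t - y s)) - 1" if "t \<notin> y ` I" for t
    using insert.IH[OF _ that] insert.prems by (simp add: c_def)
  have yj: "y j \<noteq> y r" if "r \<in> I" for r
    using insert.prems insert.hyps that by (auto simp: inj_on_def)
  have tj: "t \<noteq> y j" and tr: "\<And>r. r \<in> I \<Longrightarrow> t \<noteq> y r"
    using insert.prems by auto
  have old: "(\<Prod>s\<in>insert j I. y r - p s) / (\<Prod>s\<in>insert j I - {r}. y r - y s) / (t - y r)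
     = (t - p j) / (t - y j) * (c r / (t - y r)) + (y j - p j) / (t - y j) * (c r / (y r - y j))"
    if r: "r \<in> I" for r
  proof -
    have "insert j I - {r} = insert j (I - {r})" using insert.hyps r by auto
    then have "(\<Prod>s\<in>insert j I. y r - p s) / (\<Prod>s\<in>insert j I - {r}. y r - y s) / (t - y r)
       = c r * ((y r - p j) / ((y r - y j) * (t - y r)))"
      using insert.hyps r by (simp add: c_def mult_ac)
    also have "(y r - p j) / ((y r - y j) * (t - y r))
       = (t - p j) / ((t - y j) * (t - y r)) + (y j - p j) / ((t - y j) * (y r - y j))"
      using tj tr[OF r] yj[OF r] by (simp add: divide_simps) (simp add: algebra_simps)
    finally show ?thesis by (simp add: field_simps)
  qed
  have new: "(\<Prod>s\<in>insert j I. y j - p s) / (\<Prod>s\<in>insert j I - {j}. y j - y s) / (t - y j)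
     = (y j - p j) / (t - y j) * ((\<Sum>r\<in>I. c r / (y j - y r)) + 1)"
  proof -
    have "insert j I - {j} = I" using insert.hyps by auto
    moreover have "(\<Sum>r\<in>I. c r / (y j - y r)) + 1 = (\<Prod>s\<in>I. (y j - p s) / (y j - y s))"
      using IH[of "y j"] yj by (simp add: image_iff)
    ultimately show ?thesis
      using insert.hyps by (simp add: prod_dividef)
  qed
  have neg: "(\<Sum>r\<in>I. c r / (y r - y j)) = - (\<Sum>r\<in>I. c r / (y j - y r))"
  proof -
    have "c r / (y r - y j) = - (c r / (y j - y r))" for r
      by (metis minus_diff_eq minus_divide_right)
    then show ?thesis by (simp add: sum_negf)
  qed
  have "(\<Sum>r\<in>insert j I. (\<Prod>s\<in>insert j I. y r - p s) / (\<Prod>s\<in>insert j I - {r}. y r - y s) / (t - y r))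
     = (y j - p j) / (t - y j) * ((\<Sum>r\<in>I. c r / (y j - y r)) + 1)
      + (\<Sum>r\<in>I. (t - p j) / (t - y j) * (c r / (t - y r)) + (y j - p j) / (t - y j) * (c r / (y r - y j)))"
    using insert.hyps new old by (simp add: sum.insert[OF insert.hyps(1,2)] cong: sum.cong)
  also have "\<dots> = (y j - p j) / (t - y j) + (t - p j) / (t - y j) * (\<Sum>r\<in>I. c r / (t - y r))"
    unfolding sum.distrib sum_distrib_left[symmetric] neg by (simp add: algebra_simps)
  also have "(\<Sum>r\<in>I. c r / (t - y r)) = (\<Prod>s\<in>I. (t - p s) / (t - y s)) - 1"
    using IH[of t] insert.prems by auto
  also have "(y j - p j) / (t - y j) + (t - p j) / (t - y j) * ((\<Prod>s\<in>I. (t - p s) / (t - y s)) - 1)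
     = (\<Prod>s\<in>insert j I. (t - p s) / (t - y s)) - 1"
  proof -
    have "(y j - p j) / (t - y j) = (t - p j) / (t - y j) - 1" using tj by (simp add: field_simps)
    then show ?thesis using insert.hyps by (simp add: right_diff_distrib)
  qed
  finally show ?case .
qed simp

lemma partial_fractions_at_0:
  fixes y p :: "'i \<Rightarrow> 'a :: field"
  assumes "finite I" "inj_on y I" "0 \<notin> y ` I"
  shows "(\<Sum>r\<in>I. (\<Prod>s\<in>I. y r - p s) / (y r * (\<Prod>s\<in>I - {r}. y r - y s)))
    = 1 - (\<Prod>s\<in>I. p s) / (\<Prod>s\<in>I. y s)"
proof -
  have "(\<Sum>r\<in>I. (\<Prod>s\<in>I. y r - p s) / (y r * (\<Prod>s\<in>I - {r}. y r - y s)))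
    = - (\<Sum>r\<in>I. (\<Prod>s\<in>I. y r - p s) / (\<Prod>s\<in>I - {r}. y r - y s) / (0 - y r))"
    by (simp add: sum_negf mult.commute)
  also have "\<dots> = 1 - (\<Prod>s\<in>I. p s) / (\<Prod>s\<in>I. y s)"
    using partial_fractions[OF assms, of p] by (simp add: prod_dividef)
  finally show ?thesis .
qed

text \<open>Written with u instead of the pole 1/u so that u = 0 is covered, where it becomes the
  evaluation at 0. For other u, the factor 1/(y (1 - u y)) splits into poles at 0 and at
  1/u.\<close>

lemma partial_fractions_extra_pole:
  fixes y p :: "'i \<Rightarrow> 'a :: field"
  assumes "finite I" "inj_on y I" "0 \<notin> y ` I" "\<And>r. r \<in> I \<Longrightarrow> u * y r \<noteq> 1"
  shows "(\<Sum>r\<in>I. (\<Prod>s\<in>I. y r - p s) / (y r * (\<Prod>s\<in>I - {r}. y r - y s)) / (1 - u * y r))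
    = (\<Prod>s\<in>I. (1 - u * p s) / (1 - u * y s)) - (\<Prod>s\<in>I. p s) / (\<Prod>s\<in>I. y s)"
proof (cases "u = 0")
  case True
  then show ?thesis using partial_fractions_at_0[OF assms(1-3), of p] by simp
next
  case False
  have t: "1 / u \<notin> y ` I"
  proof
    assume "1 / u \<in> y ` I"
    then obtain r where "r \<in> I" "y r = 1 / u" by auto
    then show False using assms(4)[of r] False by simp
  qed
  have split: "(\<Prod>s\<in>I. y r - p s) / (y r * (\<Prod>s\<in>I - {r}. y r - y s)) / (1 - u * y r)
    = (\<Prod>s\<in>I. y r - p s) / (y r * (\<Prod>s\<in>I - {r}. y r - y s))
      + (\<Prod>s\<in>I. y r - p s) / (\<Prod>s\<in>I - {r}. y r - y s) / (1 / u - y r)" if "r \<in> I" for r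
  proof -
    have "y r \<noteq> 0" "u * y r \<noteq> 1" "1 / u - y r \<noteq> 0" using assms(3,4) t that by auto
    then have "1 / (y r * (1 - u * y r)) = 1 / y r + 1 / (1 / u - y r)"
      using False by (simp add: divide_simps)
    moreover have "a / (y r * b) / (1 - u * y r) = a / b * (1 / (y r * (1 - u * y r)))"
      "a / (y r * b) = a / b * (1 / y r)" "a / b / (1 / u - y r) = a / b * (1 / (1 / u - y r))" for a b
      by (simp_all add: mult_ac)
    ultimately show ?thesis
      by (simp only: distrib_left)
  qed
  have "(\<Prod>s\<in>I. (1 / u - p s) / (1 / u - y s)) = (\<Prod>s\<in>I. (1 - u * p s) / (1 - u * y s))"
  proof (rule prod.cong)
    fix s assume "s \<in> I"
    have "(1 / u - z) = (1 - u * z) / u" for z using False by (simp add: field_simps)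
    then show "(1 / u - p s) / (1 / u - y s) = (1 - u * p s) / (1 - u * y s)" using False by simp
  qed simp
  then show ?thesis
    using partial_fractions[OF assms(1,2) t, of p] partial_fractions_at_0[OF assms(1-3), of p] split
    by (simp add: sum.distrib)
qed

section \<open>Milne's multiple sums\<close>

definition vprod :: "nat \<Rightarrow> (nat \<Rightarrow> 'a :: field) \<Rightarrow> 'a" where
  "vprod n y = (\<Prod>s=1..n. \<Prod>r=1..<s. y s - y r)"

lemma vprod_Suc: "vprod (Suc n) y = vprod n y * (\<Prod>r=1..n. y (Suc n) - y r)"
  by (simp add: vprod_def atLeastLessThanSuc_atLeastAtMost)

text \<open>Only the pairs containing r change, and the signs caused by the order of a pair are the
  same on both sides. The cross-multiplied form avoids dividing by differences of nodes.\<close>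

lemma vprod_update:
  assumes "r \<in> {1..n}"
  shows "vprod n y * (\<Prod>s\<in>{1..n} - {r}. z - y s) = vprod n (y(r := z)) * (\<Prod>s\<in>{1..n} - {r}. y r - y s)"
  using assms
proof (induction n)
  case (Suc n)
  show ?case
  proof (cases "r = Suc n")
    case True
    have "{1..Suc n} - {r} = {1..n}" using True by auto
    moreover have "vprod n (y(r := z)) = vprod n y"
      unfolding vprod_def using True by (intro prod.cong) auto
    ultimately show ?thesis
      using True by (simp only: vprod_Suc) (simp add: mult_ac)
  next
    case False
    then have r: "r \<in> {1..n}" using Suc.prems by auto
    have set: "{1..Suc n} - {r} = insert (Suc n) ({1..n} - {r})" using r by auto
    have rem: "(\<Prod>i=1..n. f i) = f r * (\<Prod>i\<in>{1..n} - {r}. f i)" for f :: "nat \<Rightarrow> 'a"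
      using r by (simp add: prod.remove)
    have upd: "(\<Prod>i\<in>{1..n} - {r}. y (Suc n) - (y(r := z)) i) = (\<Prod>i\<in>{1..n} - {r}. y (Suc n) - y i)"
      "(y(r := z)) (Suc n) = y (Suc n)" "(y(r := z)) r = z"
      using False by (auto intro!: prod.cong)
    have swap: "(A * (c * R)) * (d * P) = (B * (e * R)) * (f * Q)" if "A * P = B * Q" "c * d = e * f"
      for A B c d e f P Q R :: 'a
    proof -
      have "(A * (c * R)) * (d * P) = (A * P) * (c * d) * R" by (simp only: mult_ac)
      then show ?thesis by (simp only: that) (simp only: mult_ac)
    qed
    have ins: "(\<Prod>s\<in>insert (Suc n) ({1..n} - {r}). f s) = f (Suc n) * (\<Prod>s\<in>{1..n} - {r}. f s)"
      for f :: "nat \<Rightarrow> 'a"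
      by simp
    show ?thesis
      unfolding vprod_Suc set rem upd ins
      by (rule swap[OF Suc.IH[OF r]]) (simp add: algebra_simps)
  qed
qed simp

text \<open>Milne's kernel: the part of the inner summand that involves only q, x and the two
  multi-indices. It serves twice, since the outer summand at a_r = q^(\<nu>_r + 1) contains it with
  (\<nu>, k) in place of (k, m).\<close>

definition mterm :: "complex \<Rightarrow> nat \<Rightarrow> (nat \<Rightarrow> complex) \<Rightarrow> (nat \<Rightarrow> nat) \<Rightarrow> (nat \<Rightarrow> nat) \<Rightarrow> complex" where
  "mterm q n x k m = vandermonde_ratio q n x m
     * (\<Prod>r=1..n. \<Prod>s=1..n.
          qpoch q (q powi (- int (k s)) * (x r / x s)) (m r) / qpoch q (q * x r / x s) (m r))
     * q ^ (\<Sum>r=1..n. r * m r)"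

definition mlevel :: "nat \<Rightarrow> nat \<Rightarrow> (nat \<Rightarrow> nat) set" where
  "mlevel n M = {m \<in> multi_indices n. msize n m = M}"

lemma member_le_msize: "r \<in> {1..n} \<Longrightarrow> m r \<le> msize n m"
  unfolding msize_def by (rule member_le_sum) auto

lemma finite_mlevel [simp]: "finite (mlevel n M)"
proof (rule finite_subset)
  show "mlevel n M \<subseteq> {1..n} \<rightarrow>\<^sub>E {0..M}"
  proof
    fix m assume "m \<in> mlevel n M"
    then have m: "m \<in> extensional {1..n}" "msize n m = M"
      by (simp_all add: mlevel_def multi_indices_def PiE_iff)
    show "m \<in> {1..n} \<rightarrow>\<^sub>E {0..M}"
      using m member_le_msize[of _ n m] by (intro PiE_I) (auto simp: extensional_arb[OF m(1)])
  qed
qed (simp add: finite_PiE)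

lemma mlevel_0: "mlevel n 0 = {\<lambda>r\<in>{1..n}. 0}"
  unfolding mlevel_def multi_indices_def msize_def
  by (auto simp: PiE_iff extensional_def fun_eq_iff)

lemma msize_update: "r \<in> {1..n} \<Longrightarrow> msize n (m(r := Suc (m r))) = Suc (msize n m)"
proof -
  assume r: "r \<in> {1..n}"
  have "(\<Sum>i\<in>{1..n} - {r}. (m(r := Suc (m r))) i) = (\<Sum>i\<in>{1..n} - {r}. m i)"
    by (intro sum.cong) auto
  then show ?thesis using r by (simp add: msize_def sum.remove)
qed

text \<open>Raising the r-th entry is a bijection from level M onto the part of level M + 1 with
  positive r-th entry. In the recurrence below the other terms vanish because a residue has the
  factor y_r - x_r.\<close>

lemma sum_mlevel_Suc:
  fixes f :: "(nat \<Rightarrow> nat) \<Rightarrow> 'a :: comm_monoid_add"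
  assumes r: "r \<in> {1..n}" and zero: "\<And>m. m \<in> mlevel n (Suc M) \<Longrightarrow> m r = 0 \<Longrightarrow> f m = 0"
  shows "(\<Sum>m\<in>mlevel n (Suc M). f m) = (\<Sum>m\<in>mlevel n M. f (m(r := Suc (m r))))"
proof -
  have "(\<Sum>m\<in>mlevel n (Suc M). f m) = (\<Sum>m\<in>{m\<in>mlevel n (Suc M). m r \<noteq> 0}. f m)"
    by (rule sum.mono_neutral_right) (use zero in auto)
  also have "\<dots> = (\<Sum>m\<in>mlevel n M. f (m(r := Suc (m r))))"
  proof (rule sum.reindex_bij_witness[of _ "\<lambda>m. m(r := Suc (m r))" "\<lambda>m. m(r := m r - 1)"])
    fix m assume m: "m \<in> {m\<in>mlevel n (Suc M). m r \<noteq> 0}"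
    define m' where "m' = m(r := m r - 1)"
    have m': "m'(r := Suc (m' r)) = m" using m by (auto simp: m'_def)
    show "(m(r := m r - 1))(r := Suc ((m(r := m r - 1)) r)) = m"
      using m' by (simp add: m'_def)
    have "Suc (msize n m') = Suc M"
      using msize_update[OF r, of m'] m m' by (simp add: mlevel_def)
    then show "m(r := m r - 1) \<in> mlevel n M"
      using m r by (auto simp: mlevel_def multi_indices_def PiE_iff extensional_def m'_def)
    show "f ((m(r := m r - 1))(r := Suc ((m(r := m r - 1)) r))) = f m"
      using m' by (simp add: m'_def)
  next
    fix m assume m: "m \<in> mlevel n M"
    show "(m(r := Suc (m r)))(r := (m(r := Suc (m r))) r - 1) = m" by simp
    show "m(r := Suc (m r)) \<in> {m\<in>mlevel n (Suc M). m r \<noteq> 0}"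
      using m r msize_update[OF r, of m] by (auto simp: mlevel_def multi_indices_def PiE_iff extensional_def)
  qed
  finally show ?thesis .
qed

text \<open>The points x_r q^i form n disjoint strings, which keeps all denominators in q and x away
  from 0. With two free exponents the condition is stable under replacing x_r by x_r q^(m_r), as the
  composition of kernels requires.\<close>

locale q_strings =
  fixes q :: complex and n :: nat and x :: "nat \<Rightarrow> complex"
  assumes q_nz [simp]: "q \<noteq> 0" and norm_q: "norm q < 1"
    and x_nz [simp]: "s \<in> {1..n} \<Longrightarrow> x s \<noteq> 0"
    and separated: "r \<in> {1..n} \<Longrightarrow> s \<in> {1..n} \<Longrightarrow> x r * q ^ i = x s * q ^ j \<Longrightarrow> r = s"
begin

lemma q_power_inj: "q ^ i = q ^ j \<longleftrightarrow> i = j"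
proof
  assume "q ^ i = q ^ j"
  then have "norm q ^ i = norm q ^ j" by (metis norm_power)
  then show "i = j"
    using norm_q q_nz power_strict_decreasing_iff[of "norm q" i j] power_strict_decreasing_iff[of "norm q" j i]
    by force
qed auto

lemma q_power_neq_1: "0 < i \<Longrightarrow> q ^ i \<noteq> 1"
  using q_power_inj[of i 0] by simp

lemma qpoch_q_nz: "qpoch q q k \<noteq> 0"
  using q_power_neq_1[of "Suc _"] by (auto simp: qpoch_eq_0_iff)

lemma strings_eq_iff:
  "r \<in> {1..n} \<Longrightarrow> s \<in> {1..n} \<Longrightarrow> x r * q ^ i = x s * q ^ j \<longleftrightarrow> r = s \<and> i = j"
  using separated[of r s i j] by (auto simp: q_power_inj)

lemma strings_eq_iff_0:
  "r \<in> {1..n} \<Longrightarrow> s \<in> {1..n} \<Longrightarrow> x r * q ^ i = x s \<longleftrightarrow> r = s \<and> i = 0"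
  using strings_eq_iff[of r s i 0] by simp

lemma vprod_nz: "vprod n (\<lambda>r. x r * q ^ m r) \<noteq> 0"
  by (auto simp: vprod_def strings_eq_iff)

lemma qpoch_string_nz: "r \<in> {1..n} \<Longrightarrow> s \<in> {1..n} \<Longrightarrow> qpoch q (q * x r / x s) k \<noteq> 0"
  using strings_eq_iff_0[of r s "Suc _"] by (auto simp: qpoch_eq_0_iff field_simps)

text \<open>The index s is the larger one in s - 1 pairs. So (s - 1) m_s of the exponent s m_s
  clears the powers q^(-m_s) in these pairs, and the remaining m_s add up to |m|.\<close>

lemma vandermonde_ratio_eq_vprod:
  "vandermonde_ratio q n x m * q ^ (\<Sum>r=1..n. r * m r)
    = vprod n (\<lambda>r. x r * q ^ m r) / vprod n x * q ^ msize n m"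
proof -
  have pt: "(1 - q powi (int (m r) - int (m s)) * (x r / x s)) / (1 - x r / x s) * q ^ m s
     = (x s * q ^ m s - x r * q ^ m r) / (x s - x r)" if "s \<in> {1..n}" "r \<in> {1..<s}" for r s
  proof -
    have "x s \<noteq> 0" "x r \<noteq> x s"
      using that strings_eq_iff[of r s 0 0] by auto
    then show ?thesis by (simp add: power_int_diff field_simps)
  qed
  have "q ^ (\<Sum>s=1..n. s * m s) = (\<Prod>s=1..n. \<Prod>r=1..<s. q ^ m s) * q ^ msize n m"
  proof -
    have "(\<Sum>s=1..n. s * m s) = (\<Sum>s=1..n. (s - 1) * m s) + msize n m"
      unfolding msize_def sum.distrib[symmetric]
      by (intro sum.cong) (auto simp: algebra_simps)
    then show ?thesis by (simp add: power_add power_sum mult.commute flip: power_mult)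
  qed
  then have "vandermonde_ratio q n x m * q ^ (\<Sum>r=1..n. r * m r)
     = (\<Prod>s=1..n. \<Prod>r=1..<s. (1 - q powi (int (m r) - int (m s)) * (x r / x s)) / (1 - x r / x s) * q ^ m s)
        * q ^ msize n m"
    unfolding vandermonde_ratio_def prod.distrib by (simp only: mult.assoc)
  also have "\<dots> = (\<Prod>s=1..n. \<Prod>r=1..<s. (x s * q ^ m s - x r * q ^ m r) / (x s - x r)) * q ^ msize n m"
    by (intro arg_cong2[where f = "(*)"] prod.cong refl pt)
  also have "\<dots> = vprod n (\<lambda>r. x r * q ^ m r) / vprod n x * q ^ msize n m"
    by (simp add: vprod_def prod_dividef)
  finally show ?thesis .
qed

lemma mterm_eq_vprod:
  "mterm q n x k m = vprod n (\<lambda>r. x r * q ^ m r) / vprod n x * q ^ msize n m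
     * (\<Prod>r=1..n. \<Prod>s=1..n.
          qpoch q (q powi (- int (k s)) * (x r / x s)) (m r) / qpoch q (q * x r / x s) (m r))"
  unfolding mterm_def vandermonde_ratio_eq_vprod[symmetric] by (simp only: mult_ac)

lemma mterm_eq_0:
  assumes "r \<in> {1..n}" "k r < m r"
  shows "mterm q n x k m = 0"
proof -
  have "q powi (- int (k r)) * (x r / x r) * q ^ k r = 1"
    using assms by (simp add: power_int_minus)
  then have "qpoch q (q powi (- int (k r)) * (x r / x r)) (m r) = 0"
    using assms unfolding qpoch_eq_0_iff by blast
  then show ?thesis
    using assms by (auto simp: mterm_def intro!: bexI[of _ r])
qed

text \<open>The factor beside the raised term is the residue at node r for the nodes after raising
  and the zeros x_s. The factor on the right is, up to q^(-|k|), the residue for the nodes before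
  raising and the zeros x_s q^(k_s). Passing between levels thus trades one system of residues for
  the other.\<close>

lemma mterm_Suc:
  fixes m defines "y \<equiv> \<lambda>r. x r * q ^ m r"
  assumes r: "r \<in> {1..n}"
  shows "mterm q n x k (m(r := Suc (m r)))
        * ((\<Prod>s=1..n. q * y r - x s) / (q * y r * (\<Prod>s\<in>{1..n} - {r}. q * y r - y s)))
     = mterm q n x k m * (q powi (- int (msize n k))
        * ((\<Prod>s=1..n. y r - x s * q ^ k s) / (y r * (\<Prod>s\<in>{1..n} - {r}. y r - y s))))"
proof -
  define R where "R m = (\<Prod>r=1..n. \<Prod>s=1..n.
    qpoch q (q powi (- int (k s)) * (x r / x s)) (m r) / qpoch q (q * x r / x s) (m r))" for m
  define F where "F = (\<Prod>s=1..n. x s - q powi (- int (k s)) * y r)"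
  define G where "G = (\<Prod>s=1..n. x s - q * y r)"
  define D where "D = (\<Prod>s\<in>{1..n} - {r}. y r - y s)"
  define E where "E = (\<Prod>s\<in>{1..n} - {r}. q * y r - y s)"
  have yr: "y r \<noteq> 0" using r by (simp add: y_def)
  have D: "D \<noteq> 0" using r by (auto simp: D_def y_def strings_eq_iff)
  have qy: "q * y r = x r * q ^ Suc (m r)" by (simp add: y_def)
  have E: "E \<noteq> 0" using r unfolding E_def qy by (auto simp: y_def strings_eq_iff simp del: power_Suc)
  have G: "G \<noteq> 0"
  proof -
    have "x s - q * y r \<noteq> 0" if "s \<in> {1..n}" for s
      using strings_eq_iff_0[OF r that, of "Suc (m r)"] unfolding qy by (metis eq_iff_diff_eq_0 nat.distinct(1))
    then show ?thesis by (simp add: G_def)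
  qed
  have y': "(\<lambda>s. x s * q ^ (m(r := Suc (m r))) s) = y(r := q * y r)"
    by (auto simp: y_def fun_eq_iff)
  have V: "vprod n (y(r := q * y r)) * D = vprod n y * E"
    using vprod_update[OF r, of y "q * y r"] by (simp add: D_def E_def)
  have RS: "R (m(r := Suc (m r))) = R m * (F / G)"
  proof -
    define t where "t m i = (\<Prod>s=1..n.
      qpoch q (q powi (- int (k s)) * (x i / x s)) (m i) / qpoch q (q * x i / x s) (m i))" for m i
    have "qpoch q (q powi (- int (k s)) * (x r / x s)) (Suc (m r)) / qpoch q (q * x r / x s) (Suc (m r))
      = qpoch q (q powi (- int (k s)) * (x r / x s)) (m r) / qpoch q (q * x r / x s) (m r)
         * ((x s - q powi (- int (k s)) * y r) / (x s - q * y r))" if "s \<in> {1..n}" for s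
    proof -
      have "1 - q powi (- int (k s)) * (x r / x s) * q ^ m r = (x s - q powi (- int (k s)) * y r) / x s"
        "1 - q * x r / x s * q ^ m r = (x s - q * y r) / x s"
        using that by (simp_all add: y_def field_simps)
      then show ?thesis using that by (simp add: qpoch_Suc)
    qed
    then have "t (m(r := Suc (m r))) r = t m r * (F / G)"
      unfolding t_def F_def G_def prod_dividef[symmetric] prod.distrib[symmetric] fun_upd_same
      by (intro prod.cong refl)
    moreover have "(\<Prod>i\<in>{1..n} - {r}. t (m(r := Suc (m r))) i) = (\<Prod>i\<in>{1..n} - {r}. t m i)"
      by (intro prod.cong) (auto simp: t_def)
    moreover have "R m = t m r * (\<Prod>i\<in>{1..n} - {r}. t m i)" for m
      unfolding R_def t_def by (rule prod.remove) (use r in auto)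
    ultimately show ?thesis by (simp only: mult_ac)
  qed
  have FG: "(\<Prod>s=1..n. q * y r - x s) = (-1) ^ n * G"
    "q powi (- int (msize n k)) * (\<Prod>s=1..n. y r - x s * q ^ k s) = (-1) ^ n * F"
  proof -
    have "q * y r - x s = (-1) * (x s - q * y r)" for s by simp
    then have "(\<Prod>s=1..n. q * y r - x s) = (\<Prod>s=1..n. (-1) * (x s - q * y r))" by simp
    then show "(\<Prod>s=1..n. q * y r - x s) = (-1) ^ n * G"
      unfolding G_def prod.distrib by simp
    have "q powi (- int (msize n k)) = (\<Prod>s=1..n. q powi (- int (k s)))"
      unfolding msize_def power_int_minus power_int_of_nat power_sum
      by (simp add: prod_inversef[symmetric] o_def)
    moreover have "q powi (- int (k s)) * (y r - x s * q ^ k s) = (-1) * (x s - q powi (- int (k s)) * y r)" for s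
      by (simp add: power_int_minus field_simps)
    ultimately show "q powi (- int (msize n k)) * (\<Prod>s=1..n. y r - x s * q ^ k s) = (-1) ^ n * F"
      unfolding F_def by (simp only: prod.distrib[symmetric]) (simp only: prod.distrib, simp)
  qed
  have mt: "mterm q n x k m = vprod n (\<lambda>r. x r * q ^ m r) / vprod n x * q ^ msize n m * R m" for m
    by (simp only: mterm_eq_vprod R_def)
  have "mterm q n x k (m(r := Suc (m r))) = vprod n (y(r := q * y r)) / vprod n x * q ^ Suc (msize n m) * (R m * (F / G))"
    unfolding mt y' msize_update[OF r] RS ..
  moreover have "mterm q n x k m = vprod n y / vprod n x * q ^ msize n m * R m"
    unfolding mt y_def ..
  moreover have "vprod n (y(r := q * y r)) = vprod n y * E / D"
    using V D by (simp add: field_simps)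
  moreover have "q powi (- int (msize n k)) * ((\<Prod>s=1..n. y r - x s * q ^ k s) / (y r * D)) = (-1) ^ n * F / (y r * D)"
    using FG(2) by simp
  ultimately show ?thesis
    unfolding FG(1) D_def[symmetric] E_def[symmetric]
    using D E G yr by (simp add: mult_ac)
qed

section \<open>The recurrence for sums over a level\<close>

definition msum :: "(nat \<Rightarrow> nat) \<Rightarrow> complex \<Rightarrow> nat \<Rightarrow> complex" where
  "msum k u M = (\<Sum>m\<in>mlevel n M. mterm q n x k m / (\<Prod>r=1..n. qpoch q (u * x r) (m r)))"

lemma msum_0: "msum k u 0 = 1"
proof -
  have "vandermonde_ratio q n x (\<lambda>r\<in>{1..n}. 0) = 1"
  proof -
    have "(1 - q powi (int ((\<lambda>r\<in>{1..n}. 0) r) - int ((\<lambda>r\<in>{1..n}. 0) s)) * (x r / x s)) / (1 - x r / x s) = 1"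
      if "s \<in> {1..n}" "r \<in> {1..<s}" for r s
      using that strings_eq_iff[of r s 0 0] by auto
    then show ?thesis unfolding vandermonde_ratio_def by (intro prod.neutral ballI)
  qed
  then show ?thesis by (simp add: msum_def mlevel_0 mterm_def)
qed

text \<open>On level M + 1 the residues with zeros x_s add up to the constant 1 - 1/q^(M+1) and can
  be inserted under the sum. Each summand so obtained comes from level M by raising one entry. There
  the residues with zeros x_s q^(k_s), divided by 1 - u y_r, add up to a product minus a constant;
  the product turns u into u q, the constant leaves u alone.\<close>

lemma msum_Suc:
  assumes u: "\<And>r i. r \<in> {1..n} \<Longrightarrow> u * x r * q ^ i \<noteq> 1"
  shows "(1 - 1 / q ^ Suc M) * msum k u (Suc M)
    = q powi (- int (msize n k)) * (\<Prod>s=1..n. (1 - u * x s * q ^ k s) / (1 - u * x s)) * msum k (u * q) M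
      - msum k u M / q ^ M"
proof -
  define y where "y m r = x r * q ^ m r" for m r
  define W where "W u m = mterm q n x k m / (\<Prod>r=1..n. qpoch q (u * x r) (m r))" for u m
  define \<phi> where "\<phi> m r = (\<Prod>s=1..n. y m r - x s) / (y m r * (\<Prod>s\<in>{1..n} - {r}. y m r - y m s))" for m r
  define \<psi> where "\<psi> m r = (\<Prod>s=1..n. y m r - x s * q ^ k s) / (y m r * (\<Prod>s\<in>{1..n} - {r}. y m r - y m s))" for m r
  have inj: "inj_on (y m) {1..n}" for m
    by (auto simp: inj_on_def y_def strings_eq_iff)
  have y0: "0 \<notin> y m ` {1..n}" for m
    by (auto simp: y_def)
  have prod_y: "(\<Prod>s=1..n. y m s) = (\<Prod>s=1..n. x s) * q ^ msize n m" for m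
    by (simp add: y_def prod.distrib msize_def power_sum)
  have prod_x: "(\<Prod>s=1..n. x s) \<noteq> 0" by auto
  have phi: "(\<Sum>r=1..n. \<phi> m r) = 1 - 1 / q ^ Suc M" if "m \<in> mlevel n (Suc M)" for m
    using that partial_fractions_at_0[OF _ inj[of m] y0, of x] prod_x
    by (simp add: \<phi>_def prod_y mlevel_def del: One_nat_def)
  have yu: "u * y m r \<noteq> 1" if "r \<in> {1..n}" for m r
    using u[OF that] by (simp add: y_def mult.assoc)
  have psi: "(\<Sum>r=1..n. \<psi> m r / (1 - u * y m r))
     = (\<Prod>s=1..n. (1 - u * x s * q ^ k s) / (1 - u * y m s)) - q ^ msize n k / q ^ M" if "m \<in> mlevel n M" for m
  proof -
    have "(\<Prod>s=1..n. x s * q ^ k s) = (\<Prod>s=1..n. x s) * q ^ msize n k"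
      by (simp add: prod.distrib msize_def power_sum)
    then show ?thesis
      using that partial_fractions_extra_pole[OF _ inj[of m] y0, of u "\<lambda>s. x s * q ^ k s"] prod_x
      by (simp add: \<psi>_def prod_y mlevel_def yu mult.assoc[of u] del: One_nat_def)
  qed
  have step: "W u (m(r := Suc (m r))) * \<phi> (m(r := Suc (m r))) r
     = q powi (- int (msize n k)) * (W u m * (\<psi> m r / (1 - u * y m r)))" if r: "r \<in> {1..n}" for m r
  proof -
    have y1: "y (m(r := Suc (m r))) r = q * y m r" by (simp add: y_def)
    have y2: "(\<Prod>s\<in>{1..n} - {r}. q * y m r - y (m(r := Suc (m r))) s) = (\<Prod>s\<in>{1..n} - {r}. q * y m r - y m s)"
      by (intro prod.cong) (auto simp: y_def)
    have "(\<Prod>i=1..n. qpoch q (u * x i) ((m(r := Suc (m r))) i)) = (1 - u * y m r) * (\<Prod>i=1..n. qpoch q (u * x i) (m i))"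
    proof -
      have "(\<Prod>i\<in>{1..n} - {r}. qpoch q (u * x i) ((m(r := Suc (m r))) i)) = (\<Prod>i\<in>{1..n} - {r}. qpoch q (u * x i) (m i))"
        by (intro prod.cong) auto
      then show ?thesis using r by (simp add: prod.remove qpoch_Suc y_def mult_ac)
    qed
    then have "W u (m(r := Suc (m r))) * \<phi> (m(r := Suc (m r))) r
      = (mterm q n x k (m(r := Suc (m r)))
        * ((\<Prod>s=1..n. q * y m r - x s) / (q * y m r * (\<Prod>s\<in>{1..n} - {r}. q * y m r - y m s))))
        / ((1 - u * y m r) * (\<Prod>i=1..n. qpoch q (u * x i) (m i)))"
      unfolding W_def \<phi>_def y1 y2 by simp
    also have "\<dots> = (mterm q n x k m * (q powi (- int (msize n k)) * \<psi> m r))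
        / ((1 - u * y m r) * (\<Prod>i=1..n. qpoch q (u * x i) (m i)))"
      using mterm_Suc[OF r, of k m] by (simp add: y_def \<psi>_def)
    also have "\<dots> = q powi (- int (msize n k)) * (W u m * (\<psi> m r / (1 - u * y m r)))"
      by (simp add: W_def mult_ac)
    finally show ?thesis .
  qed
  \<comment> \<open>This is (z)_m (1 - z q^m) = (1 - z) (z q)_m at z = u x_s, for every s.\<close>
  have shift: "W u m * (\<Prod>s=1..n. (1 - u * x s * q ^ k s) / (1 - u * y m s))
     = (\<Prod>s=1..n. (1 - u * x s * q ^ k s) / (1 - u * x s)) * W (u * q) m" for m
  proof -
    have "qpoch q (u * x s) (m s) * (1 - u * y m s) = (1 - u * x s) * qpoch q (u * q * x s) (m s)" for s
      using qpoch_Suc[of q "u * x s" "m s"] qpoch_Suc'[of q "u * x s" "m s"] by (simp add: y_def mult_ac)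
    then have "(\<Prod>s=1..n. qpoch q (u * x s) (m s)) * (\<Prod>s=1..n. 1 - u * y m s)
       = (\<Prod>s=1..n. 1 - u * x s) * (\<Prod>s=1..n. qpoch q (u * q * x s) (m s))"
      by (simp flip: prod.distrib)
    moreover have "(\<Prod>s=1..n. 1 - u * y m s) \<noteq> 0" "(\<Prod>s=1..n. 1 - u * x s) \<noteq> 0"
      "(\<Prod>s=1..n. qpoch q (u * x s) (m s)) \<noteq> 0" "(\<Prod>s=1..n. qpoch q (u * q * x s) (m s)) \<noteq> 0"
      using u[of _ 0] u[of _ "Suc _"] u yu by (auto simp: qpoch_eq_0_iff mult_ac)
    ultimately show ?thesis
      unfolding W_def prod_dividef by (simp add: divide_simps)
  qed
  have "(1 - 1 / q ^ Suc M) * msum k u (Suc M) = (\<Sum>m\<in>mlevel n (Suc M). (1 - 1 / q ^ Suc M) * W u m)"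
    by (simp only: msum_def W_def sum_distrib_left)
  also have "\<dots> = (\<Sum>m\<in>mlevel n (Suc M). \<Sum>r=1..n. W u m * \<phi> m r)"
    by (intro sum.cong refl) (simp only: phi sum_distrib_left[symmetric] mult.commute)
  also have "\<dots> = (\<Sum>r=1..n. \<Sum>m\<in>mlevel n (Suc M). W u m * \<phi> m r)"
    by (rule sum.swap)
  also have "\<dots> = (\<Sum>r=1..n. \<Sum>m\<in>mlevel n M. W u (m(r := Suc (m r))) * \<phi> (m(r := Suc (m r))) r)"
  proof (rule sum.cong)
    fix r assume r: "r \<in> {1..n}"
    show "(\<Sum>m\<in>mlevel n (Suc M). W u m * \<phi> m r)
      = (\<Sum>m\<in>mlevel n M. W u (m(r := Suc (m r))) * \<phi> (m(r := Suc (m r))) r)"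
      by (rule sum_mlevel_Suc[OF r]) (use r in \<open>auto simp: \<phi>_def y_def\<close>)
  qed simp
  also have "\<dots> = (\<Sum>m\<in>mlevel n M. q powi (- int (msize n k)) * (W u m * (\<Sum>r=1..n. \<psi> m r / (1 - u * y m r))))"
    by (subst sum.swap) (simp only: sum_distrib_left step cong: sum.cong)
  also have "\<dots> = (\<Sum>m\<in>mlevel n M. q powi (- int (msize n k))
       * ((\<Prod>s=1..n. (1 - u * x s * q ^ k s) / (1 - u * x s)) * W (u * q) m) - W u m / q ^ M)"
  proof (rule sum.cong)
    fix m assume m: "m \<in> mlevel n M"
    show "q powi (- int (msize n k)) * (W u m * (\<Sum>r=1..n. \<psi> m r / (1 - u * y m r)))
      = q powi (- int (msize n k))
         * ((\<Prod>s=1..n. (1 - u * x s * q ^ k s) / (1 - u * x s)) * W (u * q) m) - W u m / q ^ M"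
      unfolding psi[OF m] shift[symmetric] by (simp add: power_int_minus field_simps)
  qed simp
  also have "\<dots> = q powi (- int (msize n k)) * (\<Prod>s=1..n. (1 - u * x s * q ^ k s) / (1 - u * x s)) * msum k (u * q) M
      - msum k u M / q ^ M"
    by (simp only: msum_def W_def sum_subtractf sum_divide_distrib mult.assoc sum_distrib_left)
  finally show ?thesis .
qed

text \<open>At u = 0 both sums on the right of the recurrence coincide, so it is of first order in M
  and sees k only through |k|. This is the reduction from n dimensions to one.\<close>

lemma milne_fundamental_lemma:
  "msum k 0 M = qpoch q (q powi (- int (msize n k))) M * q ^ M / qpoch q q M"
proof (induction M)
  case (Suc M)
  have nz: "1 - 1 / q ^ Suc M \<noteq> 0" "1 - q * q ^ M \<noteq> 0"
    using q_power_neq_1[of "Suc M"] by auto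
  have "(1 - 1 / q ^ Suc M) * msum k 0 (Suc M) = (q powi (- int (msize n k)) - 1 / q ^ M) * msum k 0 M"
    using msum_Suc[of 0 M k] by (simp add: algebra_simps)
  also have "\<dots> = (1 - 1 / q ^ Suc M)
     * (qpoch q (q powi (- int (msize n k))) (Suc M) * q ^ Suc M / qpoch q q (Suc M))"
    using nz qpoch_q_nz[of M] unfolding Suc.IH by (simp add: qpoch_Suc) (simp add: field_simps)
  finally show ?case using nz(1) unfolding mult_cancel_left by blast
qed (simp add: msum_0)

end

section \<open>A q-difference calculus for sequences\<close>

text \<open>Its eigenvectors are the sequences \<open>qpoch q c\<close>, with eigenvalue c.\<close>

definition qdiff :: "complex \<Rightarrow> (nat \<Rightarrow> complex) \<Rightarrow> nat \<Rightarrow> complex" where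
  "qdiff q h M = (h M - h (Suc M)) / q ^ M"

text \<open>The numerator that arises when the q-difference D is applied to
  \<open>h M / qpoch q p M\<close>. Dividing D - p by 1 - p makes the operator fix the unit sequence
  at 0, in accordance with the level sum for M = 0 being 1.\<close>

definition qstep :: "complex \<Rightarrow> complex \<Rightarrow> (nat \<Rightarrow> complex) \<Rightarrow> nat \<Rightarrow> complex" where
  "qstep q p h M = (qdiff q h M - p * h M) / (1 - p)"

lemma qdiff_lincomb: "qdiff q (\<lambda>M. a * g M + b * h M) = (\<lambda>M. a * qdiff q g M + b * qdiff q h M)"
  by (rule ext) (simp add: qdiff_def add_divide_distrib diff_divide_distrib algebra_simps)

lemma qdiff_pow_lincomb:
  "(qdiff q ^^ j) (\<lambda>M. a * g M + b * h M) = (\<lambda>M. a * (qdiff q ^^ j) g M + b * (qdiff q ^^ j) h M)"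
  by (induction j) (simp_all add: qdiff_lincomb)

lemma qstep_eq: "qstep q p h = (\<lambda>M. (1 / (1 - p)) * qdiff q h M + (- p / (1 - p)) * h M)"
  by (rule ext) (simp add: qstep_def diff_divide_distrib)

lemma qstep_lincomb: "qstep q p (\<lambda>M. a * g M + b * h M) = (\<lambda>M. a * qstep q p g M + b * qstep q p h M)"
  unfolding qstep_eq qdiff_lincomb by (rule ext) (simp add: algebra_simps)

lemma qdiff_qstep: "qdiff q (qstep q p h) = qstep q p (qdiff q h)"
  unfolding qstep_eq qdiff_lincomb ..

lemma qdiff_pow_qstep: "(qdiff q ^^ j) (qstep q p h) = qstep q p ((qdiff q ^^ j) h)"
  by (induction j) (simp_all add: qdiff_qstep)

abbreviation qsteps :: "complex \<Rightarrow> complex list \<Rightarrow> (nat \<Rightarrow> complex) \<Rightarrow> nat \<Rightarrow> complex" where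
  "qsteps q ps h \<equiv> foldr (qstep q) ps h"

lemma qsteps_lincomb:
  "qsteps q ps (\<lambda>M. a * g M + b * h M) = (\<lambda>M. a * qsteps q ps g M + b * qsteps q ps h M)"
  by (induction ps) (simp_all add: qstep_lincomb)

lemma qdiff_qsteps: "qdiff q (qsteps q ps h) = qsteps q ps (qdiff q h)"
  by (induction ps) (simp_all add: qdiff_qstep)

text \<open>Each step looks one index further ahead. Hence a sequence may be replaced by a finite
  combination of unit sequences.\<close>

lemma qsteps_local:
  assumes "\<And>j. j \<le> length ps + M \<Longrightarrow> g j = h j"
  shows "qsteps q ps g M = qsteps q ps h M"
  using assms
proof (induction ps arbitrary: M)
  case (Cons p ps)
  then show ?case by (simp add: qstep_def qdiff_def)
qed simp

lemma qsteps_zero: "qsteps q ps (\<lambda>_. 0) = (\<lambda>_. 0)"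
  by (induction ps) (simp_all add: qstep_def qdiff_def)

lemma qsteps_sum:
  assumes "finite J"
  shows "qsteps q ps (\<lambda>M. \<Sum>j\<in>J. c j * g j M) = (\<lambda>M. \<Sum>j\<in>J. c j * qsteps q ps (g j) M)"
  using assms
proof (induction J rule: finite_induct)
  case (insert j J)
  then show ?case
    using qsteps_lincomb[of q ps "c j" "g j" 1 "\<lambda>M. \<Sum>j\<in>J. c j * g j M"] by simp
qed (simp add: qsteps_zero)

text \<open>At M + 1 the q-difference of h is 1/q times that of the shifted sequence, so a step at p
  becomes a multiple of a step at p q. This mirrors the passage from u to u q in the recurrence for
  level sums.\<close>

lemma qsteps_shift:
  assumes "q \<noteq> 0" "\<And>p. p \<in> set ps \<Longrightarrow> p * q \<noteq> 1"
  shows "qsteps q ps h (Suc M)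
    = (\<Prod>p\<leftarrow>ps. (1 - p * q) / (q * (1 - p))) * qsteps q (map (\<lambda>p. p * q) ps) (\<lambda>M. h (Suc M)) M"
  using assms(2)
proof (induction ps arbitrary: M)
  case (Cons p ps)
  define c where "c = (\<Prod>p\<leftarrow>ps. (1 - p * q) / (q * (1 - p)))"
  define g where "g = qsteps q (map (\<lambda>p. p * q) ps) (\<lambda>M. h (Suc M))"
  have IH: "qsteps q ps h (Suc M) = c * g M" for M
    using Cons by (simp add: c_def g_def)
  have "qsteps q (p # ps) h (Suc M) = ((c * g M - c * g (Suc M)) / q ^ Suc M - p * (c * g M)) / (1 - p)"
    by (simp add: qstep_def qdiff_def IH)
  also have "\<dots> = (1 - p * q) / (q * (1 - p)) * c * qstep q (p * q) g M"
  proof -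
    have "1 - p * q \<noteq> 0" using Cons.prems[of p] by simp
    then show ?thesis
      using assms(1) by (simp add: qstep_def qdiff_def divide_simps) (simp add: algebra_simps)
  qed
  finally show ?case by (simp add: c_def g_def)
qed simp

lemma qsteps_delta_0:
  assumes "\<And>p. p \<in> set ps \<Longrightarrow> p \<noteq> 1"
  shows "qsteps q ps (\<lambda>j. if j = 0 then 1 else 0) = (\<lambda>j. if j = 0 then 1 else 0)"
  using assms by (induction ps) (auto simp: qstep_def qdiff_def fun_eq_iff)

text \<open>A twisted Leibniz rule: the difference of h carries the weight (c)_(M+1) = (1 - c) (c
  q)_M. The base moves from c to c q, and so the constants collected by iteration form a convergent
  product.\<close>

lemma qdiff_qpoch_mult:
  assumes "q \<noteq> 0"
  shows "qdiff q (\<lambda>M. qpoch q c M * h M)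
    = (\<lambda>M. c * (qpoch q c M * h M) + (1 - c) * (qpoch q (c * q) M * qdiff q h M))"
proof
  fix M
  have "(1 - c) * qpoch q (c * q) M = qpoch q c M * (1 - c * q ^ M)"
    using qpoch_Suc[of q c M] qpoch_Suc'[of q c M] by simp
  then have "(1 - c) * (qpoch q (c * q) M * qdiff q h M) = qpoch q c M * (1 - c * q ^ M) * qdiff q h M"
    by (metis mult.assoc)
  moreover have "qdiff q (\<lambda>M. qpoch q c M * h M) M
    = c * (qpoch q c M * h M) + qpoch q c M * (1 - c * q ^ M) * qdiff q h M"
    using assms by (simp add: qdiff_def qpoch_Suc divide_simps) (simp add: algebra_simps)
  ultimately show "qdiff q (\<lambda>M. qpoch q c M * h M) M
    = c * (qpoch q c M * h M) + (1 - c) * (qpoch q (c * q) M * qdiff q h M)"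
    by (simp only:)
qed

lemma qdiff_pow_qpoch: "q \<noteq> 0 \<Longrightarrow> (qdiff q ^^ j) (qpoch q c) = (\<lambda>M. c ^ j * qpoch q c M)"
proof (induction j)
  case (Suc j)
  have "qdiff q (\<lambda>_. 1) = (\<lambda>_. 0)" by (simp add: qdiff_def fun_eq_iff)
  then have "qdiff q (\<lambda>M. qpoch q c M) = (\<lambda>M. c * qpoch q c M)"
    using qdiff_qpoch_mult[OF Suc.prems, of c "\<lambda>_. 1"] by simp
  then show ?case
    using Suc qdiff_lincomb[of q "c ^ j" "qpoch q c" 0 "\<lambda>_. 0"] by (simp add: mult_ac)
qed simp

text \<open>The quotient counterpart: the result is again a sequence over a shifted factorial, now
  with base c q, and can be differenced again.\<close>

lemma qdiff_qpoch_divide: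
  assumes "q \<noteq> 0" "\<And>j. qpoch q c j \<noteq> 0"
  shows "qdiff q (\<lambda>M. h M / qpoch q c M) = (\<lambda>M. qstep q c h M / qpoch q (c * q) M)"
proof
  fix M
  have "(1 - c) * qpoch q (c * q) M = qpoch q c M * (1 - c * q ^ M)"
    using qpoch_Suc[of q c M] qpoch_Suc'[of q c M] by simp
  moreover have "1 - c * q ^ M \<noteq> 0" "1 - c \<noteq> 0" "qpoch q (c * q) M \<noteq> 0" "qpoch q c M \<noteq> 0"
    using assms(2)[of "Suc M"] qpoch_Suc[of q c M] qpoch_Suc'[of q c M] by auto
  ultimately have eq: "qstep q c h M / qpoch q (c * q) M
    = (qdiff q h M - c * h M) / (qpoch q c M * (1 - c * q ^ M))"
    by (simp add: qstep_def)
  show "qdiff q (\<lambda>M. h M / qpoch q c M) M = qstep q c h M / qpoch q (c * q) M"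
    unfolding eq using assms(1) \<open>1 - c * q ^ M \<noteq> 0\<close> \<open>qpoch q c M \<noteq> 0\<close>
    by (simp add: qdiff_def qpoch_Suc divide_simps) (simp add: algebra_simps)
qed

section \<open>Growth estimates\<close>

lemma prod_one_plus_geometric_le:
  fixes a r :: real
  assumes "0 \<le> a" "0 \<le> r" "r < 1"
  shows "(\<Prod>i<j. 1 + a * r ^ i) \<le> exp (a / (1 - r))"
proof -
  have "(\<Prod>i<j. 1 + a * r ^ i) \<le> (\<Prod>i<j. exp (a * r ^ i))"
    using assms by (intro prod_mono) (auto simp: exp_ge_add_one_self add_nonneg_nonneg)
  also have "\<dots> = exp (a * (\<Sum>i<j. r ^ i))"
    by (simp add: exp_sum sum_distrib_left)
  also have "(\<Sum>i<j. r ^ i) \<le> 1 / (1 - r)"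
    using assms sum_le_suminf[of "\<lambda>i. r ^ i" "{..<j}"] by (simp add: suminf_geometric summable_geometric)
  then have "exp (a * (\<Sum>i<j. r ^ i)) \<le> exp (a / (1 - r))"
    using assms mult_left_mono[of "\<Sum>i<j. r ^ i" "1 / (1 - r)" a] by simp
  finally show ?thesis .
qed

lemma norm_qpoch_le:
  assumes "norm q < 1"
  shows "norm (qpoch q c j) \<le> exp (norm c / (1 - norm q))"
proof -
  have "norm (qpoch q c j) \<le> (\<Prod>i<j. 1 + norm c * norm q ^ i)"
    unfolding qpoch_def prod_norm[symmetric]
    by (intro prod_mono) (metis norm_ge_zero norm_mult norm_one norm_power norm_triangle_ineq4)
  also have "\<dots> \<le> exp (norm c / (1 - norm q))"
    using assms by (intro prod_one_plus_geometric_le) auto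
  finally show ?thesis .
qed

section \<open>Infinite products and lower bounds for shifted factorials\<close>

lemma convergent_prod_qpoch:
  fixes q c :: complex
  assumes "norm q < 1"
  shows "convergent_prod (\<lambda>i. 1 - c * q ^ i)"
proof -
  have "summable (\<lambda>i. norm (1 - c * q ^ i - 1))"
    using assms by (auto simp: norm_mult norm_power intro!: summable_geometric summable_mult)
  then show ?thesis
    by (intro abs_convergent_prod_imp_convergent_prod summable_imp_abs_convergent_prod)
qed

lemma qpoch_tendsto:
  assumes "norm q < 1"
  shows "qpoch q c \<longlonglongrightarrow> qpoch_inf q c"
proof -
  have "(\<lambda>j. \<Prod>i\<le>j. 1 - c * q ^ i) \<longlonglongrightarrow> qpoch_inf q c"
    unfolding qpoch_inf_def by (rule convergent_prod_LIMSEQ[OF convergent_prod_qpoch[OF assms]])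
  then have "(\<lambda>j. qpoch q c (Suc j)) \<longlonglongrightarrow> qpoch_inf q c"
    by (simp add: qpoch_def lessThan_Suc_atMost)
  then show ?thesis
    by (simp only: filterlim_sequentially_Suc)
qed

lemma qpoch_inf_nz:
  assumes "norm q < 1" "\<And>i. c * q ^ i \<noteq> 1"
  shows "qpoch_inf q c \<noteq> 0"
  unfolding qpoch_inf_def
  using assms by (intro prodinf_nonzero convergent_prod_qpoch) auto

lemma qpoch_inf_nz_qpoch:
  assumes "norm q < 1" "\<And>j. qpoch q z j \<noteq> 0"
  shows "qpoch_inf q z \<noteq> 0"
proof (rule qpoch_inf_nz[OF assms(1)])
  show "z * q ^ i \<noteq> 1" for i
    using assms(2)[of "Suc i"] by (auto simp: qpoch_Suc)
qed

text \<open>The infinite product is nonzero, so the reciprocals of the partial products converge and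
  are therefore bounded.\<close>

lemma qpoch_bounded_below:
  assumes "norm q < 1" "\<And>j. qpoch q c j \<noteq> 0"
  obtains \<delta> where "\<delta> > 0" "\<And>j. \<delta> \<le> norm (qpoch q c j)"
proof -
  have "qpoch_inf q c \<noteq> 0"
    by (rule qpoch_inf_nz_qpoch[OF assms])
  then have "Bseq (\<lambda>j. inverse (qpoch q c j))"
    by (intro convergent_imp_Bseq convergentI[OF tendsto_inverse[OF qpoch_tendsto[OF assms(1)]]])
  then obtain K where K: "K > 0" "\<And>j. norm (inverse (qpoch q c j)) \<le> K"
    by (metis BseqE)
  show thesis
  proof (rule that[of "1 / K"])
    fix j
    have "norm (qpoch q c j) > 0" using assms(2) by simp
    moreover have "inverse (norm (qpoch q c j)) \<le> K"
      using K(2)[of j] by (simp only: norm_inverse)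
    ultimately show "1 / K \<le> norm (qpoch q c j)"
      using K(1) by (simp add: field_simps)
  qed (use K in auto)
qed

text \<open>Only differences at 0 of order at most K are controlled: |k| steps evaluated at 0 reach
  no further, and the sequence under study itself depends on |k|, so that higher orders could not be
  bounded uniformly.\<close>

definition qgrowth :: "complex \<Rightarrow> real \<Rightarrow> real \<Rightarrow> nat \<Rightarrow> (nat \<Rightarrow> complex) \<Rightarrow> bool" where
  "qgrowth q C \<rho> K h \<longleftrightarrow> (\<forall>j\<le>K. norm ((qdiff q ^^ j) h 0) \<le> C * \<rho> ^ j)"

lemma qgrowth_qstep:
  assumes h: "qgrowth q C \<rho> (Suc K) h"
  shows "qgrowth q (C * ((\<rho> + norm p) / norm (1 - p))) \<rho> K (qstep q p h)"
  unfolding qgrowth_def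
proof (intro allI impI)
  fix j assume "j \<le> K"
  have "norm ((qdiff q ^^ j) (qstep q p h) 0)
     = norm ((qdiff q ^^ Suc j) h 0 - p * (qdiff q ^^ j) h 0) / norm (1 - p)"
    by (simp add: qdiff_pow_qstep qstep_def norm_divide)
  also have "\<dots> \<le> (C * \<rho> ^ Suc j + norm p * (C * \<rho> ^ j)) / norm (1 - p)"
  proof (rule divide_right_mono)
    have "norm ((qdiff q ^^ Suc j) h 0) \<le> C * \<rho> ^ Suc j" "norm ((qdiff q ^^ j) h 0) \<le> C * \<rho> ^ j"
      using h \<open>j \<le> K\<close> unfolding qgrowth_def by (auto simp del: funpow.simps power_Suc)
    then show "norm ((qdiff q ^^ Suc j) h 0 - p * (qdiff q ^^ j) h 0) \<le> C * \<rho> ^ Suc j + norm p * (C * \<rho> ^ j)"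
      by (intro order_trans[OF norm_triangle_ineq4] add_mono) (auto simp: norm_mult intro: mult_left_mono)
  qed simp
  also have "\<dots> = C * ((\<rho> + norm p) / norm (1 - p)) * \<rho> ^ j"
    by (simp add: algebra_simps)
  finally show "norm ((qdiff q ^^ j) (qstep q p h) 0) \<le> C * ((\<rho> + norm p) / norm (1 - p)) * \<rho> ^ j" .
qed

lemma qgrowth_qsteps:
  assumes "qgrowth q C \<rho> (length ps + K) h"
  shows "qgrowth q (C * (\<Prod>p\<leftarrow>ps. (\<rho> + norm p) / norm (1 - p))) \<rho> K (qsteps q ps h)"
  using assms
proof (induction ps arbitrary: K)
  case (Cons p ps)
  then have "qgrowth q (C * (\<Prod>p\<leftarrow>ps. (\<rho> + norm p) / norm (1 - p))) \<rho> (Suc K) (qsteps q ps h)"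
    by simp
  from qgrowth_qstep[OF this, of p] show ?case by (simp add: mult_ac)
qed simp

text \<open>The product is chosen to close the induction: 1 + |c| times the product for c q with j
  factors is 1 - |c|/\<rho> times the product for c with j + 1 factors. In the Leibniz rule the term
  with h then accounts for the share |c|/\<rho> of the new bound and the term with the difference of
  h for the rest. This is where |c| < \<rho> enters.\<close>

lemma qgrowth_qpoch_mult_aux:
  assumes q: "q \<noteq> 0" "norm q < 1" and "norm c < \<rho>" "0 \<le> C"
    and "\<forall>i\<le>j. norm ((qdiff q ^^ i) h 0) \<le> C * \<rho> ^ i"
  shows "norm ((qdiff q ^^ j) (\<lambda>M. qpoch q c M * h M) 0)
    \<le> C * \<rho> ^ j * (\<Prod>i<j. (1 + norm c * norm q ^ i) / (1 - norm c * norm q ^ i / \<rho>))"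
  using assms(3-)
proof (induction j arbitrary: c C h)
  case (Suc j)
  define \<kappa> where "\<kappa> c j = (\<Prod>i<j. (1 + norm c * norm q ^ i) / (1 - norm c * norm q ^ i / \<rho>))" for c :: complex and j
  have \<rho>: "\<rho> > 0" using Suc.prems(1) norm_ge_zero[of c] by linarith
  have fac: "1 \<le> (1 + norm c * norm q ^ i) / (1 - norm c * norm q ^ i / \<rho>)" "0 < 1 - norm c * norm q ^ i / \<rho>" for i
  proof -
    have "norm c * norm q ^ i \<le> norm c * 1"
      using q by (intro mult_left_mono power_le_one) auto
    then have "norm c * norm q ^ i < \<rho>" using Suc.prems(1) by simp
    then show pos: "0 < 1 - norm c * norm q ^ i / \<rho>" using \<rho> by (simp add: divide_simps)
    have "1 - norm c * norm q ^ i / \<rho> \<le> 1" using \<rho> by simp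
    then have "1 - norm c * norm q ^ i / \<rho> \<le> 1 + norm c * norm q ^ i"
      by (smt (verit) norm_ge_zero mult_nonneg_nonneg zero_le_power)
    then show "1 \<le> (1 + norm c * norm q ^ i) / (1 - norm c * norm q ^ i / \<rho>)"
      using pos by simp
  qed
  have \<kappa>_nonneg: "0 \<le> \<kappa> c j"
    unfolding \<kappa>_def using fac(1) by (intro prod_nonneg) (meson order_trans zero_le_one)
  have \<kappa>_mono: "\<kappa> c j \<le> \<kappa> c (Suc j)"
    using mult_left_mono[OF fac(1)[of j] \<kappa>_nonneg] by (simp add: \<kappa>_def)
  have \<kappa>_Suc: "\<kappa> c (Suc j) = (1 + norm c) / (1 - norm c / \<rho>) * \<kappa> (c * q) j"
    unfolding \<kappa>_def prod.lessThan_Suc_shift by (simp add: norm_mult mult.assoc)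
  have "norm (c * q) \<le> norm c"
    using q by (simp add: norm_mult mult_left_le)
  then have cq: "norm (c * q) < \<rho>" using Suc.prems(1) by linarith
  have 1: "norm ((qdiff q ^^ j) (\<lambda>M. qpoch q c M * h M) 0) \<le> C * \<rho> ^ j * \<kappa> c j"
    unfolding \<kappa>_def using Suc.prems by (intro Suc.IH) auto
  have "norm ((qdiff q ^^ i) (qdiff q h) 0) \<le> (C * \<rho>) * \<rho> ^ i" if "i \<le> j" for i
    using Suc.prems(3)[rule_format, of "Suc i"] that by (simp add: funpow_swap1 mult_ac)
  then have 2: "norm ((qdiff q ^^ j) (\<lambda>M. qpoch q (c * q) M * qdiff q h M) 0) \<le> (C * \<rho>) * \<rho> ^ j * \<kappa> (c * q) j"
    unfolding \<kappa>_def using Suc.prems cq \<rho> by (intro Suc.IH) auto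
  have "(qdiff q ^^ Suc j) (\<lambda>M. qpoch q c M * h M) 0
     = c * (qdiff q ^^ j) (\<lambda>M. qpoch q c M * h M) 0
       + (1 - c) * (qdiff q ^^ j) (\<lambda>M. qpoch q (c * q) M * qdiff q h M) 0"
    unfolding funpow_Suc_right o_def qdiff_qpoch_mult[OF q(1)] qdiff_pow_lincomb ..
  also have "norm \<dots> \<le> norm c * (C * \<rho> ^ j * \<kappa> c j) + (1 + norm c) * ((C * \<rho>) * \<rho> ^ j * \<kappa> (c * q) j)"
  proof (intro order_trans[OF norm_triangle_ineq] add_mono)
    show "norm ((1 - c) * (qdiff q ^^ j) (\<lambda>M. qpoch q (c * q) M * qdiff q h M) 0)
       \<le> (1 + norm c) * ((C * \<rho>) * \<rho> ^ j * \<kappa> (c * q) j)"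
      unfolding norm_mult using 2 norm_triangle_ineq4[of 1 c] by (intro mult_mono) auto
  qed (use 1 in \<open>auto simp: norm_mult intro: mult_left_mono\<close>)
  \<comment> \<open>The first term is weakened to the longer product, so that both terms become
    multiples of the same bound.\<close>
  also have "\<dots> \<le> norm c * (C * \<rho> ^ j * \<kappa> c (Suc j)) + (1 + norm c) * ((C * \<rho>) * \<rho> ^ j * \<kappa> (c * q) j)"
    using \<kappa>_mono Suc.prems \<rho> by (intro add_right_mono mult_left_mono) auto
  also have "(1 + norm c) * \<kappa> (c * q) j = (1 - norm c / \<rho>) * \<kappa> c (Suc j)"
  proof -
    have "1 - norm c / \<rho> \<noteq> 0" using fac(2)[of 0] by auto
    then show ?thesis unfolding \<kappa>_Suc times_divide_eq_left times_divide_eq_right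
      by (rule nonzero_mult_div_cancel_left[symmetric])
  qed
  then have "(1 + norm c) * ((C * \<rho>) * \<rho> ^ j * \<kappa> (c * q) j) = C * \<rho> * \<rho> ^ j * ((1 - norm c / \<rho>) * \<kappa> c (Suc j))"
    by (metis (no_types, opaque_lifting) mult.assoc mult.commute)
  also have "norm c * (C * \<rho> ^ j * \<kappa> c (Suc j)) + C * \<rho> * \<rho> ^ j * ((1 - norm c / \<rho>) * \<kappa> c (Suc j))
     = C * \<rho> ^ Suc j * \<kappa> c (Suc j)"
    using \<rho> by (simp add: field_simps)
  finally show ?case by (simp only: \<kappa>_def)
qed simp

lemma qgrowth_qpoch_mult:
  assumes q: "q \<noteq> 0" "norm q < 1" and c: "norm c < \<rho>"
  obtains B where "B \<ge> 0" "\<And>C K h. 0 \<le> C \<Longrightarrow> qgrowth q C \<rho> K h \<Longrightarrow> qgrowth q (C * B) \<rho> K (\<lambda>M. qpoch q c M * h M)"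
proof -
  have \<rho>: "\<rho> > 0" using c norm_ge_zero[of c] by linarith
  define b where "b = norm c / \<rho>"
  have b: "0 \<le> b" "b < 1" using c \<rho> by (auto simp: b_def)
  \<comment> \<open>For 0 \<le> t \<le> 1 one has 1/(1 - b t) = 1 + b t/(1 - b t) \<le> 1 + a t.
    This bounds the reciprocal factors by a product of the same convergent type as the
    numerators.\<close>
  define a where "a = b / (1 - b)"
  have a: "0 \<le> a" using b by (simp add: a_def)
  define B where "B = exp (norm c / (1 - norm q)) * exp (a / (1 - norm q))"
  have le: "(\<Prod>i<j. (1 + norm c * norm q ^ i) / (1 - norm c * norm q ^ i / \<rho>)) \<le> B" for j
  proof -
    have "(1 + norm c * norm q ^ i) / (1 - norm c * norm q ^ i / \<rho>) \<le> (1 + norm c * norm q ^ i) * (1 + a * norm q ^ i)"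
      and "0 \<le> (1 + norm c * norm q ^ i) / (1 - norm c * norm q ^ i / \<rho>)" for i
    proof -
      define t where "t = norm q ^ i"
      have t: "0 \<le> t" "t \<le> 1" using q by (auto simp: t_def power_le_one)
      have bt: "b * t \<le> b" using b t by (simp add: mult_left_le)
      then have pos: "0 < 1 - b * t" using b by linarith
      have "b * t * (b * t) \<le> b * t * b" using bt b t by (intro mult_left_mono) auto
      then have "1 \<le> (1 - b * t) * (1 + a * t)"
        using b pos unfolding a_def by (simp add: divide_simps) (simp add: algebra_simps)
      then have "1 / (1 - b * t) \<le> 1 + a * t" using pos by (simp add: divide_simps mult.commute)
      then have "(1 + norm c * t) * (1 / (1 - b * t)) \<le> (1 + norm c * t) * (1 + a * t)"
        using t by (intro mult_left_mono) (auto simp: add_nonneg_nonneg)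
      moreover have "b * t = norm c * t / \<rho>" by (simp add: b_def)
      ultimately show "(1 + norm c * norm q ^ i) / (1 - norm c * norm q ^ i / \<rho>) \<le> (1 + norm c * norm q ^ i) * (1 + a * norm q ^ i)"
        by (simp add: t_def)
      show "0 \<le> (1 + norm c * norm q ^ i) / (1 - norm c * norm q ^ i / \<rho>)"
        using pos t \<open>b * t = norm c * t / \<rho>\<close> unfolding t_def by (intro divide_nonneg_nonneg add_nonneg_nonneg) auto
    qed
    then have "(\<Prod>i<j. (1 + norm c * norm q ^ i) / (1 - norm c * norm q ^ i / \<rho>))
       \<le> (\<Prod>i<j. (1 + norm c * norm q ^ i) * (1 + a * norm q ^ i))"
      by (intro prod_mono) blast
    also have "\<dots> \<le> B"
      unfolding B_def prod.distrib using a q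
      by (intro mult_mono prod_one_plus_geometric_le prod_nonneg) (auto simp: add_nonneg_nonneg)
    finally show ?thesis .
  qed
  show thesis
  proof (rule that[of B])
    show "B \<ge> 0" by (simp add: B_def)
    fix C K h assume C: "(0::real) \<le> C" and h: "qgrowth q C \<rho> K h"
    show "qgrowth q (C * B) \<rho> K (\<lambda>M. qpoch q c M * h M)"
      unfolding qgrowth_def
    proof (intro allI impI)
      fix j assume "j \<le> K"
      then have "\<forall>i\<le>j. norm ((qdiff q ^^ i) h 0) \<le> C * \<rho> ^ i"
        using h by (auto simp: qgrowth_def)
      then have "norm ((qdiff q ^^ j) (\<lambda>M. qpoch q c M * h M) 0)
        \<le> C * \<rho> ^ j * (\<Prod>i<j. (1 + norm c * norm q ^ i) / (1 - norm c * norm q ^ i / \<rho>))"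
        by (rule qgrowth_qpoch_mult_aux[OF q c C])
      also have "\<dots> \<le> C * \<rho> ^ j * B"
        using le C \<rho> by (intro mult_left_mono) auto
      finally show "norm ((qdiff q ^^ j) (\<lambda>M. qpoch q c M * h M) 0) \<le> C * B * \<rho> ^ j"
        by (simp add: mult_ac)
    qed
  qed
qed

text \<open>Each difference turns h into \<open>qstep q c h\<close> and c into c q, at the cost of
  the factor (\<rho> + |c|)/|1 - c|. The denominator left over is a shifted factorial of length 0,
  because the evaluation is at 0.\<close>

lemma qgrowth_qpoch_divide_aux:
  assumes q: "q \<noteq> 0" and "\<And>i. qpoch q c i \<noteq> 0"
    and "\<forall>i\<le>j. norm ((qdiff q ^^ i) h 0) \<le> C * \<rho> ^ i"
  shows "norm ((qdiff q ^^ j) (\<lambda>M. h M / qpoch q c M) 0) \<le> C * (\<Prod>i<j. (\<rho> + norm c * norm q ^ i) / norm (1 - c * q ^ i))"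
  using assms(2-)
proof (induction j arbitrary: c C h)
  case (Suc j)
  have nz: "qpoch q (c * q) i \<noteq> 0" for i
    using Suc.prems(1)[of "Suc i"] by (simp add: qpoch_Suc')
  have "qgrowth q C \<rho> (Suc j) h" using Suc.prems(2) by (simp add: qgrowth_def)
  from qgrowth_qstep[OF this, of c]
  have "\<forall>i\<le>j. norm ((qdiff q ^^ i) (qstep q c h) 0) \<le> C * ((\<rho> + norm c) / norm (1 - c)) * \<rho> ^ i"
    by (simp add: qgrowth_def)
  from Suc.IH[OF nz this] show ?case
    unfolding funpow_Suc_right o_def qdiff_qpoch_divide[OF q Suc.prems(1)] prod.lessThan_Suc_shift
    by (simp add: norm_mult mult_ac)
qed simp

text \<open>Taking \<rho> out of each numerator leaves a bounded product over a factorial that stays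
  away from 0. The rate is therefore exactly \<rho>, even if |c| is larger.\<close>

lemma prod_ratio_bound:
  assumes q: "norm q < 1" and c: "\<And>i. qpoch q c i \<noteq> 0" and \<rho>: "0 < \<rho>"
  obtains B where "B \<ge> 0" "\<And>j. (\<Prod>i<j. (\<rho> + norm c * norm q ^ i) / norm (1 - c * q ^ i)) \<le> B * \<rho> ^ j"
proof -
  obtain \<delta> where \<delta>: "\<delta> > 0" "\<And>j. \<delta> \<le> norm (qpoch q c j)"
    using qpoch_bounded_below[OF q c] by blast
  show thesis
  proof (rule that[of "exp (norm c / \<rho> / (1 - norm q)) / \<delta>"])
    fix j
    have "\<rho> + norm c * norm q ^ i = \<rho> * (1 + norm c / \<rho> * norm q ^ i)" for i
      using \<rho> by (simp add: field_simps)
    then have "(\<Prod>i<j. (\<rho> + norm c * norm q ^ i) / norm (1 - c * q ^ i))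
       = \<rho> ^ j * (\<Prod>i<j. 1 + norm c / \<rho> * norm q ^ i) / norm (qpoch q c j)"
      by (simp add: qpoch_def prod_dividef prod.distrib prod_norm)
    also have "\<dots> \<le> \<rho> ^ j * exp (norm c / \<rho> / (1 - norm q)) / \<delta>"
      using \<delta> q \<rho> by (intro frac_le mult_left_mono prod_one_plus_geometric_le mult_nonneg_nonneg) auto
    finally show "(\<Prod>i<j. (\<rho> + norm c * norm q ^ i) / norm (1 - c * q ^ i))
      \<le> exp (norm c / \<rho> / (1 - norm q)) / \<delta> * \<rho> ^ j"
      by (simp add: mult_ac)
  qed (use \<delta> in auto)
qed

lemma qgrowth_qpoch_divide:
  assumes q: "q \<noteq> 0" "norm q < 1" and c: "\<And>i. qpoch q c i \<noteq> 0" and \<rho>: "0 < \<rho>"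
  obtains B where "B \<ge> 0" "\<And>C K h. 0 \<le> C \<Longrightarrow> qgrowth q C \<rho> K h \<Longrightarrow> qgrowth q (C * B) \<rho> K (\<lambda>M. h M / qpoch q c M)"
proof -
  obtain B where B: "B \<ge> 0" "\<And>j. (\<Prod>i<j. (\<rho> + norm c * norm q ^ i) / norm (1 - c * q ^ i)) \<le> B * \<rho> ^ j"
    using prod_ratio_bound[OF q(2) c \<rho>] by blast
  show thesis
  proof (rule that[OF B(1)])
    fix C K h assume C: "(0::real) \<le> C" and h: "qgrowth q C \<rho> K h"
    show "qgrowth q (C * B) \<rho> K (\<lambda>M. h M / qpoch q c M)"
      unfolding qgrowth_def
    proof (intro allI impI)
      fix j assume "j \<le> K"
      then have "\<forall>i\<le>j. norm ((qdiff q ^^ i) h 0) \<le> C * \<rho> ^ i"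
        using h by (auto simp: qgrowth_def)
      then have "norm ((qdiff q ^^ j) (\<lambda>M. h M / qpoch q c M) 0)
        \<le> C * (\<Prod>i<j. (\<rho> + norm c * norm q ^ i) / norm (1 - c * q ^ i))"
        by (rule qgrowth_qpoch_divide_aux[OF q(1) c])
      also have "\<dots> \<le> C * (B * \<rho> ^ j)"
        using B C by (intro mult_left_mono) auto
      finally show "norm ((qdiff q ^^ j) (\<lambda>M. h M / qpoch q c M) 0) \<le> C * B * \<rho> ^ j"
        by (simp add: mult_ac)
    qed
  qed
qed

section \<open>Evaluation and growth of the inner sum\<close>

context q_strings
begin

text \<open>One point p for each factor 1 - p of the product over s of (u x_s)_(k_s), with
  repetitions kept; hence a list.\<close>

definition points :: "(nat \<Rightarrow> nat) \<Rightarrow> complex \<Rightarrow> complex list" where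
  "points k u = concat (map (\<lambda>s. map (\<lambda>i. u * x s * q ^ i) [0..<k s]) [1..<Suc n])"

lemma length_points: "length (points k u) = msize n k"
  by (simp add: points_def length_concat comp_def msize_def interv_sum_list_conv_sum_set_nat
      atLeastLessThanSuc_atLeastAtMost del: upt_Suc)

lemma prod_points: "(\<Prod>p\<leftarrow>points k u. f p) = (\<Prod>s=1..n. \<Prod>i<k s. f (u * x s * q ^ i))"
  for f :: "complex \<Rightarrow> 'a :: comm_monoid_mult"
proof -
  have "(\<Prod>p\<leftarrow>concat xss. f p) = (\<Prod>xs\<leftarrow>xss. \<Prod>p\<leftarrow>xs. f p)" for xss
    by (induction xss) auto
  then show ?thesis
    by (simp add: points_def comp_def lessThan_atLeast0 atLeastLessThanSuc_atLeastAtMost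
        prod.distinct_set_conv_list[of "[1..<Suc n]", symmetric] prod.distinct_set_conv_list[of "[0..<_]", symmetric]
        del: upt_Suc One_nat_def)
qed

lemma set_points: "p \<in> set (points k u) \<Longrightarrow> \<exists>s\<in>{1..n}. \<exists>i. p = u * x s * q ^ i"
  by (fastforce simp: points_def)

lemma points_shift: "map (\<lambda>p. p * q) (points k u) = points k (u * q)"
  by (simp add: points_def map_concat comp_def mult_ac)

text \<open>Both sides obey the recurrence for level sums. On the operator side, let e_M be the unit
  sequence at M. Then e_(M+1) minus its q-difference is (1 - 1/q^(M+1)) e_(M+1) + e_M / q^M. On the
  other hand f 0 minus the q-difference of f at 0 is f 1, and shifting by one index replaces e_(M+1)
  by e_M and u by u q.\<close>

lemma msum_eq_qsteps:
  assumes u: "\<And>r i. r \<in> {1..n} \<Longrightarrow> u * x r * q ^ i \<noteq> 1"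
  shows "msum k u M = qsteps q (points k u) (\<lambda>j. if j = M then 1 else 0) 0"
  using u
proof (induction M arbitrary: u)
  case 0
  have "p \<noteq> 1" if "p \<in> set (points k u)" for p
    using set_points[OF that] 0 by auto
  then show ?case by (simp add: qsteps_delta_0 msum_0)
next
  case (Suc M)
  define \<delta> where "\<delta> M = (\<lambda>j. if j = M then 1 else 0 :: complex)" for M :: nat
  have pts: "p * q \<noteq> 1" if "p \<in> set (points k u)" for p
    using set_points[OF that] Suc.prems[of _ "Suc _"] by (auto simp: mult_ac)
  have shift_delta: "(\<lambda>j. \<delta> (Suc M) (Suc j)) = \<delta> M"
    by (auto simp: \<delta>_def)
  have uq: "u * q * x r * q ^ i \<noteq> 1" if "r \<in> {1..n}" for r i
    using Suc.prems[OF that, of "Suc i"] by (simp add: mult_ac)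
  \<comment> \<open>Within one string the quotients of consecutive factors telescope, and the
    coefficient of the level recurrence remains.\<close>
  have c: "(\<Prod>p\<leftarrow>points k u. (1 - p * q) / (q * (1 - p)))
     = q powi (- int (msize n k)) * (\<Prod>s=1..n. (1 - u * x s * q ^ k s) / (1 - u * x s))"
  proof -
    have "(\<Prod>i<j. (1 - u * x s * q ^ i * q) / (q * (1 - u * x s * q ^ i)))
       = q powi (- int j) * ((1 - u * x s * q ^ j) / (1 - u * x s))" if "s \<in> {1..n}" for s j
    proof -
      define X where "X i = 1 - u * x s * q ^ i" for i
      have X: "X i \<noteq> 0" for i using Suc.prems[OF that, of i] by (simp add: X_def)
      have "(\<Prod>i<j. X (Suc i) / (q * X i)) = q powi (- int j) * (X j / X 0)"
      proof (induction j)
        case (Suc j)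
        have "q powi (- int (Suc j)) = q powi (- int j) / q"
          unfolding power_int_minus power_int_of_nat by (simp add: field_simps)
        then show ?case using X[of j] by (simp only: prod.lessThan_Suc Suc.IH) simp
      qed (use X in simp)
      then show ?thesis by (simp add: X_def mult_ac)
    qed
    then have "(\<Prod>p\<leftarrow>points k u. (1 - p * q) / (q * (1 - p)))
      = (\<Prod>s=1..n. q powi (- int (k s)) * ((1 - u * x s * q ^ k s) / (1 - u * x s)))"
      unfolding prod_points by (intro prod.cong refl)
    moreover have "q powi (- int (msize n k)) = (\<Prod>s=1..n. q powi (- int (k s)))"
      unfolding msize_def power_int_minus power_int_of_nat power_sum
      by (simp add: prod_inversef[symmetric] o_def)
    ultimately show ?thesis by (simp only: prod.distrib)
  qed
  have "(1 - 1 / q ^ Suc M) * qsteps q (points k u) (\<delta> (Suc M)) 0 + 1 / q ^ M * qsteps q (points k u) (\<delta> M) 0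
     = qsteps q (points k u) (\<lambda>j. (1 - 1 / q ^ Suc M) * \<delta> (Suc M) j + 1 / q ^ M * \<delta> M j) 0"
    by (simp only: qsteps_lincomb)
  also have "(\<lambda>j. (1 - 1 / q ^ Suc M) * \<delta> (Suc M) j + 1 / q ^ M * \<delta> M j)
     = (\<lambda>j. 1 * \<delta> (Suc M) j + (-1) * qdiff q (\<delta> (Suc M)) j)"
    by (auto simp: \<delta>_def qdiff_def fun_eq_iff)
  also have "qsteps q (points k u) \<dots> 0 = qsteps q (points k u) (\<delta> (Suc M)) 0 - qdiff q (qsteps q (points k u) (\<delta> (Suc M))) 0"
    unfolding qsteps_lincomb qdiff_qsteps by simp
  also have "\<dots> = qsteps q (points k u) (\<delta> (Suc M)) (Suc 0)"
    by (simp add: qdiff_def)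
  also have "\<dots> = q powi (- int (msize n k)) * (\<Prod>s=1..n. (1 - u * x s * q ^ k s) / (1 - u * x s))
       * qsteps q (points k (u * q)) (\<delta> M) 0"
    by (subst qsteps_shift[OF q_nz pts]) (simp_all only: c points_shift shift_delta)
  also have "\<dots> = (1 - 1 / q ^ Suc M) * msum k u (Suc M) + msum k u M / q ^ M"
    using msum_Suc[OF Suc.prems, of M k] Suc.IH[OF uq] by (simp add: \<delta>_def)
  also have "msum k u M = qsteps q (points k u) (\<delta> M) 0"
    using Suc.IH[OF Suc.prems] by (simp add: \<delta>_def)
  finally have "(1 - 1 / q ^ Suc M) * qsteps q (points k u) (\<delta> (Suc M)) 0 = (1 - 1 / q ^ Suc M) * msum k u (Suc M)"
    by simp
  moreover have "1 - 1 / q ^ Suc M \<noteq> 0"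
    using q_power_neq_1[of "Suc M"] by simp
  ultimately show ?case
    unfolding \<delta>_def mult_cancel_left by simp
qed

lemma multi_indices_le_eq: "multi_indices_le n k = {m \<in> multi_indices n. \<forall>r\<in>{1..n}. m r \<le> k r}"
  by (rule set_eqI) (simp add: multi_indices_le_def multi_indices_def PiE_iff conj_comms)

lemma finite_multi_indices_le: "finite (multi_indices_le n k)"
  by (simp add: multi_indices_le_def finite_PiE)

text \<open>The level recurrences need full levels, not their intersection with the box below k. The
  vanishing terms allow the enlargement.\<close>

lemma sum_multi_indices_le_levels:
  fixes f :: "(nat \<Rightarrow> nat) \<Rightarrow> complex"
  assumes "\<And>m. m \<in> multi_indices n \<Longrightarrow> \<exists>r\<in>{1..n}. k r < m r \<Longrightarrow> f m = 0"
  shows "(\<Sum>m\<in>multi_indices_le n k. f m) = (\<Sum>M\<le>msize n k. \<Sum>m\<in>mlevel n M. f m)"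
proof -
  have "(\<Sum>m\<in>multi_indices_le n k. f m) = (\<Sum>m\<in>(\<Union>M\<in>{..msize n k}. mlevel n M). f m)"
  proof (rule sum.mono_neutral_left)
    show "multi_indices_le n k \<subseteq> (\<Union>M\<in>{..msize n k}. mlevel n M)"
      by (auto simp: multi_indices_le_eq mlevel_def msize_def intro!: sum_mono)
    show "\<forall>m\<in>(\<Union>M\<in>{..msize n k}. mlevel n M) - multi_indices_le n k. f m = 0"
    proof
      fix m assume "m \<in> (\<Union>M\<in>{..msize n k}. mlevel n M) - multi_indices_le n k"
      then have "m \<in> multi_indices n" "\<not> (\<forall>r\<in>{1..n}. m r \<le> k r)"
        by (auto simp: mlevel_def multi_indices_le_eq)
      then show "f m = 0" using assms[of m] by (meson not_le)
    qed
  qed simp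
  also have "\<dots> = (\<Sum>M\<le>msize n k. \<Sum>m\<in>mlevel n M. f m)"
    by (rule sum.UNION_disjoint, simp, simp, auto simp: mlevel_def)
  finally show ?thesis .
qed

text \<open>Linearity reduces the claim to unit sequences, and by locality only the values of h up
  to |k| matter.\<close>

lemma sum_mterm_eq_qsteps:
  assumes u: "\<And>r i. r \<in> {1..n} \<Longrightarrow> u * x r * q ^ i \<noteq> 1"
  shows "(\<Sum>m\<in>multi_indices_le n k. mterm q n x k m * h (msize n m) / (\<Prod>r=1..n. qpoch q (u * x r) (m r)))
    = qsteps q (points k u) h 0"
proof -
  have "(\<Sum>m\<in>multi_indices_le n k. mterm q n x k m * h (msize n m) / (\<Prod>r=1..n. qpoch q (u * x r) (m r)))
    = (\<Sum>M\<le>msize n k. \<Sum>m\<in>mlevel n M. mterm q n x k m * h (msize n m) / (\<Prod>r=1..n. qpoch q (u * x r) (m r)))"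
    by (rule sum_multi_indices_le_levels) (auto simp: mterm_eq_0)
  also have "\<dots> = (\<Sum>M\<le>msize n k. h M * msum k u M)"
    unfolding msum_def sum_distrib_left
    by (intro sum.cong refl) (auto simp: mlevel_def)
  also have "\<dots> = (\<Sum>M\<le>msize n k. h M * qsteps q (points k u) (\<lambda>j. if j = M then 1 else 0) 0)"
    by (simp only: msum_eq_qsteps[OF u])
  also have "\<dots> = qsteps q (points k u) (\<lambda>j. \<Sum>M\<le>msize n k. h M * (if j = M then 1 else 0)) 0"
    by (simp add: qsteps_sum)
  also have "\<dots> = qsteps q (points k u) h 0"
    by (rule qsteps_local) (simp add: length_points if_distrib cong: if_cong)
  finally show ?thesis .
qed

lemma inner_sum_eq:
  "inner_sum q n \<alpha> \<beta> \<gamma> b c d x k =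
    (\<Sum>m\<in>multi_indices_le n k. mterm q n x k m
      * (qpochs q [\<alpha> * q ^ msize n k, \<alpha> * \<beta>, \<alpha> * \<gamma>] (msize n m) / qpochs q [\<alpha> * c, \<alpha> * d] (msize n m))
      / (\<Prod>r=1..n. qpoch q (\<alpha> * b * x r) (m r)))"
  unfolding inner_sum_def mterm_def by (intro sum.cong refl) (simp add: mult_ac)

text \<open>In the operator form with u = \<alpha> b, a one-dimensional sequence is to be estimated.
  Its factor with \<alpha> q^|k| is an eigenvector, the factors with \<beta> and \<gamma> are
  admissible because \<rho> exceeds their moduli, and the divisions keep the rate. The steps along
  the string of x_r finally cost at most a constant times \<rho>^(k_r).\<close>

lemma inner_sum_bound:
  assumes cd: "\<And>j. qpoch q (\<alpha> * c) j \<noteq> 0" "\<And>j. qpoch q (\<alpha> * d) j \<noteq> 0"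
    and b: "\<And>r j. r \<in> {1..n} \<Longrightarrow> qpoch q (\<alpha> * b * x r) j \<noteq> 0"
    and \<rho>: "norm (\<alpha> * \<beta>) < \<rho>" "norm (\<alpha> * \<gamma>) < \<rho>"
  obtains C where "C \<ge> 0" "\<And>k. norm (inner_sum q n \<alpha> \<beta> \<gamma> b c d x k) \<le> C * \<rho> ^ msize n k"
proof -
  have \<rho>_pos: "\<rho> > 0" using \<rho>(1) norm_ge_zero[of "\<alpha> * \<beta>"] by linarith
  have q_pos: "0 < norm q" by simp
  obtain B1 where B1: "B1 \<ge> 0"
    "\<And>C K h. 0 \<le> C \<Longrightarrow> qgrowth q C \<rho> K h \<Longrightarrow> qgrowth q (C * B1) \<rho> K (\<lambda>M. qpoch q (\<alpha> * \<beta>) M * h M)"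
    using qgrowth_qpoch_mult[OF q_nz norm_q \<rho>(1)] by blast
  obtain B2 where B2: "B2 \<ge> 0"
    "\<And>C K h. 0 \<le> C \<Longrightarrow> qgrowth q C \<rho> K h \<Longrightarrow> qgrowth q (C * B2) \<rho> K (\<lambda>M. qpoch q (\<alpha> * \<gamma>) M * h M)"
    using qgrowth_qpoch_mult[OF q_nz norm_q \<rho>(2)] by blast
  obtain B3 where B3: "B3 \<ge> 0"
    "\<And>C K h. 0 \<le> C \<Longrightarrow> qgrowth q C \<rho> K h \<Longrightarrow> qgrowth q (C * B3) \<rho> K (\<lambda>M. h M / qpoch q (\<alpha> * c) M)"
    using qgrowth_qpoch_divide[OF q_nz norm_q cd(1) \<rho>_pos] by blast
  obtain B4 where B4: "B4 \<ge> 0"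
    "\<And>C K h. 0 \<le> C \<Longrightarrow> qgrowth q C \<rho> K h \<Longrightarrow> qgrowth q (C * B4) \<rho> K (\<lambda>M. h M / qpoch q (\<alpha> * d) M)"
    using qgrowth_qpoch_divide[OF q_nz norm_q cd(2) \<rho>_pos] by blast
  \<comment> \<open>This constant must serve all K. For large K the quotient |\<alpha>| |q|^K /
    \<rho> is less than 1; for the finitely many other K the exponent is bounded by j \<le> K, which
    is why only differences up to order K are considered.\<close>
  obtain C0 where C0: "C0 \<ge> 0" "\<And>K j. j \<le> K \<Longrightarrow> norm (\<alpha> * q ^ K) ^ j \<le> C0 * \<rho> ^ j"
  proof -
    define A where "A = norm \<alpha> / \<rho>"
    have A: "A \<ge> 0" using \<rho>_pos by (simp add: A_def)
    have "(\<lambda>K. A * norm q ^ K) \<longlonglongrightarrow> A * 0"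
      using norm_q by (intro tendsto_mult tendsto_const LIMSEQ_power_zero) auto
    then have "eventually (\<lambda>K. A * norm q ^ K < 1) sequentially"
      by (intro order_tendstoD(2)) auto
    then obtain K0 where K0: "\<And>K. K \<ge> K0 \<Longrightarrow> A * norm q ^ K < 1"
      by (auto simp: eventually_sequentially)
    show thesis
    proof (rule that[of "max 1 A ^ K0"])
      fix K j :: nat assume "j \<le> K"
      have "(A * norm q ^ K) ^ j \<le> max 1 A ^ K0"
      proof (cases "K \<ge> K0")
        case True
        then have "(A * norm q ^ K) ^ j \<le> 1"
          using K0[OF True] A by (intro power_le_one) auto
        also have "1 \<le> max 1 A ^ K0" by (intro one_le_power) simp
        finally show ?thesis .
      next
        case False
        have "A * norm q ^ K \<le> max 1 A"
          using A norm_q by (intro order_trans[OF mult_left_le]) (auto intro: power_le_one)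
        then have "(A * norm q ^ K) ^ j \<le> max 1 A ^ j"
          using A by (intro power_mono) auto
        also have "\<dots> \<le> max 1 A ^ K0"
          using False \<open>j \<le> K\<close> by (intro power_increasing) auto
        finally show ?thesis .
      qed
      then have "(A * norm q ^ K) ^ j * \<rho> ^ j \<le> max 1 A ^ K0 * \<rho> ^ j"
        using \<rho>_pos by (intro mult_right_mono) auto
      moreover have "A * norm q ^ K * \<rho> = norm (\<alpha> * q ^ K)"
        using \<rho>_pos by (simp add: A_def norm_mult norm_power)
      ultimately show "norm (\<alpha> * q ^ K) ^ j \<le> max 1 A ^ K0 * \<rho> ^ j"
        by (simp only: power_mult_distrib[symmetric])
    qed simp
  qed
  have "\<exists>B\<ge>0. \<forall>j. (\<Prod>i<j. (\<rho> + norm (\<alpha> * b * x r) * norm q ^ i) / norm (1 - \<alpha> * b * x r * q ^ i)) \<le> B * \<rho> ^ j"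
    if "r \<in> {1..n}" for r
    using prod_ratio_bound[OF norm_q b[OF that] \<rho>_pos] by metis
  then obtain D where D: "\<And>r. r \<in> {1..n} \<Longrightarrow> D r \<ge> 0"
    "\<And>r j. r \<in> {1..n} \<Longrightarrow> (\<Prod>i<j. (\<rho> + norm (\<alpha> * b * x r) * norm q ^ i) / norm (1 - \<alpha> * b * x r * q ^ i)) \<le> D r * \<rho> ^ j"
    by metis
  define C where "C = C0 * B1 * B2 * B3 * B4"
  have C: "C \<ge> 0" using C0 B1 B2 B3 B4 by (simp add: C_def)
  show thesis
  proof (rule that[of "C * (\<Prod>r=1..n. D r)"])
    show "C * (\<Prod>r=1..n. D r) \<ge> 0"
      using C D(1) by (intro mult_nonneg_nonneg prod_nonneg) auto
    fix k
    define K where "K = msize n k"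
    define h where "h M = qpochs q [\<alpha> * q ^ K, \<alpha> * \<beta>, \<alpha> * \<gamma>] M / qpochs q [\<alpha> * c, \<alpha> * d] M" for M
    have "qgrowth q C0 \<rho> K (qpoch q (\<alpha> * q ^ K))"
      using C0(2) by (simp add: qgrowth_def qdiff_pow_qpoch norm_power)
    then have "qgrowth q C \<rho> K
       (\<lambda>M. (qpoch q (\<alpha> * \<gamma>) M * (qpoch q (\<alpha> * \<beta>) M * qpoch q (\<alpha> * q ^ K) M)) / qpoch q (\<alpha> * c) M / qpoch q (\<alpha> * d) M)"
      unfolding C_def using C0 B1 B2 B3 B4 by (intro B4(2) B3(2) B2(2) B1(2)) simp_all
    also have "(\<lambda>M. (qpoch q (\<alpha> * \<gamma>) M * (qpoch q (\<alpha> * \<beta>) M * qpoch q (\<alpha> * q ^ K) M)) / qpoch q (\<alpha> * c) M / qpoch q (\<alpha> * d) M) = h"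
      by (simp add: h_def qpochs_def fun_eq_iff mult_ac)
    finally have "qgrowth q C \<rho> (length (points k (\<alpha> * b)) + 0) h"
      by (simp add: length_points K_def)
    from qgrowth_qsteps[OF this]
    have "norm (qsteps q (points k (\<alpha> * b)) h 0)
      \<le> C * (\<Prod>p\<leftarrow>points k (\<alpha> * b). (\<rho> + norm p) / norm (1 - p))"
      by (auto simp: qgrowth_def)
    also have "(\<Prod>p\<leftarrow>points k (\<alpha> * b). (\<rho> + norm p) / norm (1 - p))
      = (\<Prod>r=1..n. \<Prod>i<k r. (\<rho> + norm (\<alpha> * b * x r) * norm q ^ i) / norm (1 - \<alpha> * b * x r * q ^ i))"
      unfolding prod_points by (simp add: norm_mult norm_power)
    also have "C * \<dots> \<le> C * (\<Prod>r=1..n. D r * \<rho> ^ k r)"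
      using C D(2) \<rho>_pos
      by (intro mult_left_mono prod_mono conjI prod_nonneg divide_nonneg_nonneg add_nonneg_nonneg) auto
    also have "\<dots> = C * (\<Prod>r=1..n. D r) * \<rho> ^ msize n k"
      by (simp add: prod.distrib msize_def power_sum)
    also have "qsteps q (points k (\<alpha> * b)) h 0 = inner_sum q n \<alpha> \<beta> \<gamma> b c d x k"
    proof -
      have "\<alpha> * b * x r * q ^ i \<noteq> 1" if "r \<in> {1..n}" for r i
        using b[OF that, of "Suc i"] by (auto simp: qpoch_Suc)
      from sum_mterm_eq_qsteps[OF this, of k h] show ?thesis
        by (simp add: inner_sum_eq h_def K_def)
    qed
    finally show "norm (inner_sum q n \<alpha> \<beta> \<gamma> b c d x k) \<le> C * (\<Prod>r=1..n. D r) * \<rho> ^ msize n k" .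
  qed
qed

end

section \<open>The terminating case\<close>

context q_strings
begin

text \<open>Indefinite summation. With l = q^L and Q = q^(t+1), the step from t to t + 1 is the
  identity (1 - Q)(1 - \<alpha> l Q) + (l - 1)(1 - \<alpha> Q^2) = (1 - \<alpha> Q)(l - Q).\<close>

lemma telescoping_sum:
  assumes nz: "\<And>J. J \<le> t \<Longrightarrow> qpoch q (\<alpha> * q ^ Suc L) J \<noteq> 0"
  shows "(\<Sum>J\<le>t. qpoch q (q powi (- int L)) J * q ^ (L * J) / qpoch q q J
        * ((1 - \<alpha> * q ^ (2 * J)) * qpoch q \<alpha> J / qpoch q (\<alpha> * q ^ Suc L) J))
    = qpoch q \<alpha> (Suc t) * qpoch q (q powi (1 - int L)) t * q ^ (L * t)
      / (qpoch q q t * qpoch q (\<alpha> * q ^ Suc L) t)"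
  using nz
proof (induction t)
  case 0
  then show ?case by (simp add: qpoch_Suc)
next
  case (Suc t)
  define l Q where "l = q ^ L" and "Q = q ^ Suc t"
  define X where "X = qpoch q \<alpha> (Suc t) * qpoch q (q powi (1 - int L)) t * q ^ (L * t)
    / (qpoch q q (Suc t) * qpoch q (\<alpha> * q ^ Suc L) (Suc t))"
  have nz1: "qpoch q q (Suc t) = qpoch q q t * (1 - Q)" "1 - Q \<noteq> 0"
    using q_power_neq_1[of "Suc t"] by (simp_all add: qpoch_Suc Q_def)
  have nz2: "qpoch q (\<alpha> * q ^ Suc L) (Suc t) = qpoch q (\<alpha> * q ^ Suc L) t * (1 - \<alpha> * l * Q)" "1 - \<alpha> * l * Q \<noteq> 0"
    using Suc.prems[of "Suc t"] by (simp_all add: qpoch_Suc Q_def l_def mult_ac)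
  have num: "qpoch q (q powi (- int L)) (Suc t) = (1 - 1 / l) * qpoch q (q powi (1 - int L)) t"
  proof -
    have "q powi (- int L) * q = q powi (1 - int L)" "q powi (- int L) = 1 / l"
      by (simp_all add: l_def power_int_minus power_int_diff field_simps)
    then show ?thesis by (simp add: qpoch_Suc')
  qed
  have num': "qpoch q (q powi (1 - int L)) (Suc t) = qpoch q (q powi (1 - int L)) t * (1 - Q / l)"
    by (simp add: qpoch_Suc Q_def l_def power_int_diff)
  have l: "l \<noteq> 0" by (simp add: l_def)
  have pw: "q ^ (L * Suc t) = q ^ (L * t) * l" "q ^ (2 * Suc t) = Q ^ 2"
    by (simp_all add: l_def Q_def power_add power_mult power2_eq_square power_mult_distrib mult_ac)
  have A1: "qpoch q \<alpha> (Suc t) * qpoch q (q powi (1 - int L)) t * q ^ (L * t)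
      / (qpoch q q t * qpoch q (\<alpha> * q ^ Suc L) t) = X * ((1 - Q) * (1 - \<alpha> * l * Q))"
    unfolding X_def nz1(1) nz2(1) using nz1(2) nz2(2) by simp
  have A2: "qpoch q (q powi (- int L)) (Suc t) * q ^ (L * Suc t) / qpoch q q (Suc t)
        * ((1 - \<alpha> * q ^ (2 * Suc t)) * qpoch q \<alpha> (Suc t) / qpoch q (\<alpha> * q ^ Suc L) (Suc t))
      = X * ((l - 1) * (1 - \<alpha> * Q ^ 2))"
  proof -
    have "(1 - 1 / l) * l = l - 1" using l by (simp add: field_simps)
    moreover have "e * B * (C * f) / g * (Y * a / h) = a * B * C / (g * h) * ((e * f) * Y)"
      for e B C f g Y a h :: complex
      by simp
    ultimately show ?thesis unfolding X_def num pw by (simp only:)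
  qed
  have A3: "qpoch q \<alpha> (Suc (Suc t)) * qpoch q (q powi (1 - int L)) (Suc t) * q ^ (L * Suc t)
      / (qpoch q q (Suc t) * qpoch q (\<alpha> * q ^ Suc L) (Suc t)) = X * ((1 - \<alpha> * Q) * (l - Q))"
  proof -
    have "(1 - Q / l) * l = l - Q" using l by (simp add: field_simps)
    moreover have "qpoch q \<alpha> (Suc (Suc t)) = qpoch q \<alpha> (Suc t) * (1 - \<alpha> * Q)"
      unfolding Q_def by (rule qpoch_Suc)
    moreover have "(a * Y) * (B * e) * (C * f) / (g * h) = a * B * C / (g * h) * (Y * (e * f))"
      for e B C f g Y a h :: complex
      by simp
    ultimately show ?thesis unfolding X_def num' pw by (simp only:)
  qed
  have "(1 - Q) * (1 - \<alpha> * l * Q) + (l - 1) * (1 - \<alpha> * Q ^ 2) = (1 - \<alpha> * Q) * (l - Q)"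
    by (simp add: algebra_simps power2_eq_square)
  then show ?case
    unfolding sum.atMost_Suc A2 A3 using Suc.IH[OF Suc.prems] A1 by (simp flip: distrib_left)
qed

text \<open>For L > 0 the closed form at t = L contains (q^(1-L))_L, whose last factor is 0.\<close>

lemma telescoping_sum_total:
  assumes "\<And>J. J \<le> L \<Longrightarrow> qpoch q (\<alpha> * q ^ Suc L) J \<noteq> 0"
  shows "(\<Sum>J\<le>L. qpoch q (q powi (- int L)) J * q ^ (L * J) / qpoch q q J
        * ((1 - \<alpha> * q ^ (2 * J)) * qpoch q \<alpha> J / qpoch q (\<alpha> * q ^ Suc L) J))
    = (if L = 0 then 1 - \<alpha> else 0)"
proof (cases "L = 0")
  case False
  have "q powi (1 - int L) * q ^ (L - 1) = 1"
    using False by (simp add: power_int_add[symmetric] flip: power_int_of_nat)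
  then have "qpoch q (q powi (1 - int L)) L = 0"
    unfolding qpoch_eq_0_iff using False by (intro exI[of _ "L - 1"]) auto
  then show ?thesis using telescoping_sum[OF assms, of L] False by simp
qed simp

section \<open>Composition of kernels\<close>

lemma q_strings_shift: "q_strings q n (\<lambda>r. x r * q ^ m r)"
proof
  fix r s i j assume "r \<in> {1..n}" "s \<in> {1..n}" "x r * q ^ m r * q ^ i = x s * q ^ m s * q ^ j"
  then show "r = s" using separated[of r s "m r + i" "m s + j"] by (simp add: power_add mult_ac)
qed (use norm_q in auto)

lemma vandermonde_ratio_add:
  "vandermonde_ratio q n x (\<lambda>r. m r + j r)
    = vandermonde_ratio q n (\<lambda>r. x r * q ^ m r) j * vandermonde_ratio q n x m"
  unfolding vandermonde_ratio_def prod.distrib[symmetric]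
proof (intro prod.cong refl)
  fix s r assume s: "s \<in> {1..n}" and r: "r \<in> {1..<s}"
  have r': "r \<in> {1..n}" "r \<noteq> s" using s r by auto
  have pd: "q powi (int a - int b) = q ^ a / q ^ b" for a b
    by (simp add: power_int_diff)
  define t where "t = x r * q ^ m r / (x s * q ^ m s)"
  have t: "t = q powi (int (m r) - int (m s)) * (x r / x s)"
    by (simp add: t_def power_int_diff mult.commute)
  have "t \<noteq> 1"
    using strings_eq_iff[of r s "m r" "m s"] r' s by (simp add: t_def field_simps)
  moreover have "q powi (int (m r + j r) - int (m s + j s)) * (x r / x s) = q powi (int (j r) - int (j s)) * t"
    unfolding t_def pd power_add by (simp add: mult_ac)
  ultimately show "(1 - q powi (int (m r + j r) - int (m s + j s)) * (x r / x s)) / (1 - x r / x s)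
     = (1 - q powi (int (j r) - int (j s)) * (x r * q ^ m r / (x s * q ^ m s))) / (1 - x r * q ^ m r / (x s * q ^ m s))
       * ((1 - q powi (int (m r) - int (m s)) * (x r / x s)) / (1 - x r / x s))"
    unfolding t_def[symmetric] t[symmetric] by simp
qed

text \<open>Put y_r = x_r q^(m_r). Splitting the factorials of length m_r + j_r gives the kernel for
  y, except that the denominators read (q y_r / x_s)_(j_r) instead of (q y_r / y_s)_(j_r). The
  numerators of the second kernel compensate for this: exchanging their shift by j_s costs q^(m_r
  j_s), in total q^(|m| |j|), and leaves them free of j.\<close>

lemma mterm_compose:
  assumes le: "\<And>r. r \<in> {1..n} \<Longrightarrow> m r \<le> \<nu> r"
  shows "mterm q n x \<nu> (\<lambda>r. m r + j r) * mterm q n x (\<lambda>r. m r + j r) m * q ^ (msize n m * msize n j)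
    = mterm q n (\<lambda>r. x r * q ^ m r) (\<lambda>r. \<nu> r - m r) j * (mterm q n x \<nu> m * mterm q n x m m)"
proof -
  define y where "y r = x r * q ^ m r" for r
  define N where "N k r s i = qpoch q (q powi (- int k) * (x r / x s)) i" for k r s i
  define D where "D r s i = qpoch q (q * x r / x s) i" for r s i
  define P where "P f = (\<Prod>r=1..n. \<Prod>s=1..n. (f r s :: complex))" for f
  have Pm: "P f * P g = P (\<lambda>r s. f r s * g r s)" for f g
    by (simp add: P_def prod.distrib)
  have Pd: "P f / P g = P (\<lambda>r s. f r s / g r s)" for f g
    by (simp add: P_def prod_dividef)
  have Pswap: "P f = P (\<lambda>r s. f s r)" for f
    unfolding P_def by (rule prod.swap)
  have Pcong: "P f = P g" if "\<And>r s. r \<in> {1..n} \<Longrightarrow> s \<in> {1..n} \<Longrightarrow> f r s = g r s" for f g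
    unfolding P_def using that by (intro prod.cong refl)
  have y_nz: "y r \<noteq> 0" if "r \<in> {1..n}" for r using that by (simp add: y_def)
  have qyy: "qpoch q (q * y r / y s) i \<noteq> 0" if "r \<in> {1..n}" "s \<in> {1..n}" for r s i
    unfolding y_def by (rule q_strings.qpoch_string_nz[OF q_strings_shift that])
  have qyx: "qpoch q (q * y r / x s) i \<noteq> 0" if "r \<in> {1..n}" "s \<in> {1..n}" for r s i
    using qpoch_string_nz[OF that, of "m r + i"] by (simp add: qpoch_add y_def mult_ac)
  have D_nz: "D r s i \<noteq> 0" if "r \<in> {1..n}" "s \<in> {1..n}" for r s i
    unfolding D_def by (rule qpoch_string_nz[OF that])
  have Nsplit: "N (\<nu> s) r s (m r + j r) = N (\<nu> s) r s (m r) * qpoch q (q powi (- int (\<nu> s - m s)) * (y r / y s)) (j r)"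
    if "r \<in> {1..n}" "s \<in> {1..n}" for r s
  proof -
    have "q powi (- int (\<nu> s - m s)) = q powi (- int (\<nu> s)) * q ^ m s"
      using le[OF that(2)] by (simp add: of_nat_diff power_int_diff power_int_minus field_simps)
    then have "q powi (- int (\<nu> s)) * (x r / x s) * q ^ m r = q powi (- int (\<nu> s - m s)) * (y r / y s)"
      by (simp add: y_def)
    then show ?thesis unfolding N_def qpoch_add by simp
  qed
  have Dsplit: "D r s (m r + j r) = D r s (m r) * qpoch q (q * y r / x s) (j r)" for r s
    unfolding D_def qpoch_add by (simp add: y_def mult_ac)
  have exch: "N (m s + j s) r s (m r) * q ^ (m r * j s) / qpoch q (q * y s / x r) (j s)
     = N (m s) r s (m r) / qpoch q (q * y s / y r) (j s)" if rs: "r \<in> {1..n}" "s \<in> {1..n}" for r s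
  proof -
    define w where "w = q powi (- int (m s)) * (x r / x s)"
    have w: "w \<noteq> 0" using rs by (simp add: w_def)
    have 1: "w * q powi (- int (j s)) = q powi (- int (m s + j s)) * (x r / x s)"
      unfolding w_def power_int_minus power_int_of_nat power_add by simp
    have 2: "q / w = q * y s / x r" "q powi (1 - int (m r)) / w = q * y s / y r"
      using rs by (simp_all add: w_def y_def power_int_minus power_int_diff field_simps)
    have "N (m s + j s) r s (m r) * qpoch q (q * y s / y r) (j s) * q ^ (m r * j s) = N (m s) r s (m r) * qpoch q (q * y s / x r) (j s)"
      using qpoch_shift_exchange[OF q_nz w, of "j s" "m r"] unfolding 1 2 by (simp add: N_def w_def)
    then show ?thesis
      using qyy[OF rs(2,1), of "j s"] qyx[OF rs(2,1), of "j s"] by (simp add: field_simps)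
  qed
  have prods: "P (\<lambda>r s. N (\<nu> s) r s (m r + j r) / D r s (m r + j r)) * P (\<lambda>r s. N (m s + j s) r s (m r) / D r s (m r))
      * q ^ (msize n m * msize n j)
     = P (\<lambda>r s. qpoch q (q powi (- int (\<nu> s - m s)) * (y r / y s)) (j r) / qpoch q (q * y r / y s) (j r))
      * (P (\<lambda>r s. N (\<nu> s) r s (m r) / D r s (m r)) * P (\<lambda>r s. N (m s) r s (m r) / D r s (m r)))"
  proof -
    have combine: "A * B / C * D * E = A / F * (B * G)" if "D * E / C = G / F" for A B C D E F G :: complex
    proof -
      have "A * B / C * D * E = A * B * (D * E / C)" by simp
      then show ?thesis unfolding that by simp
    qed
    have 1: "q ^ (msize n m * msize n j) = P (\<lambda>r s. q ^ (m r * j s))"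
      by (simp add: P_def msize_def sum_product power_sum)
    have 2: "P (\<lambda>r s. N (\<nu> s) r s (m r + j r) / D r s (m r + j r))
      = P (\<lambda>r s. qpoch q (q powi (- int (\<nu> s - m s)) * (y r / y s)) (j r) * (N (\<nu> s) r s (m r) / D r s (m r)))
        / P (\<lambda>r s. qpoch q (q * y r / x s) (j r))"
      unfolding Pd by (rule Pcong) (simp add: Nsplit Dsplit)
    have 3: "P (\<lambda>r s. N (m s + j s) r s (m r) / D r s (m r)) * P (\<lambda>r s. q ^ (m r * j s)) / P (\<lambda>r s. qpoch q (q * y r / x s) (j r))
      = P (\<lambda>r s. N (m s) r s (m r) / D r s (m r)) / P (\<lambda>r s. qpoch q (q * y r / y s) (j r))"
    proof -
      \<comment> \<open>The exchange pairs a numerator at (r, s) with a denominator at (s, r), so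
        the double product of denominators is transposed first.\<close>
      have "P (\<lambda>r s. N (m s + j s) r s (m r) / D r s (m r)) * P (\<lambda>r s. q ^ (m r * j s)) / P (\<lambda>r s. qpoch q (q * y r / x s) (j r))
        = P (\<lambda>r s. N (m s + j s) r s (m r) * q ^ (m r * j s) / qpoch q (q * y s / x r) (j s) / D r s (m r))"
        unfolding Pm by (subst (2) Pswap) (simp add: Pd mult_ac)
      also have "\<dots> = P (\<lambda>r s. N (m s) r s (m r) / qpoch q (q * y s / y r) (j s) / D r s (m r))"
        by (rule Pcong) (simp only: exch)
      also have "\<dots> = P (\<lambda>r s. N (m s) r s (m r) / D r s (m r)) / P (\<lambda>r s. qpoch q (q * y r / y s) (j r))"
        by (subst (3) Pswap) (simp add: Pd mult_ac)
      finally show ?thesis .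
    qed
    show ?thesis
      unfolding 1 2 Pm[symmetric] Pd[symmetric, of _ "\<lambda>r s. qpoch q (q * y r / y s) (j r)"]
      by (rule combine[OF 3])
  qed
  have pw: "q ^ (\<Sum>r=1..n. r * (m r + j r)) = q ^ (\<Sum>r=1..n. r * j r) * q ^ (\<Sum>r=1..n. r * m r)"
    by (simp add: distrib_left sum.distrib power_add)
  have rearrange: "(vj * vm * R1 * (pj * pm)) * (vm * R2 * pm) * E = (vj * R3 * pj) * ((vm * R4 * pm) * (vm * R5 * pm))"
    if "R1 * R2 * E = R3 * (R4 * R5)" for vj vm R1 R2 R3 R4 R5 pj pm E :: complex
  proof -
    have "(vj * vm * R1 * (pj * pm)) * (vm * R2 * pm) * E = (R1 * R2 * E) * (vj * vm * pj * pm * vm * pm)"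
      by (simp only: mult_ac)
    then show ?thesis unfolding that by (simp only: mult_ac)
  qed
  show ?thesis
    unfolding mterm_def vandermonde_ratio_add pw
    by (rule rearrange[OF prods[unfolded P_def N_def D_def y_def]])
qed

end

lemma msize_cong: "(\<And>r. r \<in> {1..n} \<Longrightarrow> k r = k' r) \<Longrightarrow> msize n k = msize n k'"
  unfolding msize_def by (rule sum.cong) auto

lemma msize_add: "msize n (\<lambda>r. m r + j r) = msize n m + msize n j"
  by (simp add: msize_def sum.distrib)

lemma mterm_cong:
  assumes "\<And>r. r \<in> {1..n} \<Longrightarrow> k r = k' r" "\<And>r. r \<in> {1..n} \<Longrightarrow> m r = m' r"
  shows "mterm q n x k m = mterm q n x k' m'"
proof -
  have "vandermonde_ratio q n x m = vandermonde_ratio q n x m'"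
    unfolding vandermonde_ratio_def by (intro prod.cong refl) (use assms(2) in simp)
  moreover have "(\<Prod>r=1..n. \<Prod>s=1..n.
          qpoch q (q powi (- int (k s)) * (x r / x s)) (m r) / qpoch q (q * x r / x s) (m r))
      = (\<Prod>r=1..n. \<Prod>s=1..n.
          qpoch q (q powi (- int (k' s)) * (x r / x s)) (m' r) / qpoch q (q * x r / x s) (m' r))"
    by (intro prod.cong refl) (use assms in simp)
  moreover have "(\<Sum>r=1..n. r * m r) = (\<Sum>r=1..n. r * m' r)"
    by (intro sum.cong refl) (use assms(2) in simp)
  ultimately show ?thesis by (simp only: mterm_def)
qed

context q_strings
begin

section \<open>Inversion of the kernel\<close>

lemma msum_0_param_sum:
  "(\<Sum>m\<in>multi_indices_le n k. mterm q n x k m * f (msize n m))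
    = (\<Sum>M\<le>msize n k. qpoch q (q powi (- int (msize n k))) M * q ^ M / qpoch q q M * f M)"
proof -
  have "(\<Sum>m\<in>multi_indices_le n k. mterm q n x k m * f (msize n m))
    = (\<Sum>M\<le>msize n k. \<Sum>m\<in>mlevel n M. mterm q n x k m * f (msize n m))"
    by (rule sum_multi_indices_le_levels) (auto simp: mterm_eq_0)
  also have "\<dots> = (\<Sum>M\<le>msize n k. msum k 0 M * f M)"
    unfolding msum_def sum_distrib_right
    by (intro sum.cong refl) (auto simp: mlevel_def)
  finally show ?thesis by (simp only: milne_fundamental_lemma)
qed

text \<open>The box below k meets the level |k| only in k itself, so the level sum given by the
  fundamental lemma consists of this single term.\<close>

lemma mterm_self:
  assumes "k \<in> multi_indices n"
  shows "mterm q n x k k = qpoch q (q powi (- int (msize n k))) (msize n k) * q ^ msize n k / qpoch q q (msize n k)"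
proof -
  have "msum k 0 (msize n k) = (\<Sum>m\<in>mlevel n (msize n k). mterm q n x k m)"
    by (simp add: msum_def)
  also have "\<dots> = (\<Sum>m\<in>{k}. mterm q n x k m)"
  proof (rule sum.mono_neutral_right)
    show "{k} \<subseteq> mlevel n (msize n k)" using assms by (simp add: mlevel_def)
    show "\<forall>m\<in>mlevel n (msize n k) - {k}. mterm q n x k m = 0"
    proof
      fix m assume m: "m \<in> mlevel n (msize n k) - {k}"
      show "mterm q n x k m = 0"
      proof (cases "\<exists>r\<in>{1..n}. k r < m r")
        case False
        then have le: "m r \<le> k r" if "r \<in> {1..n}" for r using that by (meson not_le)
        have "(\<Sum>r=1..n. m r) = (\<Sum>r=1..n. k r)" using m by (simp add: mlevel_def msize_def)
        then have "m r = k r" if "r \<in> {1..n}" for r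
          using le sum_mono_inv[of m "{1..n}" k r] that by auto
        then have "m = k"
          using m assms by (intro PiE_ext[of m "{1..n}" "\<lambda>_. UNIV" k]) (auto simp: mlevel_def multi_indices_def)
        then show ?thesis using m by simp
      qed (use mterm_eq_0 in blast)
    qed
  qed simp
  finally show ?thesis by (simp add: milne_fundamental_lemma)
qed

text \<open>On the diagonal m = \<nu> of the inversion the kernel occurs squared. The sign (-1)^|k|
  disappears, and the power of q cancels the one supplied by the weights of the outer sum.\<close>

lemma mterm_self_square:
  assumes "k \<in> multi_indices n"
  shows "(mterm q n x k k)\<^sup>2 * q ^ (msize n k * (msize n k - 1)) = 1"
proof -
  define N where "N = msize n k"
  define w where "w = q powi (- int N)"
  have w: "w \<noteq> 0" "w * q ^ N = 1" by (simp_all add: w_def power_int_minus)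
  have sq: "(\<Prod>i<j. - w * q ^ i)\<^sup>2 = w ^ (2 * j) * q ^ (j * (j - 1))" for j
  proof (induction j)
    case (Suc j)
    have "Suc j * (Suc j - 1) = j * (j - 1) + 2 * j"
      by (cases j) (auto simp: algebra_simps)
    then show ?case
      by (simp only: prod.lessThan_Suc power_mult_distrib Suc.IH)
        (simp add: power_add power_mult power2_eq_square power_mult_distrib mult_ac)
  qed simp
  have "q powi (1 - int N) / w = q"
    by (simp add: w_def power_int_diff power_int_minus)
  then have "qpoch q w N = (\<Prod>i<N. - w * q ^ i) * qpoch q q N"
    using qpoch_reverse[OF q_nz w(1), of N] by simp
  then have "mterm q n x k k = (\<Prod>i<N. - w * q ^ i) * q ^ N"
    using mterm_self[OF assms] qpoch_q_nz[of N] by (simp add: N_def[symmetric] w_def[symmetric])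
  then have "(mterm q n x k k)\<^sup>2 * q ^ (N * (N - 1)) = w ^ (2 * N) * q ^ (N * (N - 1)) * q ^ (2 * N) * q ^ (N * (N - 1))"
    by (simp only: power_mult_distrib sq) (simp add: power_mult[symmetric] mult_ac)
  also have "\<dots> = w ^ (2 * N) * q ^ (2 * (N * N))"
  proof -
    have "N * (N - 1) + 2 * N + N * (N - 1) = 2 * (N * N)" by (cases N) (auto simp: algebra_simps)
    then show ?thesis by (simp only: mult.assoc power_add[symmetric])
  qed
  also have "\<dots> = (w * q ^ N) ^ (2 * N)"
    by (simp add: power_mult_distrib mult_ac flip: power_mult)
  finally show ?thesis by (simp only: w(2) power_one flip: N_def)
qed

text \<open>After substituting k = m + j, the composition law leaves a single kernel in j on the
  shifted strings. The fundamental lemma sums it over each level |j| = J.\<close>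

lemma bailey_inversion_sum:
  assumes m: "m \<in> multi_indices_le n \<nu>"
  defines "L \<equiv> msize n \<nu> - msize n m"
  shows "(\<Sum>k\<in>multi_indices_le n \<nu>. mterm q n x \<nu> k * mterm q n x k m * g (msize n k))
    = mterm q n x \<nu> m * mterm q n x m m
      * (\<Sum>J\<le>L. qpoch q (q powi (- int L)) J * q ^ J / qpoch q q J * (g (msize n m + J) / q ^ (msize n m * J)))"
proof -
  let ?y = "\<lambda>r. x r * q ^ m r"
  interpret Y: q_strings q n ?y by (rule q_strings_shift)
  define \<mu> where "\<mu> r = \<nu> r - m r" for r
  have \<mu>_fun: "\<mu> = (\<lambda>r. \<nu> r - m r)" by (simp add: \<mu>_def fun_eq_iff)
  have le: "m r \<le> \<nu> r" if "r \<in> {1..n}" for r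
    using m that by (auto simp: multi_indices_le_eq)
  have "msize n (\<lambda>r. m r + \<mu> r) = msize n \<nu>"
    by (rule msize_cong) (simp add: \<mu>_def le)
  then have L: "msize n \<mu> = L" by (simp add: msize_add L_def)
  define S where "S = {k \<in> multi_indices_le n \<nu>. \<forall>r\<in>{1..n}. m r \<le> k r}"
  have "(\<Sum>k\<in>multi_indices_le n \<nu>. mterm q n x \<nu> k * mterm q n x k m * g (msize n k))
    = (\<Sum>k\<in>S. mterm q n x \<nu> k * mterm q n x k m * g (msize n k))"
  proof (rule sum.mono_neutral_right[OF finite_multi_indices_le])
    show "\<forall>k\<in>multi_indices_le n \<nu> - S. mterm q n x \<nu> k * mterm q n x k m * g (msize n k) = 0"
      using mterm_eq_0[of _ _ m] by (force simp: S_def not_le)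
  qed (auto simp: S_def)
  also have "\<dots> = (\<Sum>j\<in>multi_indices_le n \<mu>. mterm q n x \<nu> (\<lambda>r. m r + j r) * mterm q n x (\<lambda>r. m r + j r) m
       * g (msize n m + msize n j))"
  proof (rule sum.reindex_bij_witness[of _ "\<lambda>j. \<lambda>r\<in>{1..n}. m r + j r" "\<lambda>k. \<lambda>r\<in>{1..n}. k r - m r"])
    fix k assume k: "k \<in> S"
    then have kl: "\<And>r. r \<in> {1..n} \<Longrightarrow> m r \<le> k r" "\<And>r. r \<in> {1..n} \<Longrightarrow> k r \<le> \<nu> r" "k \<in> extensional {1..n}"
      by (auto simp: S_def multi_indices_le_def PiE_iff)
    show "(\<lambda>r\<in>{1..n}. m r + (\<lambda>r\<in>{1..n}. k r - m r) r) = k"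
      using kl by (intro extensionalityI[of _ "{1..n}"]) auto
    show "(\<lambda>r\<in>{1..n}. k r - m r) \<in> multi_indices_le n \<mu>"
      using kl by (auto simp: multi_indices_le_def \<mu>_def intro!: diff_le_mono)
    have eq: "\<And>r. r \<in> {1..n} \<Longrightarrow> m r + (\<lambda>r\<in>{1..n}. k r - m r) r = k r"
      using kl by simp
    have 1: "mterm q n x \<nu> (\<lambda>r. m r + (\<lambda>r\<in>{1..n}. k r - m r) r) = mterm q n x \<nu> k"
      by (rule mterm_cong) (simp_all only: eq)
    have 2: "mterm q n x (\<lambda>r. m r + (\<lambda>r\<in>{1..n}. k r - m r) r) m = mterm q n x k m"
      by (rule mterm_cong) (simp_all only: eq)
    have 3: "msize n m + msize n (\<lambda>r\<in>{1..n}. k r - m r) = msize n k"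
      unfolding msize_add[symmetric] by (rule msize_cong) (simp only: eq)
    show "mterm q n x \<nu> (\<lambda>r. m r + (\<lambda>r\<in>{1..n}. k r - m r) r) * mterm q n x (\<lambda>r. m r + (\<lambda>r\<in>{1..n}. k r - m r) r) m
       * g (msize n m + msize n (\<lambda>r\<in>{1..n}. k r - m r)) = mterm q n x \<nu> k * mterm q n x k m * g (msize n k)"
      by (simp only: 1 2 3)
  next
    fix j assume j: "j \<in> multi_indices_le n \<mu>"
    then have jl: "\<And>r. r \<in> {1..n} \<Longrightarrow> j r \<le> \<mu> r" "j \<in> extensional {1..n}"
      by (auto simp: multi_indices_le_def PiE_iff)
    show "(\<lambda>r\<in>{1..n}. (\<lambda>r\<in>{1..n}. m r + j r) r - m r) = j"
      using jl by (intro extensionalityI[of _ "{1..n}"]) auto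
    have "m r + j r \<le> \<nu> r" if "r \<in> {1..n}" for r
      using jl(1)[OF that] le[OF that] by (simp add: \<mu>_def)
    then show "(\<lambda>r\<in>{1..n}. m r + j r) \<in> S"
      by (auto simp: S_def multi_indices_le_def)
  qed
  also have "\<dots> = (\<Sum>j\<in>multi_indices_le n \<mu>. mterm q n ?y \<mu> j * (mterm q n x \<nu> m * mterm q n x m m
       * (g (msize n m + msize n j) / q ^ (msize n m * msize n j))))"
  proof (rule sum.cong[OF refl])
    fix j
    have "mterm q n x \<nu> (\<lambda>r. m r + j r) * mterm q n x (\<lambda>r. m r + j r) m
      = mterm q n ?y \<mu> j * (mterm q n x \<nu> m * mterm q n x m m) / q ^ (msize n m * msize n j)"
      unfolding \<mu>_fun using mterm_compose[where j = j, OF le] by (simp add: nonzero_eq_divide_eq)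
    then show "mterm q n x \<nu> (\<lambda>r. m r + j r) * mterm q n x (\<lambda>r. m r + j r) m * g (msize n m + msize n j)
      = mterm q n ?y \<mu> j * (mterm q n x \<nu> m * mterm q n x m m
         * (g (msize n m + msize n j) / q ^ (msize n m * msize n j)))"
      by simp
  qed
  also have "\<dots> = (\<Sum>J\<le>L. qpoch q (q powi (- int L)) J * q ^ J / qpoch q q J
      * (mterm q n x \<nu> m * mterm q n x m m * (g (msize n m + J) / q ^ (msize n m * J))))"
    unfolding Y.msum_0_param_sum[of \<mu> "\<lambda>J. mterm q n x \<nu> m * mterm q n x m m * (g (msize n m + J) / q ^ (msize n m * J))"] L ..
  also have "\<dots> = mterm q n x \<nu> m * mterm q n x m m
      * (\<Sum>J\<le>L. qpoch q (q powi (- int L)) J * q ^ J / qpoch q q J * (g (msize n m + J) / q ^ (msize n m * J)))"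
    unfolding sum_distrib_left by (intro sum.cong refl) (simp only: mult_ac)
  finally show ?thesis .
qed

text \<open>Since (\<alpha>)_(M+J) (\<alpha> q^(M+J))_M = (\<alpha>)_(2M) (\<alpha> q^(2M))_J, the
  one-dimensional sum is the telescoping one with \<alpha> q^(2M) for \<alpha> and L = |\<nu>| -
  |m|. It vanishes for L > 0, and L = 0 forces m = \<nu> because m lies below \<nu>.\<close>

lemma bailey_inversion:
  assumes \<nu>: "\<nu> \<in> multi_indices n" and m: "m \<in> multi_indices_le n \<nu>" and \<alpha>: "\<alpha> \<noteq> 1"
    and nz: "\<And>j. qpoch q (\<alpha> * q ^ Suc (msize n \<nu>)) j \<noteq> 0"
  shows "(\<Sum>k\<in>multi_indices_le n \<nu>. mterm q n x \<nu> k * mterm q n x k m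
       * (q powi ((int (msize n \<nu>) - 1) * int (msize n k))
          * ((1 - \<alpha> * q ^ (2 * msize n k)) * qpoch q \<alpha> (msize n k)
             / ((1 - \<alpha>) * qpoch q (\<alpha> * q ^ Suc (msize n \<nu>)) (msize n k)))
          * qpoch q (\<alpha> * q ^ msize n k) (msize n m)))
    = (if m = \<nu> then qpoch q (\<alpha> * q) (msize n \<nu>) else 0)"
proof -
  define N M L where "N = msize n \<nu>" and "M = msize n m" and "L = N - M"
  define g where "g K = q powi ((int N - 1) * int K)
      * ((1 - \<alpha> * q ^ (2 * K)) * qpoch q \<alpha> K / ((1 - \<alpha>) * qpoch q (\<alpha> * q ^ Suc N) K)) * qpoch q (\<alpha> * q ^ K) M" for K
  define \<alpha>' where "\<alpha>' = \<alpha> * q ^ (2 * M)"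
  \<comment> \<open>The part of the summand that does not depend on J once \<alpha>' has absorbed
    q^(2M).\<close>
  define c where "c = q powi ((int N - 1) * int M) * qpoch q \<alpha> (2 * M) / ((1 - \<alpha>) * qpoch q (\<alpha> * q ^ Suc N) M)"
  have le: "m r \<le> \<nu> r" if "r \<in> {1..n}" for r
    using m that by (auto simp: multi_indices_le_eq)
  then have MN: "M \<le> N" unfolding M_def N_def msize_def by (intro sum_mono) auto
  have \<alpha>'L: "\<alpha>' * q ^ Suc L = \<alpha> * q ^ Suc N * q ^ M"
  proof -
    have "2 * M + Suc L = Suc N + M" using MN by (simp add: L_def)
    then show ?thesis by (simp only: \<alpha>'_def mult.assoc power_add[symmetric])
  qed
  have term_eq: "qpoch q (q powi (- int L)) J * q ^ J / qpoch q q J * (g (M + J) / q ^ (M * J))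
    = c * (qpoch q (q powi (- int L)) J * q ^ (L * J) / qpoch q q J
        * ((1 - \<alpha>' * q ^ (2 * J)) * qpoch q \<alpha>' J / qpoch q (\<alpha>' * q ^ Suc L) J))" for J
  proof -
    have 1: "qpoch q \<alpha> (M + J) * qpoch q (\<alpha> * q ^ (M + J)) M = qpoch q \<alpha> (2 * M) * qpoch q \<alpha>' J"
    proof -
      have "M + J + M = 2 * M + J" by simp
      then show ?thesis unfolding \<alpha>'_def qpoch_add[symmetric] by (simp only:)
    qed
    have 2: "qpoch q (\<alpha> * q ^ Suc N) (M + J) = qpoch q (\<alpha> * q ^ Suc N) M * qpoch q (\<alpha>' * q ^ Suc L) J"
      unfolding \<alpha>'L qpoch_add ..
    have 3: "\<alpha> * q ^ (2 * (M + J)) = \<alpha>' * q ^ (2 * J)"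
      by (simp add: \<alpha>'_def distrib_left power_add mult.assoc)
    have 4: "q powi ((int N - 1) * int (M + J)) * q ^ J / q ^ (M * J) = q powi ((int N - 1) * int M) * q ^ (L * J)"
    proof -
      have "(int N - 1) * int (M + J) + int J = (int N - 1) * int M + int (L * J) + int (M * J)"
        using MN by (simp add: L_def of_nat_diff algebra_simps)
      then have "q powi ((int N - 1) * int (M + J)) * q powi (int J)
         = q powi ((int N - 1) * int M) * q powi (int (L * J)) * q powi (int (M * J))"
        by (simp only: power_int_add[symmetric] q_nz simp_thms)
      then show ?thesis by (simp only: power_int_of_nat) simp
    qed
    have re: "a * e / f * (p * ((s * t) / (u * v)) * w / h) = a * (p * e / h) / f * (s * (t * w) / (u * v))"
      for a e f p s t u v w h :: complex
      by (simp add: mult_ac)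
    have re2: "a * (p * l) / f * (s * (t * w) / (u * (v * z))) = p * t / (u * v) * (a * l / f * (s * w / z))"
      for a e f p s t u v w l z :: complex
      by (simp add: mult_ac)
    show ?thesis
      unfolding g_def re 1 2 3 4 c_def by (rule re2)
  qed
  have "(\<Sum>k\<in>multi_indices_le n \<nu>. mterm q n x \<nu> k * mterm q n x k m * g (msize n k))
    = mterm q n x \<nu> m * mterm q n x m m
      * (\<Sum>J\<le>L. qpoch q (q powi (- int L)) J * q ^ J / qpoch q q J * (g (M + J) / q ^ (M * J)))"
    using bailey_inversion_sum[OF m, of g] by (simp only: L_def N_def M_def)
  also have "\<dots> = mterm q n x \<nu> m * mterm q n x m m * (c * (if L = 0 then 1 - \<alpha>' else 0))"
  proof -
    have "qpoch q (\<alpha>' * q ^ Suc L) J \<noteq> 0" for J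
      using nz[of "M + J"] unfolding \<alpha>'L N_def[symmetric] qpoch_add by simp
    from telescoping_sum_total[OF this] show ?thesis
      unfolding term_eq sum_distrib_left[symmetric] by simp
  qed
  also have "\<dots> = (if m = \<nu> then qpoch q (\<alpha> * q) N else 0)"
  proof (cases "m = \<nu>")
    case True
    then have MN: "M = N" "L = 0" by (simp_all add: M_def N_def L_def)
    have "(int N - 1) * int N = int (N * (N - 1))" by (cases N) (auto simp: algebra_simps)
    then have p: "q powi ((int N - 1) * int N) = q ^ (N * (N - 1))"
      by (simp only: power_int_of_nat)
    have "qpoch q \<alpha> (2 * N) * (1 - \<alpha>') = qpoch q \<alpha> (Suc (2 * N))"
      by (simp add: qpoch_Suc \<alpha>'_def MN)
    also have "\<dots> = (1 - \<alpha>) * (qpoch q (\<alpha> * q) N * qpoch q (\<alpha> * q ^ Suc N) N)"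
    proof -
      have "2 * N = N + N" by simp
      then show ?thesis by (simp only: qpoch_Suc' qpoch_add) (simp add: mult.assoc)
    qed
    finally have fin: "qpoch q \<alpha> (2 * N) * (1 - \<alpha>') = (1 - \<alpha>) * (qpoch q (\<alpha> * q) N * qpoch q (\<alpha> * q ^ Suc N) N)" .
    have "c * (1 - \<alpha>') = q ^ (N * (N - 1)) * (qpoch q \<alpha> (2 * N) * (1 - \<alpha>')) / ((1 - \<alpha>) * qpoch q (\<alpha> * q ^ Suc N) N)"
      unfolding c_def MN p by simp
    also have "\<dots> = q ^ (N * (N - 1)) * qpoch q (\<alpha> * q) N"
      unfolding fin using nz[of N] \<alpha> by (simp add: N_def[symmetric])
    finally have "c * (1 - \<alpha>') = q ^ (N * (N - 1)) * qpoch q (\<alpha> * q) N" .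
    then show ?thesis
      using mterm_self_square[OF \<nu>] True MN by (simp add: N_def[symmetric] power2_eq_square mult.assoc[symmetric])
  next
    case False
    have "L \<noteq> 0"
    proof
      assume "L = 0"
      then have "M = N" using MN by (simp add: L_def)
      then have "(\<Sum>r=1..n. m r) = (\<Sum>r=1..n. \<nu> r)" by (simp add: M_def N_def msize_def)
      then have "m r = \<nu> r" if "r \<in> {1..n}" for r
        using le sum_mono_inv[of m "{1..n}" \<nu> r] that by auto
      then have "m = \<nu>"
        using m \<nu> by (intro PiE_ext[of m "{1..n}" "\<lambda>_. UNIV" \<nu>]) (auto simp: multi_indices_le_eq multi_indices_def)
      then show False using False by simp
    qed
    then show ?thesis using False by simp
  qed
  finally show ?thesis
    by (simp only: g_def N_def M_def mult.assoc)
qed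

text \<open>Here q x_r/(x_s a_s) is q^(-\<nu>_s) x_r/x_s, the base of a kernel numerator. As a_1 ...
  a_n = q^(|\<nu>| + n), the explicit factor q^(-n |k|) is cancelled; completing (r - 1) k_r to r
  k_r costs a further q^(-|k|).\<close>

lemma numer_poly_terminating:
  assumes a: "\<And>r. r \<in> {1..n} \<Longrightarrow> a r = q ^ Suc (\<nu> r)"
  shows "vandermonde_ratio q n x k * (numer_poly q n x a k / (\<Prod>r=1..n. \<Prod>s=1..n. qpoch q (q * x r / x s) (k r)))
      * q powi ((\<Sum>r=1..n. (int r - 1) * int (k r)) - int n * int (msize n k))
    = mterm q n x \<nu> k * q powi ((int (msize n \<nu>) - 1) * int (msize n k))"
proof -
  define K where "K = msize n k"
  have "(\<Prod>s=1..n. a s) = (\<Prod>s=1..n. q ^ Suc (\<nu> s))"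
    using a by (intro prod.cong) auto
  also have "\<dots> = q ^ (msize n \<nu> + n)"
    by (simp add: msize_def power_add power_sum prod.distrib mult.commute)
  finally have A: "(\<Prod>s=1..n. a s) = q ^ (msize n \<nu> + n)" .
  have "(\<Prod>r=1..n. \<Prod>s=1..n. qpoch q (q * x r / (x s * a s)) (k r))
      = (\<Prod>r=1..n. \<Prod>s=1..n. qpoch q (q powi (- int (\<nu> s)) * (x r / x s)) (k r))"
    by (intro prod.cong refl arg_cong2[of _ _ _ _ "qpoch q"]) (simp add: a power_int_minus field_simps)
  moreover have "\<forall>s\<in>{1..n}. a s \<noteq> 0" by (simp add: a)
  ultimately have np: "numer_poly q n x a k
      = (\<Prod>r=1..n. \<Prod>s=1..n. qpoch q (q powi (- int (\<nu> s)) * (x r / x s)) (k r)) * q ^ ((msize n \<nu> + n) * K)"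
    by (simp only: numer_poly_eq A K_def power_mult)
  have pw: "q ^ ((msize n \<nu> + n) * K) * q powi ((\<Sum>r=1..n. (int r - 1) * int (k r)) - int n * int K)
     = q ^ (\<Sum>r=1..n. r * k r) * q powi ((int (msize n \<nu>) - 1) * int K)"
  proof -
    have "(\<Sum>r=1..n. (int r - 1) * int (k r)) = int (\<Sum>r=1..n. r * k r) - int K"
      by (simp add: K_def msize_def algebra_simps sum_subtractf)
    then have "int ((msize n \<nu> + n) * K) + ((\<Sum>r=1..n. (int r - 1) * int (k r)) - int n * int K)
       = int (\<Sum>r=1..n. r * k r) + (int (msize n \<nu>) - 1) * int K"
      by (simp add: algebra_simps)
    then have "q powi (int ((msize n \<nu> + n) * K)) * q powi ((\<Sum>r=1..n. (int r - 1) * int (k r)) - int n * int K)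
       = q powi (int (\<Sum>r=1..n. r * k r)) * q powi ((int (msize n \<nu>) - 1) * int K)"
      by (simp only: power_int_add[symmetric] q_nz simp_thms)
    then show ?thesis by (simp only: power_int_of_nat)
  qed
  have re: "v * (p * e / d) * f = v * (p / d) * g * h" if "e * f = g * h" for v p e d f g h :: complex
  proof -
    have "v * (p * e / d) * f = v * (p / d) * (e * f)" by simp
    then show ?thesis by (simp only: that mult.assoc)
  qed
  show ?thesis
    unfolding np mterm_def prod_dividef K_def[symmetric] by (rule re[OF pw])
qed

lemma outer_sum_terminating:
  assumes \<nu>: "\<nu> \<in> multi_indices n" and a: "\<And>r. r \<in> {1..n} \<Longrightarrow> a r = q ^ Suc (\<nu> r)"
    and \<alpha>: "\<alpha> \<noteq> 1" and nz: "\<And>j. qpoch q (\<alpha> * q ^ Suc (msize n \<nu>)) j \<noteq> 0"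
  shows "((\<lambda>k. outer_term q n \<alpha> \<beta> \<gamma> a b c d x k) has_sum
     (qpoch q (\<alpha> * q) (msize n \<nu>)
       * (qpochs q [\<alpha> * \<beta>, \<alpha> * \<gamma>] (msize n \<nu>)
          / (qpochs q [\<alpha> * c, \<alpha> * d] (msize n \<nu>) * (\<Prod>r=1..n. qpoch q (\<alpha> * b * x r) (\<nu> r))))))
     (multi_indices n)"
proof -
  define N where "N = msize n \<nu>"
  define F where "F m = qpochs q [\<alpha> * \<beta>, \<alpha> * \<gamma>] (msize n m)
     / (qpochs q [\<alpha> * c, \<alpha> * d] (msize n m) * (\<Prod>r=1..n. qpoch q (\<alpha> * b * x r) (m r)))" for m
  define G where "G K = q powi ((int N - 1) * int K)
      * ((1 - \<alpha> * q ^ (2 * K)) * qpoch q \<alpha> K / ((1 - \<alpha>) * qpoch q (\<alpha> * q ^ Suc N) K))" for K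
  have "(\<Prod>s=1..n. a s) = (\<Prod>s=1..n. q ^ Suc (\<nu> s))"
    using a by (intro prod.cong) auto
  also have "\<dots> = q ^ N * q ^ n"
    by (simp add: N_def msize_def power_sum prod.distrib mult.commute)
  finally have A: "\<alpha> * (\<Prod>s=1..n. a s) * q powi (1 - int n) = \<alpha> * q ^ Suc N"
    by (simp add: power_int_diff)
  have outer: "outer_term q n \<alpha> \<beta> \<gamma> a b c d x k = mterm q n x \<nu> k * G (msize n k) * inner_sum q n \<alpha> \<beta> \<gamma> b c d x k" for k
  proof -
    have re: "v * p * g * w * i = m * (e * g) * i" if "v * p * w = m * e" for v p g w i m e :: complex
    proof -
      have "v * p * g * w * i = (v * p * w) * (g * i)" by (simp only: mult_ac)
      then show ?thesis unfolding that by (simp only: mult_ac)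
    qed
    show ?thesis
      unfolding outer_term_def A G_def N_def by (rule re[OF numer_poly_terminating[OF a]])
  qed
  have inner: "inner_sum q n \<alpha> \<beta> \<gamma> b c d x k = (\<Sum>m\<in>multi_indices_le n \<nu>. mterm q n x k m * qpoch q (\<alpha> * q ^ msize n k) (msize n m) * F m)"
    if k: "k \<in> multi_indices_le n \<nu>" for k
  proof -
    have "inner_sum q n \<alpha> \<beta> \<gamma> b c d x k = (\<Sum>m\<in>multi_indices_le n k. mterm q n x k m * qpoch q (\<alpha> * q ^ msize n k) (msize n m) * F m)"
      unfolding inner_sum_eq F_def by (intro sum.cong refl) (simp add: qpochs_def)
    \<comment> \<open>The kernel vanishes unless m lies below k. So both sums can run over the box
      below \<nu>, and their order can be changed.\<close>
    also have "\<dots> = (\<Sum>m\<in>multi_indices_le n \<nu>. mterm q n x k m * qpoch q (\<alpha> * q ^ msize n k) (msize n m) * F m)"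
    proof (rule sum.mono_neutral_left[OF finite_multi_indices_le])
      show "multi_indices_le n k \<subseteq> multi_indices_le n \<nu>"
        using k by (force simp: multi_indices_le_eq intro: order_trans)
      show "\<forall>m\<in>multi_indices_le n \<nu> - multi_indices_le n k. mterm q n x k m * qpoch q (\<alpha> * q ^ msize n k) (msize n m) * F m = 0"
        using mterm_eq_0 by (force simp: multi_indices_le_eq not_le)
    qed
    finally show ?thesis .
  qed
  have "(\<Sum>k\<in>multi_indices_le n \<nu>. outer_term q n \<alpha> \<beta> \<gamma> a b c d x k)
    = (\<Sum>k\<in>multi_indices_le n \<nu>. \<Sum>m\<in>multi_indices_le n \<nu>.
         F m * (mterm q n x \<nu> k * mterm q n x k m * (G (msize n k) * qpoch q (\<alpha> * q ^ msize n k) (msize n m))))"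
    by (intro sum.cong refl) (simp add: outer inner sum_distrib_left mult_ac)
  also have "\<dots> = (\<Sum>m\<in>multi_indices_le n \<nu>. F m * (\<Sum>k\<in>multi_indices_le n \<nu>.
         mterm q n x \<nu> k * mterm q n x k m * (G (msize n k) * qpoch q (\<alpha> * q ^ msize n k) (msize n m))))"
    by (subst sum.swap) (simp only: sum_distrib_left)
  also have "\<dots> = (\<Sum>m\<in>multi_indices_le n \<nu>. F m * (if m = \<nu> then qpoch q (\<alpha> * q) N else 0))"
    using bailey_inversion[OF \<nu> _ \<alpha> nz] by (intro sum.cong refl) (simp only: G_def N_def)
  also have "\<dots> = F \<nu> * qpoch q (\<alpha> * q) N"
    using \<nu> finite_multi_indices_le by (simp add: multi_indices_le_eq if_distrib cong: if_cong)
  finally have total: "(\<Sum>k\<in>multi_indices_le n \<nu>. outer_term q n \<alpha> \<beta> \<gamma> a b c d x k) = qpoch q (\<alpha> * q) N * F \<nu>"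
    by (simp only: mult.commute)
  have "((\<lambda>k. outer_term q n \<alpha> \<beta> \<gamma> a b c d x k) has_sum (qpoch q (\<alpha> * q) N * F \<nu>)) (multi_indices_le n \<nu>)"
    using has_sum_finite[OF finite_multi_indices_le] total by metis
  moreover have "((\<lambda>k. outer_term q n \<alpha> \<beta> \<gamma> a b c d x k) has_sum (qpoch q (\<alpha> * q) N * F \<nu>)) (multi_indices n)
    \<longleftrightarrow> ((\<lambda>k. outer_term q n \<alpha> \<beta> \<gamma> a b c d x k) has_sum (qpoch q (\<alpha> * q) N * F \<nu>)) (multi_indices_le n \<nu>)"
  proof (rule has_sum_cong_neutral)
    fix k assume "k \<in> multi_indices n - multi_indices_le n \<nu>"
    then show "outer_term q n \<alpha> \<beta> \<gamma> a b c d x k = 0"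
      using mterm_eq_0 unfolding outer by (force simp: multi_indices_le_eq not_le)
  qed (auto simp: multi_indices_le_eq)
  ultimately have "((\<lambda>k. outer_term q n \<alpha> \<beta> \<gamma> a b c d x k) has_sum (qpoch q (\<alpha> * q) N * F \<nu>)) (multi_indices n)"
    by blast
  then show ?thesis by (simp only: F_def N_def)
qed

end

section \<open>Analytic continuation in the parameters\<close>

lemma qpoch_inf_split:
  assumes "norm q < 1"
  shows "qpoch_inf q z = qpoch q z k * qpoch_inf q (z * q ^ k)"
proof (rule LIMSEQ_unique)
  show "(\<lambda>j. qpoch q z (j + k)) \<longlonglongrightarrow> qpoch_inf q z"
    by (rule LIMSEQ_ignore_initial_segment[OF qpoch_tendsto[OF assms]])
  have "(\<lambda>j. qpoch q z k * qpoch q (z * q ^ k) j) \<longlonglongrightarrow> qpoch q z k * qpoch_inf q (z * q ^ k)"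
    by (intro tendsto_mult_left qpoch_tendsto assms)
  then show "(\<lambda>j. qpoch q z (j + k)) \<longlonglongrightarrow> qpoch q z k * qpoch_inf q (z * q ^ k)"
    by (simp add: add.commute flip: qpoch_add)
qed

lemma qpoch_inf_nz_norm_less_1:
  assumes "norm q < 1" "norm z < 1"
  shows "qpoch_inf q z \<noteq> 0"
proof (rule qpoch_inf_nz[OF assms(1)])
  fix i
  have "norm (z * q ^ i) \<le> norm z"
    using assms by (simp add: norm_mult norm_power mult_left_le power_le_one)
  then show "z * q ^ i \<noteq> 1" using assms by (metis norm_one not_le)
qed

text \<open>On the disc of radius r the majorant r |q|^i gives uniform convergence of the partial
  products, and every point lies in such a disc.\<close>

lemma qpoch_inf_holomorphic:
  assumes "norm q < 1"
  shows "qpoch_inf q holomorphic_on UNIV"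
proof -
  have "qpoch_inf q holomorphic_on ball 0 r" if r: "r > 0" for r :: real
  proof -
    have "uniformly_convergent_on (cball 0 r) (\<lambda>N x. \<Sum>i<N. norm (- x * q ^ i))"
    proof (rule Weierstrass_m_test')
      show "norm (norm (- x * q ^ i)) \<le> r * norm q ^ i" if "x \<in> cball 0 r" for i x
        using that by (auto simp: norm_mult norm_power intro: mult_right_mono)
      show "summable (\<lambda>i. r * norm q ^ i)"
        using assms by (intro summable_mult summable_geometric) auto
    qed
    then have "uniformly_convergent_on (cball 0 r) (\<lambda>N x. \<Prod>i<N. 1 + - x * q ^ i)"
      by (intro uniformly_convergent_on_prod) (auto intro!: continuous_intros)
    then have lim: "uniform_limit (cball 0 r) (\<lambda>N x. qpoch q x N) (\<lambda>x. lim (\<lambda>N. qpoch q x N)) sequentially"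
      by (simp add: uniformly_convergent_uniform_limit_iff qpoch_def)
    have "(\<lambda>x. lim (\<lambda>N. qpoch q x N)) = qpoch_inf q"
      using qpoch_tendsto[OF assms] by (auto simp: fun_eq_iff intro: limI)
    with lim have "uniform_limit (cball 0 r) (\<lambda>N x. qpoch q x N) (qpoch_inf q) sequentially"
      by simp
    moreover have "continuous_on (cball 0 r) (\<lambda>x. qpoch q x N)" "(\<lambda>x. qpoch q x N) holomorphic_on ball 0 r" for N
      unfolding qpoch_def by (auto intro!: continuous_intros holomorphic_intros)
    ultimately show ?thesis
      using holomorphic_uniform_limit[of 0 r "\<lambda>N x. qpoch q x N" sequentially "qpoch_inf q"] by auto
  qed
  moreover have "0 < norm z + 1" for z :: complex
    by (intro add_nonneg_pos) auto
  ultimately have hol: "qpoch_inf q holomorphic_on ball 0 (norm z + 1)" for z :: complex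
    by blast
  have "qpoch_inf q field_differentiable at z" for z
    by (rule holomorphic_on_imp_differentiable_at[OF hol[of z]]) auto
  then show ?thesis by (simp add: holomorphic_on_def)
qed

lemma qpoch_inf_holomorphic_intro:
  assumes "norm q < 1" "f holomorphic_on S"
  shows "(\<lambda>t. qpoch_inf q (f t)) holomorphic_on S"
  using holomorphic_on_compose[OF assms(2) holomorphic_on_subset[OF qpoch_inf_holomorphic[OF assms(1)]]]
  by (simp add: o_def)

text \<open>A finite set of multi-indices lies in a box, over which the sum factors into n partial
  geometric series.\<close>

lemma summable_on_power_msize:
  fixes \<theta> :: real
  assumes "0 \<le> \<theta>" "\<theta> < 1"
  shows "(\<lambda>k. \<theta> ^ msize n k) summable_on multi_indices n"
proof (rule nonneg_bdd_above_summable_on)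
  show "bdd_above (sum (\<lambda>k. \<theta> ^ msize n k) ` {F. F \<subseteq> multi_indices n \<and> finite F})"
  proof (rule bdd_aboveI2)
    fix F assume F: "F \<in> {F. F \<subseteq> multi_indices n \<and> finite F}"
    define M where "M = (\<Sum>k\<in>F. msize n k)"
    have sub: "F \<subseteq> {1..n} \<rightarrow>\<^sub>E {..M}"
    proof
      fix k assume k: "k \<in> F"
      then have kext: "k \<in> extensional {1..n}" using F by (auto simp: multi_indices_def PiE_iff)
      have "msize n k \<le> M" unfolding M_def using F k by (intro member_le_sum) auto
      then have "k r \<le> M" if "r \<in> {1..n}" for r
        using member_le_msize[OF that, of k] by linarith
      then show "k \<in> {1..n} \<rightarrow>\<^sub>E {..M}"
        by (intro PiE_I) (auto simp: extensional_arb[OF kext])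
    qed
    have "(\<Sum>k\<in>F. \<theta> ^ msize n k) \<le> (\<Sum>k\<in>{1..n} \<rightarrow>\<^sub>E {..M}. \<theta> ^ msize n k)"
      using sub assms by (intro sum_mono2) (auto intro!: finite_PiE)
    also have "\<dots> = (\<Prod>r=1..n. \<Sum>i\<le>M. \<theta> ^ i)"
      by (simp only: msize_def power_sum prod_sum_PiE finite_atLeastAtMost finite_atMost)
    also have "\<dots> \<le> (\<Prod>r=1..n. 1 / (1 - \<theta>))"
    proof (rule prod_mono)
      fix r assume "r \<in> {1..n}"
      show "0 \<le> (\<Sum>i\<le>M. \<theta> ^ i) \<and> (\<Sum>i\<le>M. \<theta> ^ i) \<le> 1 / (1 - \<theta>)"
        using assms sum_le_suminf[of "\<lambda>i. \<theta> ^ i" "{..M}"]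
        by (auto simp: suminf_geometric summable_geometric intro!: sum_nonneg)
    qed
    finally show "(\<Sum>k\<in>F. \<theta> ^ msize n k) \<le> (\<Prod>r=1..n. 1 / (1 - \<theta>))" .
  qed
qed (use assms in auto)

lemma fun_upd_holomorphic: "(\<lambda>t. (a(j := t)) s) holomorphic_on S" for a :: "nat \<Rightarrow> complex"
  by (cases "s = j") (auto intro: holomorphic_intros)

section \<open>The continuation setting: all parameters fixed except the a_r\<close>

locale expansion = q_strings +
  fixes \<alpha> \<beta> \<gamma> b c d :: complex
  assumes \<alpha>_neq_1: "\<alpha> \<noteq> 1"
    and c_nz: "\<And>j. qpoch q (\<alpha> * c) j \<noteq> 0"
    and d_nz: "\<And>j. qpoch q (\<alpha> * d) j \<noteq> 0"
    and b_nz: "\<And>r j. r \<in> {1..n} \<Longrightarrow> qpoch q (\<alpha> * b * x r) j \<noteq> 0"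
begin

abbreviation outer :: "(nat \<Rightarrow> complex) \<Rightarrow> (nat \<Rightarrow> nat) \<Rightarrow> complex" where
  "outer a k \<equiv> outer_term q n \<alpha> \<beta> \<gamma> a b c d x k"

definition closed_form :: "(nat \<Rightarrow> complex) \<Rightarrow> complex" where
  "closed_form a =
     qpochs_inf q [\<alpha> * q, \<alpha> * (\<Prod>r=1..n. a r) * c / q ^ n, \<alpha> * (\<Prod>r=1..n. a r) * d / q ^ n, \<alpha> * \<beta>, \<alpha> * \<gamma>]
     / qpochs_inf q [\<alpha> * (\<Prod>r=1..n. a r) * q powi (1 - int n), \<alpha> * c, \<alpha> * d,
                     \<alpha> * (\<Prod>r=1..n. a r) * \<beta> / q ^ n, \<alpha> * (\<Prod>r=1..n. a r) * \<gamma> / q ^ n]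
     * (\<Prod>r=1..n. qpoch_inf q (\<alpha> * a r * b * x r / q) / qpoch_inf q (\<alpha> * b * x r))"

lemma inf_nz:
  "qpoch_inf q (\<alpha> * c) \<noteq> 0" "qpoch_inf q (\<alpha> * d) \<noteq> 0" "r \<in> {1..n} \<Longrightarrow> qpoch_inf q (\<alpha> * b * x r) \<noteq> 0"
  using c_nz d_nz b_nz by (auto intro!: qpoch_inf_nz_qpoch[OF norm_q])

text \<open>Since a_1 ... a_n = q^(|\<nu>| + n), the infinite products compare (z)_infinity with (z
  q^|\<nu>|)_infinity, or with (z q^(\<nu>_r))_infinity for z = \<alpha> b x_r, and their quotients
  are finite factorials.\<close>

lemma has_sum_closed_form_terminating:
  assumes a: "\<And>r. r \<in> {1..n} \<Longrightarrow> N r > 0 \<and> a r = q ^ N r"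
    and nz: "qpochs_inf q [\<alpha> * (\<Prod>r=1..n. a r) * q powi (1 - int n),
               \<alpha> * (\<Prod>r=1..n. a r) * \<beta> / q ^ n, \<alpha> * (\<Prod>r=1..n. a r) * \<gamma> / q ^ n] \<noteq> 0"
  shows "(outer a has_sum closed_form a) (multi_indices n)"
proof -
  \<comment> \<open>The terminating evaluation is stated for a_r = q^(\<nu>_r + 1), hence the shift
    by 1 and the condition N_r > 0.\<close>
  define \<nu> where "\<nu> = (\<lambda>r\<in>{1..n}. N r - 1)"
  have \<nu>: "\<nu> \<in> multi_indices n" by (simp add: \<nu>_def multi_indices_def)
  have a': "a r = q ^ Suc (\<nu> r)" if "r \<in> {1..n}" for r
    using a[OF that] that by (simp add: \<nu>_def del: power_Suc)
  define M where "M = msize n \<nu>"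
  have "(\<Prod>s=1..n. a s) = (\<Prod>s=1..n. q ^ Suc (\<nu> s))"
    using a' by (intro prod.cong) auto
  also have "\<dots> = q ^ M * q ^ n"
    by (simp add: M_def msize_def power_sum prod.distrib mult.commute)
  finally have A: "(\<Prod>s=1..n. a s) = q ^ M * q ^ n" .
  have e: "\<alpha> * (\<Prod>s=1..n. a s) * q powi (1 - int n) = \<alpha> * q * q ^ M"
    "\<alpha> * (\<Prod>s=1..n. a s) * z / q ^ n = \<alpha> * z * q ^ M" for z
    unfolding A by (simp_all add: power_int_diff)
  have br: "\<alpha> * a r * b * x r / q = \<alpha> * b * x r * q ^ \<nu> r" if "r \<in> {1..n}" for r
    by (simp add: a'[OF that])
  have nz': "qpoch_inf q (\<alpha> * q * q ^ M) \<noteq> 0" "qpoch_inf q (\<alpha> * \<beta> * q ^ M) \<noteq> 0" "qpoch_inf q (\<alpha> * \<gamma> * q ^ M) \<noteq> 0"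
    using nz unfolding e qpochs_inf_def by simp_all
  have nz'': "qpoch q (\<alpha> * q ^ Suc M) j \<noteq> 0" for j
    using nz'(1) qpoch_inf_split[OF norm_q, of "\<alpha> * q * q ^ M" j] by (auto simp: mult.assoc)
  have inf: "qpoch_inf q z = qpoch q z k * qpoch_inf q (z * q ^ k)" for z k
    by (rule qpoch_inf_split[OF norm_q])
  have cdM: "qpoch_inf q (\<alpha> * c * q ^ M) \<noteq> 0" "qpoch_inf q (\<alpha> * d * q ^ M) \<noteq> 0"
    using inf_nz(1,2) inf[of "\<alpha> * c" M] inf[of "\<alpha> * d" M] by auto
  have bM: "qpoch_inf q (\<alpha> * b * x r * q ^ \<nu> r) \<noteq> 0" if "r \<in> {1..n}" for r
    using inf_nz(3)[OF that] inf[of "\<alpha> * b * x r" "\<nu> r"] by auto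
  have "(\<Prod>r=1..n. qpoch_inf q (\<alpha> * a r * b * x r / q) / qpoch_inf q (\<alpha> * b * x r))
    = (\<Prod>r=1..n. 1 / qpoch q (\<alpha> * b * x r) (\<nu> r))"
  proof (rule prod.cong[OF refl])
    fix r assume r: "r \<in> {1..n}"
    show "qpoch_inf q (\<alpha> * a r * b * x r / q) / qpoch_inf q (\<alpha> * b * x r) = 1 / qpoch q (\<alpha> * b * x r) (\<nu> r)"
      unfolding br[OF r] using bM[OF r] by (subst (2) inf[of _ "\<nu> r"]) simp
  qed
  then have b_prod: "(\<Prod>r=1..n. qpoch_inf q (\<alpha> * a r * b * x r / q) / qpoch_inf q (\<alpha> * b * x r))
    = 1 / (\<Prod>r=1..n. qpoch q (\<alpha> * b * x r) (\<nu> r))"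
    by (simp add: prod_dividef)
  have "closed_form a = qpoch q (\<alpha> * q) M * (qpochs q [\<alpha> * \<beta>, \<alpha> * \<gamma>] M
       / (qpochs q [\<alpha> * c, \<alpha> * d] M * (\<Prod>r=1..n. qpoch q (\<alpha> * b * x r) (\<nu> r))))"
    unfolding closed_form_def b_prod e qpochs_inf_def qpochs_def
    using nz' cdM
    by (simp add: inf[of "\<alpha> * q" M] inf[of "\<alpha> * \<beta>" M] inf[of "\<alpha> * \<gamma>" M] inf[of "\<alpha> * c" M] inf[of "\<alpha> * d" M])
  then show ?thesis
    using outer_sum_terminating[OF \<nu> a' \<alpha>_neq_1 nz''[unfolded M_def], of \<beta> \<gamma> b c d] by (simp add: M_def)
qed

text \<open>The reciprocal of a radius: the three convergence conditions that contain a_1 ... a_n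
  together say that \<open>radius\<close> times |a_1 ... a_n| is less than 1.\<close>

definition radius :: real where
  "radius = max (norm (\<alpha> * q powi (1 - int n))) (max (norm (\<alpha> * \<beta> / q ^ n)) (norm (\<alpha> * \<gamma> / q ^ n)))"

lemma radius_nonneg: "0 \<le> radius"
  by (simp add: radius_def le_max_iff_disj)

lemma radius_mult_less_1:
  assumes "radius * P < 1" "0 \<le> P"
  shows "norm (\<alpha> * q powi (1 - int n)) * P < 1" "norm (\<alpha> * \<beta> / q ^ n) * P < 1" "norm (\<alpha> * \<gamma> / q ^ n) * P < 1"
proof -
  have less: "r * P < 1" if "r \<le> radius" for r
    using mult_right_mono[OF that assms(2)] assms(1) by linarith
  show "norm (\<alpha> * q powi (1 - int n)) * P < 1" "norm (\<alpha> * \<beta> / q ^ n) * P < 1" "norm (\<alpha> * \<gamma> / q ^ n) * P < 1"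
    by (rule less; simp only: radius_def max.cobounded1 max.coboundedI2 max.cobounded2)+
qed

lemma closed_form_denominators_nz:
  assumes "radius * (\<Prod>r=1..n. norm (a r)) < 1"
  shows "qpoch_inf q (\<alpha> * (\<Prod>r=1..n. a r) * q powi (1 - int n)) \<noteq> 0"
    "qpoch_inf q (\<alpha> * (\<Prod>r=1..n. a r) * \<beta> / q ^ n) \<noteq> 0"
    "qpoch_inf q (\<alpha> * (\<Prod>r=1..n. a r) * \<gamma> / q ^ n) \<noteq> 0"
proof -
  have P: "0 \<le> (\<Prod>r=1..n. norm (a r))" by (intro prod_nonneg) auto
  have "norm (\<alpha> * (\<Prod>r=1..n. a r) * q powi (1 - int n)) = norm (\<alpha> * q powi (1 - int n)) * (\<Prod>r=1..n. norm (a r))"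
    "norm (\<alpha> * (\<Prod>r=1..n. a r) * \<beta> / q ^ n) = norm (\<alpha> * \<beta> / q ^ n) * (\<Prod>r=1..n. norm (a r))"
    "norm (\<alpha> * (\<Prod>r=1..n. a r) * \<gamma> / q ^ n) = norm (\<alpha> * \<gamma> / q ^ n) * (\<Prod>r=1..n. norm (a r))"
    by (simp_all add: norm_mult norm_divide prod_norm[symmetric] mult_ac)
  then show "qpoch_inf q (\<alpha> * (\<Prod>r=1..n. a r) * q powi (1 - int n)) \<noteq> 0"
    "qpoch_inf q (\<alpha> * (\<Prod>r=1..n. a r) * \<beta> / q ^ n) \<noteq> 0"
    "qpoch_inf q (\<alpha> * (\<Prod>r=1..n. a r) * \<gamma> / q ^ n) \<noteq> 0"
    using radius_mult_less_1[OF assms P] by (auto intro!: qpoch_inf_nz_norm_less_1[OF norm_q])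
qed

text \<open>The bounds e_s are positive while a_s may be 0. Therefore e_s, not a_s, is taken out of
  each factor: |a_s - z q^i| \<le> e_s (1 + |z| |q|^i / e_s), and the products of the second factors
  are bounded.\<close>

lemma numerator_ratio_bound:
  assumes e: "\<And>s. s \<in> {1..n} \<Longrightarrow> 0 < e s"
  shows "\<exists>C\<ge>0. \<forall>a k. (\<forall>s\<in>{1..n}. norm (a s) \<le> e s) \<longrightarrow>
       norm (numer_poly q n x a k / (\<Prod>r=1..n. \<Prod>s=1..n. qpoch q (q * x r / x s) (k r)))
         \<le> C * (\<Prod>s=1..n. e s) ^ msize n k"
proof -
  define Q where "Q r s D \<longleftrightarrow> 0 \<le> D \<and> (\<forall>t j. norm t \<le> e s \<longrightarrow>
      norm ((\<Prod>i<j. t - q * x r / x s * q ^ i) / qpoch q (q * x r / x s) j) \<le> D * e s ^ j)" for r s D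
  have ex: "\<exists>D. Q r s D" if r: "r \<in> {1..n}" and s: "s \<in> {1..n}" for r s
  proof -
    define z where "z = q * x r / x s"
    obtain \<delta> where \<delta>: "\<delta> > 0" "\<And>j. \<delta> \<le> norm (qpoch q z j)"
      using qpoch_bounded_below[OF norm_q qpoch_string_nz[OF r s]] unfolding z_def by blast
    define E where "E = exp (norm z / e s / (1 - norm q))"
    have "norm ((\<Prod>i<j. t - z * q ^ i) / qpoch q z j) \<le> E / \<delta> * e s ^ j" if t: "norm t \<le> e s" for t j
    proof -
      have "norm (\<Prod>i<j. t - z * q ^ i) \<le> (\<Prod>i<j. e s * (1 + norm z / e s * norm q ^ i))"
        unfolding prod_norm[symmetric]
      proof (rule prod_mono)
        fix i
        have "norm (t - z * q ^ i) \<le> norm t + norm z * norm q ^ i"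
          by (metis norm_mult norm_power norm_triangle_ineq4)
        also have "\<dots> \<le> e s * (1 + norm z / e s * norm q ^ i)"
          using t e[OF s] by (simp add: field_simps)
        finally show "0 \<le> norm (t - z * q ^ i) \<and> norm (t - z * q ^ i) \<le> e s * (1 + norm z / e s * norm q ^ i)"
          by simp
      qed
      also have "\<dots> = e s ^ j * (\<Prod>i<j. 1 + norm z / e s * norm q ^ i)"
        by (simp add: prod.distrib)
      also have "\<dots> \<le> e s ^ j * E"
        unfolding E_def using e[OF s] norm_q
        by (intro mult_left_mono prod_one_plus_geometric_le) auto
      finally have "norm (\<Prod>i<j. t - z * q ^ i) / norm (qpoch q z j) \<le> (e s ^ j * E) / \<delta>"
        using \<delta> e[OF s] by (intro frac_le) (auto simp: E_def)
      then show ?thesis by (simp add: norm_divide mult_ac)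
    qed
    moreover have "0 \<le> E / \<delta>" using \<delta> by (simp add: E_def)
    ultimately have "Q r s (E / \<delta>)" unfolding Q_def z_def by blast
    then show ?thesis ..
  qed
  define D where "D r s = (SOME D. Q r s D)" for r s
  have "Q r s (D r s)" if "r \<in> {1..n}" "s \<in> {1..n}" for r s
    unfolding D_def using ex[OF that] by (rule someI_ex)
  then have D: "\<And>r s. r \<in> {1..n} \<Longrightarrow> s \<in> {1..n} \<Longrightarrow> 0 \<le> D r s"
    "\<And>r s t j. r \<in> {1..n} \<Longrightarrow> s \<in> {1..n} \<Longrightarrow> norm t \<le> e s \<Longrightarrow>
       norm ((\<Prod>i<j. t - q * x r / x s * q ^ i) / qpoch q (q * x r / x s) j) \<le> D r s * e s ^ j"
    unfolding Q_def by blast+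
  show ?thesis
  proof (intro exI[of _ "\<Prod>r=1..n. \<Prod>s=1..n. D r s"] conjI allI impI)
    show "0 \<le> (\<Prod>r=1..n. \<Prod>s=1..n. D r s)" by (intro prod_nonneg D(1))
    fix a :: "nat \<Rightarrow> complex" and k assume a: "\<forall>s\<in>{1..n}. norm (a s) \<le> e s"
    have "norm (numer_poly q n x a k / (\<Prod>r=1..n. \<Prod>s=1..n. qpoch q (q * x r / x s) (k r)))
      = (\<Prod>r=1..n. \<Prod>s=1..n. norm ((\<Prod>i<k r. a s - q * x r / x s * q ^ i) / qpoch q (q * x r / x s) (k r)))"
      by (simp add: numer_poly_def prod_norm flip: prod_dividef)
    also have "\<dots> \<le> (\<Prod>r=1..n. \<Prod>s=1..n. D r s * e s ^ k r)"
      by (intro prod_mono conjI prod_nonneg norm_ge_zero D(2) a[rule_format])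
    also have "\<dots> = (\<Prod>r=1..n. \<Prod>s=1..n. D r s) * (\<Prod>s=1..n. e s) ^ msize n k"
      by (simp add: prod.distrib msize_def power_sum prod_power_distrib)
    finally show "norm (numer_poly q n x a k / (\<Prod>r=1..n. \<Prod>s=1..n. qpoch q (q * x r / x s) (k r)))
         \<le> (\<Prod>r=1..n. \<Prod>s=1..n. D r s) * (\<Prod>s=1..n. e s) ^ msize n k" .
  qed
qed

text \<open>With its negative powers cleared the Vandermonde product is bounded in k. Clearing uses
  up the exponents r k_r and returns |k|, so that - n |k| is what remains of the power of q.\<close>

lemma vandermonde_power_bound:
  obtains C where "0 \<le> C"
    "\<And>k. norm (vandermonde_ratio q n x k * q powi ((\<Sum>r=1..n. (int r - 1) * int (k r)) - int n * int (msize n k)))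
       \<le> C * (1 / norm q ^ n) ^ msize n k"
proof (rule that[of "(\<Prod>s=1..n. \<Prod>r=1..<s. norm (x s) + norm (x r)) / norm (vprod n x)"])
  show "0 \<le> (\<Prod>s=1..n. \<Prod>r=1..<s. norm (x s) + norm (x r)) / norm (vprod n x)"
    by (intro divide_nonneg_nonneg prod_nonneg add_nonneg_nonneg) auto
  fix k
  define K where "K = msize n k"
  have "(\<Sum>r=1..n. (int r - 1) * int (k r)) - int n * int K = int (\<Sum>r=1..n. r * k r) + - int ((n + 1) * K)"
    by (simp add: K_def msize_def algebra_simps sum_subtractf)
  then have "q powi ((\<Sum>r=1..n. (int r - 1) * int (k r)) - int n * int K)
     = q ^ (\<Sum>r=1..n. r * k r) * q powi (- int ((n + 1) * K))"
    by (simp only: power_int_add q_nz simp_thms power_int_of_nat)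
  then have "vandermonde_ratio q n x k * q powi ((\<Sum>r=1..n. (int r - 1) * int (k r)) - int n * int K)
    = (vandermonde_ratio q n x k * q ^ (\<Sum>r=1..n. r * k r)) * q powi (- int ((n + 1) * K))"
    by simp
  also have "\<dots> = vprod n (\<lambda>r. x r * q ^ k r) / vprod n x * (q ^ K * q powi (- int ((n + 1) * K)))"
    unfolding vandermonde_ratio_eq_vprod K_def by simp
  also have "q ^ K * q powi (- int ((n + 1) * K)) = (1 / q ^ n) ^ K"
    unfolding power_int_minus power_int_of_nat by (simp add: power_add power_mult divide_simps)
  finally have eq: "vandermonde_ratio q n x k * q powi ((\<Sum>r=1..n. (int r - 1) * int (k r)) - int n * int K)
    = vprod n (\<lambda>r. x r * q ^ k r) / vprod n x * (1 / q ^ n) ^ K" .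
  have "norm (vprod n (\<lambda>r. x r * q ^ k r)) \<le> (\<Prod>s=1..n. \<Prod>r=1..<s. norm (x s) + norm (x r))"
    unfolding vprod_def prod_norm[symmetric]
  proof (intro prod_mono conjI prod_nonneg norm_ge_zero)
    fix s r
    have "norm (x i * q ^ k i) \<le> norm (x i)" for i
      using norm_q by (simp add: norm_mult norm_power mult_left_le power_le_one)
    then show "norm (x s * q ^ k s - x r * q ^ k r) \<le> norm (x s) + norm (x r)"
      by (meson add_mono norm_triangle_ineq4 order_trans)
  qed
  then have "norm (vprod n (\<lambda>r. x r * q ^ k r)) / norm (vprod n x) * (1 / norm q ^ n) ^ K
     \<le> (\<Prod>s=1..n. \<Prod>r=1..<s. norm (x s) + norm (x r)) / norm (vprod n x) * (1 / norm q ^ n) ^ K"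
    by (intro mult_right_mono divide_right_mono) auto
  then show "norm (vandermonde_ratio q n x k * q powi ((\<Sum>r=1..n. (int r - 1) * int (k r)) - int n * int (msize n k)))
       \<le> (\<Prod>s=1..n. \<Prod>r=1..<s. norm (x s) + norm (x r)) / norm (vprod n x) * (1 / norm q ^ n) ^ msize n k"
    unfolding K_def[symmetric] eq by (simp add: norm_mult norm_divide norm_power)
qed

text \<open>The point is a lower bound for the denominator that is uniform in A. Each of its factors
  has modulus at least 1 - \<theta> |q|^i with \<theta> < 1.\<close>

lemma alpha_factor_bound:
  assumes P: "0 \<le> P" "norm (\<alpha> * q powi (1 - int n)) * P < 1"
  shows "\<exists>C\<ge>0. \<forall>A K. norm A \<le> P \<longrightarrow> norm ((1 - \<alpha> * q ^ (2 * K)) * qpoch q \<alpha> K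
        / ((1 - \<alpha>) * qpoch q (\<alpha> * A * q powi (1 - int n)) K)) \<le> C"
proof -
  define \<theta> where "\<theta> = norm (\<alpha> * q powi (1 - int n)) * P"
  \<comment> \<open>The product of the real lower bounds is itself a shifted factorial, so the
    general lower bound applies once its arguments are regarded as complex.\<close>
  define q' \<theta>' where "q' = complex_of_real (norm q)" and "\<theta>' = complex_of_real \<theta>"
  have \<theta>: "0 \<le> \<theta>" "\<theta> < 1" using P by (simp_all add: \<theta>_def)
  have \<theta>i: "0 < 1 - \<theta> * norm q ^ i" for i
  proof -
    have "\<theta> * norm q ^ i \<le> \<theta>" using \<theta> norm_q by (simp add: mult_left_le power_le_one)
    then show ?thesis using \<theta> by linarith
  qed
  have norm_\<theta>': "norm (qpoch q' \<theta>' j) = (\<Prod>i<j. 1 - \<theta> * norm q ^ i)" for j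
  proof -
    have "1 - \<theta>' * q' ^ i = complex_of_real (1 - \<theta> * norm q ^ i)" for i
      by (simp add: \<theta>'_def q'_def)
    then have "norm (1 - \<theta>' * q' ^ i) = 1 - \<theta> * norm q ^ i" for i
      using \<theta>i[of i] by (simp only: norm_of_real abs_of_pos)
    then show ?thesis by (simp add: qpoch_def flip: prod_norm)
  qed
  have pos: "(\<Prod>i<j. 1 - \<theta> * norm q ^ i) > 0" for j
    using \<theta>i by (intro prod_pos) auto
  have "qpoch q' \<theta>' j \<noteq> 0" for j using norm_\<theta>'[of j] pos[of j] by (metis norm_zero less_irrefl)
  moreover have "norm q' < 1" using norm_q by (simp add: q'_def)
  ultimately obtain \<delta> where "\<delta> > 0" "\<And>j. \<delta> \<le> norm (qpoch q' \<theta>' j)"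
    using qpoch_bounded_below[of q' \<theta>'] by blast
  then have \<delta>: "\<delta> > 0" "\<And>j. \<delta> \<le> (\<Prod>i<j. 1 - \<theta> * norm q ^ i)"
    unfolding norm_\<theta>' .
  define E where "E = exp (norm \<alpha> / (1 - norm q))"
  show ?thesis
  proof (intro exI[of _ "(1 + norm \<alpha>) * E / (norm (1 - \<alpha>) * \<delta>)"] conjI allI impI)
    show "0 \<le> (1 + norm \<alpha>) * E / (norm (1 - \<alpha>) * \<delta>)"
      using \<delta> by (simp add: E_def)
    fix A :: complex and K assume A: "norm A \<le> P"
    define z where "z = \<alpha> * A * q powi (1 - int n)"
    have z: "norm z \<le> \<theta>"
    proof -
      have "norm z = norm (\<alpha> * q powi (1 - int n)) * norm A" by (simp add: z_def norm_mult mult_ac)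
      then show ?thesis unfolding \<theta>_def using A by (simp add: mult_left_mono)
    qed
    have "(\<Prod>i<K. 1 - \<theta> * norm q ^ i) \<le> norm (qpoch q z K)"
      unfolding qpoch_def prod_norm[symmetric]
    proof (rule prod_mono, intro conjI)
      fix i
      have "1 - \<theta> * norm q ^ i \<le> 1 - norm (z * q ^ i)"
        using z by (simp add: norm_mult norm_power mult_right_mono)
      also have "\<dots> \<le> norm (1 - z * q ^ i)"
        by (metis norm_one norm_triangle_ineq2)
      finally show "1 - \<theta> * norm q ^ i \<le> norm (1 - z * q ^ i)" .
    qed (use \<theta>i in \<open>auto intro: less_imp_le\<close>)
    then have low: "\<delta> \<le> norm (qpoch q z K)" using \<delta>(2)[of K] by linarith
    have "norm (1 - \<alpha> * q ^ (2 * K)) \<le> 1 + norm (\<alpha> * q ^ (2 * K))"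
      by (metis norm_one norm_triangle_ineq4)
    also have "norm (\<alpha> * q ^ (2 * K)) \<le> norm \<alpha>"
      using norm_q by (simp add: norm_mult norm_power mult_left_le power_le_one)
    finally have "norm (1 - \<alpha> * q ^ (2 * K)) \<le> 1 + norm \<alpha>" by simp
    moreover have "norm (qpoch q \<alpha> K) \<le> E" unfolding E_def by (rule norm_qpoch_le[OF norm_q])
    ultimately show "norm ((1 - \<alpha> * q ^ (2 * K)) * qpoch q \<alpha> K / ((1 - \<alpha>) * qpoch q (\<alpha> * A * q powi (1 - int n)) K))
       \<le> (1 + norm \<alpha>) * E / (norm (1 - \<alpha>) * \<delta>)"
      unfolding z_def[symmetric] norm_divide norm_mult[of "1 - \<alpha>"] norm_mult[of "1 - \<alpha> * q ^ (2 * K)"]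
      using low \<delta> \<alpha>_neq_1
      by (intro frac_le mult_mono mult_left_mono mult_pos_pos mult_nonneg_nonneg) (auto simp: E_def)
  qed
qed

lemma outer_bound:
  assumes e: "\<And>s. s \<in> {1..n} \<Longrightarrow> 0 < e s" and R: "radius * (\<Prod>s=1..n. e s) < 1"
  shows "\<exists>M. M summable_on multi_indices n \<and>
    (\<forall>a k. (\<forall>s\<in>{1..n}. norm (a s) \<le> e s) \<longrightarrow> norm (outer a k) \<le> M k)"
proof -
  define P where "P = (\<Prod>s=1..n. e s)"
  have P: "P > 0" unfolding P_def using e by (intro prod_pos) auto
  note rad = radius_mult_less_1[OF R[folded P_def] less_imp_le[OF P]]
  have qn: "0 < norm q ^ n" by simp
  \<comment> \<open>The inner sum contributes \<rho>^|k|, the numerator P^|k| and the Vandermonde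
    part |q|^(-n |k|). The conditions with \<beta> and \<gamma> leave room for \<rho> between the
    two moduli and |q|^n / P, and the resulting geometric ratio \<theta> is less than 1.\<close>
  have "max (norm (\<alpha> * \<beta>)) (norm (\<alpha> * \<gamma>)) < norm q ^ n / P"
    using rad(2,3) P qn by (simp add: norm_divide norm_power field_simps)
  then obtain \<rho> where \<rho>: "max (norm (\<alpha> * \<beta>)) (norm (\<alpha> * \<gamma>)) < \<rho>" "\<rho> < norm q ^ n / P"
    using dense by blast
  have \<rho>_pos: "0 < \<rho>" using \<rho>(1) norm_ge_zero[of "\<alpha> * \<beta>"] by linarith
  define \<theta> where "\<theta> = 1 / norm q ^ n * P * \<rho>"
  have \<theta>: "0 \<le> \<theta>" "\<theta> < 1"
    using P qn \<rho>_pos \<rho>(2) by (auto simp: \<theta>_def field_simps)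
  obtain C1 where C1: "0 \<le> C1" "\<And>k. norm (inner_sum q n \<alpha> \<beta> \<gamma> b c d x k) \<le> C1 * \<rho> ^ msize n k"
    using inner_sum_bound[OF c_nz d_nz b_nz, of \<beta> \<rho> \<gamma>] \<rho>(1) by auto
  obtain C2 where C2: "0 \<le> C2" "\<forall>a k. (\<forall>s\<in>{1..n}. norm (a s) \<le> e s) \<longrightarrow>
       norm (numer_poly q n x a k / (\<Prod>r=1..n. \<Prod>s=1..n. qpoch q (q * x r / x s) (k r))) \<le> C2 * P ^ msize n k"
    using numerator_ratio_bound[of e, OF e] unfolding P_def by auto
  obtain C3 where C3: "0 \<le> C3"
    "\<And>k. norm (vandermonde_ratio q n x k * q powi ((\<Sum>r=1..n. (int r - 1) * int (k r)) - int n * int (msize n k)))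
       \<le> C3 * (1 / norm q ^ n) ^ msize n k"
    by (rule vandermonde_power_bound, rule that)
  obtain C4 where C4: "0 \<le> C4" "\<forall>A K. norm A \<le> P \<longrightarrow> norm ((1 - \<alpha> * q ^ (2 * K)) * qpoch q \<alpha> K
        / ((1 - \<alpha>) * qpoch q (\<alpha> * A * q powi (1 - int n)) K)) \<le> C4"
    using alpha_factor_bound[OF less_imp_le[OF P] rad(1)] by auto
  show ?thesis
  proof (intro exI[of _ "\<lambda>k. (C3 * C2 * C4 * C1) * \<theta> ^ msize n k"] conjI allI impI)
    show "(\<lambda>k. (C3 * C2 * C4 * C1) * \<theta> ^ msize n k) summable_on multi_indices n"
      by (intro summable_on_cmult_right summable_on_power_msize \<theta>)
    fix a :: "nat \<Rightarrow> complex" and k assume a: "\<forall>s\<in>{1..n}. norm (a s) \<le> e s"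
    define K where "K = msize n k"
    have A: "norm (\<Prod>s=1..n. a s) \<le> P"
      unfolding P_def prod_norm[symmetric] using a by (intro prod_mono) auto
    have re: "outer a k
       = (vandermonde_ratio q n x k * q powi ((\<Sum>r=1..n. (int r - 1) * int (k r)) - int n * int (msize n k)))
         * (numer_poly q n x a k / (\<Prod>r=1..n. \<Prod>s=1..n. qpoch q (q * x r / x s) (k r)))
         * ((1 - \<alpha> * q ^ (2 * K)) * qpoch q \<alpha> K
             / ((1 - \<alpha>) * qpoch q (\<alpha> * (\<Prod>s=1..n. a s) * q powi (1 - int n)) K))
         * inner_sum q n \<alpha> \<beta> \<gamma> b c d x k"
      unfolding outer_term_def K_def by (simp only: mult_ac)
    have "norm (outer a k) \<le> (C3 * (1 / norm q ^ n) ^ K) * (C2 * P ^ K) * C4 * (C1 * \<rho> ^ K)"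
      unfolding re norm_mult[of "_ * _ * _"] norm_mult[of "_ * _" "_ / ((1 - \<alpha>) * _)"] norm_mult[of _ "numer_poly q n x a k / _"]
      using C1 C2(1) C2(2)[rule_format, of a k] C3 C4(1) C4(2)[rule_format, OF A, of K] a P \<rho>_pos
      by (intro mult_mono mult_nonneg_nonneg norm_ge_zero) (simp_all add: K_def)
    also have "\<dots> = (C3 * C2 * C4 * C1) * \<theta> ^ K"
      unfolding \<theta>_def power_mult_distrib by (simp only: mult_ac)
    finally show "norm (outer a k) \<le> (C3 * C2 * C4 * C1) * \<theta> ^ msize n k"
      by (simp only: K_def)
  qed
qed

lemma outer_has_sum:
  assumes "radius * (\<Prod>r=1..n. norm (a r)) < 1"
  shows "(outer a has_sum (\<Sum>\<^sub>\<infinity>k\<in>multi_indices n. outer a k)) (multi_indices n)"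
    and "\<exists>\<epsilon>>0. radius * (\<Prod>r=1..n. norm (a r) + 2 * \<epsilon>) < 1"
proof -
  \<comment> \<open>By continuity all |a_r| can be enlarged a little without violating the
    condition. The enlarged bounds are positive even where a_r = 0, as the domination
    requires.\<close>
  have "((\<lambda>\<epsilon>. radius * (\<Prod>r=1..n. norm (a r) + 2 * \<epsilon>)) \<longlongrightarrow> radius * (\<Prod>r=1..n. norm (a r) + 2 * 0)) (at_right 0)"
    by (intro tendsto_intros)
  then have "eventually (\<lambda>\<epsilon>. radius * (\<Prod>r=1..n. norm (a r) + 2 * \<epsilon>) < 1) (at_right 0)"
    by (rule order_tendstoD(2)) (use assms in simp)
  then have "eventually (\<lambda>\<epsilon>. radius * (\<Prod>r=1..n. norm (a r) + 2 * \<epsilon>) < 1 \<and> \<epsilon> > 0) (at_right 0)"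
    by (intro eventually_conj eventually_at_right_less)
  then obtain \<epsilon> :: real where \<epsilon>: "\<epsilon> > 0" "radius * (\<Prod>r=1..n. norm (a r) + 2 * \<epsilon>) < 1"
    using eventually_happens'[OF trivial_limit_at_right_real] by blast
  then show "\<exists>\<epsilon>>0. radius * (\<Prod>r=1..n. norm (a r) + 2 * \<epsilon>) < 1" by blast
  obtain M where M: "M summable_on multi_indices n"
    "\<forall>a' k. (\<forall>s\<in>{1..n}. norm (a' s) \<le> norm (a s) + 2 * \<epsilon>) \<longrightarrow> norm (outer a' k) \<le> M k"
    using outer_bound[of "\<lambda>s. norm (a s) + 2 * \<epsilon>", OF add_nonneg_pos] \<epsilon> by auto
  have "(\<lambda>k. norm (outer a k)) summable_on multi_indices n"
    by (rule summable_on_comparison_test[OF M(1)]) (use M(2)[rule_format, of a] \<epsilon>(1) in simp_all)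
  then show "(outer a has_sum (\<Sum>\<^sub>\<infinity>k\<in>multi_indices n. outer a k)) (multi_indices n)"
    by (rule has_sum_infsum[OF abs_summable_summable])
qed

section \<open>Analyticity in a single parameter\<close>

definition slice :: "nat \<Rightarrow> (nat \<Rightarrow> complex) \<Rightarrow> complex set" where
  "slice j a = {t. radius * (\<Prod>r=1..n. norm ((a(j := t)) r)) < 1}"

lemma slice_eq:
  assumes "j \<in> {1..n}"
  shows "slice j a = {t. radius * (\<Prod>r\<in>{1..n} - {j}. norm (a r)) * norm t < 1}"
proof -
  have "(\<Prod>r\<in>{1..n} - {j}. norm ((a(j := t)) r)) = (\<Prod>r\<in>{1..n} - {j}. norm (a r))" for t
    by (intro prod.cong) auto
  then have "(\<Prod>r=1..n. norm ((a(j := t)) r)) = norm t * (\<Prod>r\<in>{1..n} - {j}. norm (a r))" for t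
    using prod.remove[of "{1..n}" j "\<lambda>r. norm ((a(j := t)) r)"] assms by simp
  then show ?thesis by (simp add: slice_def mult_ac)
qed

text \<open>The condition depends on t only through a nonnegative multiple of |t|, so the slice is a
  disc about 0 or the whole plane. It contains 0 whatever the other a_r are.\<close>

lemma slice_topology:
  assumes "j \<in> {1..n}"
  shows "open (slice j a)" "connected (slice j a)" "0 \<in> slice j a"
proof -
  define \<kappa> where "\<kappa> = radius * (\<Prod>r\<in>{1..n} - {j}. norm (a r))"
  have \<kappa>: "0 \<le> \<kappa>" unfolding \<kappa>_def by (intro mult_nonneg_nonneg radius_nonneg prod_nonneg) auto
  have eq: "slice j a = {t. \<kappa> * norm t < 1}" using slice_eq[OF assms] by (simp add: \<kappa>_def)
  have "slice j a = (if \<kappa> = 0 then UNIV else ball 0 (1 / \<kappa>))"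
    using \<kappa> unfolding eq by (auto simp: field_simps)
  then show "open (slice j a)" "connected (slice j a)"
    by (auto intro: convex_connected)
  show "0 \<in> slice j a" by (simp add: eq)
qed

text \<open>Because the numerator is polynomial in the a_s, the point t = 0, at which the known
  values accumulate, is an ordinary point of every term.\<close>

lemma outer_slice_holomorphic:
  assumes j: "j \<in> {1..n}"
  shows "(\<lambda>t. outer (a(j := t)) k) holomorphic_on slice j a"
proof -
  have "qpoch q (\<alpha> * (\<Prod>r=1..n. (a(j := t)) r) * q powi (1 - int n)) i \<noteq> 0" if "t \<in> slice j a" for t i
    using closed_form_denominators_nz(1)[of "a(j := t)"] that
      qpoch_inf_split[OF norm_q, of "\<alpha> * (\<Prod>r=1..n. (a(j := t)) r) * q powi (1 - int n)" i]
    by (auto simp: slice_def)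
  moreover have "(\<lambda>t. qpoch q (\<alpha> * (\<Prod>r=1..n. (a(j := t)) r) * q powi (1 - int n)) i) holomorphic_on slice j a" for i
    unfolding qpoch_def by (intro holomorphic_intros fun_upd_holomorphic)
  moreover have "(\<lambda>t. numer_poly q n x (a(j := t)) k) holomorphic_on slice j a"
    unfolding numer_poly_def by (intro holomorphic_intros fun_upd_holomorphic)
  ultimately show ?thesis
    unfolding outer_term_def using \<alpha>_neq_1 qpoch_string_nz
    by (intro holomorphic_intros) auto
qed

lemma infsum_slice_holomorphic:
  assumes j: "j \<in> {1..n}"
  shows "(\<lambda>t. \<Sum>\<^sub>\<infinity>k\<in>multi_indices n. outer (a(j := t)) k) holomorphic_on slice j a"
  unfolding holomorphic_on_def
proof
  fix t0 assume t0: "t0 \<in> slice j a"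
  obtain \<epsilon> where \<epsilon>: "\<epsilon> > 0" "radius * (\<Prod>r=1..n. norm ((a(j := t0)) r) + 2 * \<epsilon>) < 1"
    using outer_has_sum(2)[of "a(j := t0)"] t0 by (auto simp: slice_def)
  \<comment> \<open>One summable majorant for all t in a closed disc about t0, as the M-test needs;
    the sum is then a uniform limit of holomorphic finite sums on that disc.\<close>
  obtain M where M: "M summable_on multi_indices n"
    "\<forall>a' k. (\<forall>s\<in>{1..n}. norm (a' s) \<le> norm ((a(j := t0)) s) + 2 * \<epsilon>) \<longrightarrow> norm (outer a' k) \<le> M k"
    using outer_bound[of "\<lambda>s. norm ((a(j := t0)) s) + 2 * \<epsilon>", OF add_nonneg_pos] \<epsilon> by (auto simp del: fun_upd_apply)
  have near: "norm ((a(j := t)) s) \<le> norm ((a(j := t0)) s) + 2 * \<epsilon>" if "t \<in> cball t0 \<epsilon>" for t s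
  proof -
    have "norm t \<le> norm t0 + \<epsilon>"
      using that norm_triangle_ineq2[of t t0] by (simp add: dist_norm norm_minus_commute)
    then show ?thesis using \<epsilon>(1) by simp
  qed
  have sub: "cball t0 \<epsilon> \<subseteq> slice j a"
  proof
    fix t assume "t \<in> cball t0 \<epsilon>"
    then have "(\<Prod>r=1..n. norm ((a(j := t)) r)) \<le> (\<Prod>r=1..n. norm ((a(j := t0)) r) + 2 * \<epsilon>)"
      using near by (intro prod_mono conjI norm_ge_zero)
    then have "radius * (\<Prod>r=1..n. norm ((a(j := t)) r)) \<le> radius * (\<Prod>r=1..n. norm ((a(j := t0)) r) + 2 * \<epsilon>)"
      using radius_nonneg by (rule mult_left_mono)
    then show "t \<in> slice j a" using \<epsilon>(2) by (simp add: slice_def)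
  qed
  have ulim: "uniform_limit (cball t0 \<epsilon>) (\<lambda>X t. \<Sum>k\<in>X. outer (a(j := t)) k)
     (\<lambda>t. \<Sum>\<^sub>\<infinity>k\<in>multi_indices n. outer (a(j := t)) k) (finite_subsets_at_top (multi_indices n))"
    by (rule Weierstrass_m_test_general[OF _ M(1)]) (intro M(2)[rule_format] near)
  have hol: "(\<lambda>t. \<Sum>k\<in>X. outer (a(j := t)) k) holomorphic_on cball t0 \<epsilon>" for X
    by (intro holomorphic_intros holomorphic_on_subset[OF outer_slice_holomorphic[OF j] sub])
  have ev: "eventually (\<lambda>X. continuous_on (cball t0 \<epsilon>) (\<lambda>t. \<Sum>k\<in>X. outer (a(j := t)) k)
      \<and> (\<lambda>t. \<Sum>k\<in>X. outer (a(j := t)) k) holomorphic_on ball t0 \<epsilon>) (finite_subsets_at_top (multi_indices n))"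
    by (intro always_eventually allI conjI holomorphic_on_imp_continuous_on hol
        holomorphic_on_subset[OF hol ball_subset_cball])
  have "(\<lambda>t. \<Sum>\<^sub>\<infinity>k\<in>multi_indices n. outer (a(j := t)) k) holomorphic_on ball t0 \<epsilon>"
    by (rule holomorphic_uniform_limit[OF ev ulim]) simp_all
  then have "(\<lambda>t. \<Sum>\<^sub>\<infinity>k\<in>multi_indices n. outer (a(j := t)) k) field_differentiable at t0"
    by (rule holomorphic_on_imp_differentiable_at) (use \<epsilon>(1) in auto)
  then show "(\<lambda>t. \<Sum>\<^sub>\<infinity>k\<in>multi_indices n. outer (a(j := t)) k) field_differentiable at t0 within slice j a"
    by (rule field_differentiable_at_within)
qed

lemma closed_form_slice_holomorphic:
  assumes j: "j \<in> {1..n}"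
  shows "(\<lambda>t. closed_form (a(j := t))) holomorphic_on slice j a"
proof -
  have nz: "qpochs_inf q [\<alpha> * (\<Prod>r=1..n. (a(j := t)) r) * q powi (1 - int n), \<alpha> * c, \<alpha> * d,
      \<alpha> * (\<Prod>r=1..n. (a(j := t)) r) * \<beta> / q ^ n, \<alpha> * (\<Prod>r=1..n. (a(j := t)) r) * \<gamma> / q ^ n] \<noteq> 0"
    if "t \<in> slice j a" for t
    using closed_form_denominators_nz[of "a(j := t)"] that inf_nz(1,2)
    unfolding qpochs_inf_def slice_def by simp
  have A: "(\<lambda>t. \<Prod>r=1..n. (a(j := t)) r) holomorphic_on slice j a"
    by (intro holomorphic_intros fun_upd_holomorphic)
  have num: "(\<lambda>t. qpochs_inf q [\<alpha> * q, \<alpha> * (\<Prod>r=1..n. (a(j := t)) r) * c / q ^ n,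
      \<alpha> * (\<Prod>r=1..n. (a(j := t)) r) * d / q ^ n, \<alpha> * \<beta>, \<alpha> * \<gamma>]) holomorphic_on slice j a"
    unfolding qpochs_inf_def list.map prod_list.Cons prod_list.Nil
    by (intro holomorphic_on_mult holomorphic_on_divide qpoch_inf_holomorphic_intro[OF norm_q] holomorphic_on_const A) simp_all
  have den: "(\<lambda>t. qpochs_inf q [\<alpha> * (\<Prod>r=1..n. (a(j := t)) r) * q powi (1 - int n), \<alpha> * c, \<alpha> * d,
      \<alpha> * (\<Prod>r=1..n. (a(j := t)) r) * \<beta> / q ^ n, \<alpha> * (\<Prod>r=1..n. (a(j := t)) r) * \<gamma> / q ^ n]) holomorphic_on slice j a"
    unfolding qpochs_inf_def list.map prod_list.Cons prod_list.Nil
    by (intro holomorphic_on_mult holomorphic_on_divide qpoch_inf_holomorphic_intro[OF norm_q] holomorphic_on_const A) simp_all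
  show ?thesis
    unfolding closed_form_def
    by (intro holomorphic_on_mult holomorphic_on_divide num den nz holomorphic_on_prod inf_nz(3)
        qpoch_inf_holomorphic_intro[OF norm_q] holomorphic_on_const fun_upd_holomorphic)
      (simp_all del: fun_upd_apply)
qed

text \<open>The parameters are freed one at a time: the points \<open>q\<^sup>N\<close> at which the identity is already
  known accumulate at \<open>0\<close>, which lies inside the slice.\<close>

lemma infsum_closed_form_partial:
  assumes "J \<le> n" "radius * (\<Prod>r=1..n. norm (a r)) < 1"
    and "\<And>r. r \<in> {J<..n} \<Longrightarrow> \<exists>N>0. a r = q ^ N"
  shows "(\<Sum>\<^sub>\<infinity>k\<in>multi_indices n. outer a k) = closed_form a"
  using assms
proof (induction J arbitrary: a)
  case 0
  then have "\<forall>r\<in>{1..n}. \<exists>N>0. a r = q ^ N" by simp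
  then obtain N where "\<forall>r\<in>{1..n}. N r > 0 \<and> a r = q ^ N r" by metis
  then have "(outer a has_sum closed_form a) (multi_indices n)"
    using closed_form_denominators_nz[OF "0.prems"(2)]
    by (intro has_sum_closed_form_terminating[of N]) (auto simp: qpochs_inf_def)
  then show ?case by (rule infsumI)
next
  case (Suc J)
  define j where "j = Suc J"
  have j: "j \<in> {1..n}" using Suc.prems(1) by (simp add: j_def)
  define f where "f t = (\<Sum>\<^sub>\<infinity>k\<in>multi_indices n. outer (a(j := t)) k) - closed_form (a(j := t))" for t
  define U where "U = slice j a \<inter> {q ^ N | N. N > 0}"
  have "f (a j) = 0"
  proof (rule analytic_continuation[of f "slice j a" U 0])
    show "f holomorphic_on slice j a"
      unfolding f_def by (intro holomorphic_on_diff infsum_slice_holomorphic closed_form_slice_holomorphic j)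
    show "open (slice j a)" "connected (slice j a)" "0 \<in> slice j a"
      by (rule slice_topology[OF j])+
    show "U \<subseteq> slice j a" by (simp add: U_def)
    show "a j \<in> slice j a" using Suc.prems(2) by (simp add: slice_def fun_upd_triv del: fun_upd_apply)
    show "0 islimpt U"
      unfolding islimpt_approachable
    proof (intro allI impI)
      fix e :: real assume "e > 0"
      have lim: "(\<lambda>N. q ^ Suc N) \<longlonglongrightarrow> 0"
        using LIMSEQ_Suc[OF LIMSEQ_power_zero[OF norm_q]] .
      have "eventually (\<lambda>N. q ^ Suc N \<in> slice j a) sequentially"
        using topological_tendstoD[OF lim slice_topology(1)[OF j] slice_topology(3)[OF j]] .
      moreover have "eventually (\<lambda>N. dist (q ^ Suc N) 0 < e) sequentially"
        using tendstoD[OF lim \<open>e > 0\<close>] .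
      ultimately have "eventually (\<lambda>N. q ^ Suc N \<in> slice j a \<and> dist (q ^ Suc N) 0 < e) sequentially"
        by (rule eventually_conj)
      then obtain N where N: "q ^ Suc N \<in> slice j a" "dist (q ^ Suc N) 0 < e"
        using eventually_happens'[OF sequentially_bot] by blast
      then have "q ^ Suc N \<in> U" unfolding U_def by blast
      moreover have "q ^ Suc N \<noteq> 0" by simp
      ultimately show "\<exists>t\<in>U. t \<noteq> 0 \<and> dist t 0 < e" using N(2) by blast
    qed
    \<comment> \<open>Putting a power of q into position j leaves at most J free entries, and
      membership in the slice is precisely the convergence hypothesis for the modified
      parameters.\<close>
    fix t assume t: "t \<in> U"
    have "(\<Sum>\<^sub>\<infinity>k\<in>multi_indices n. outer (a(j := t)) k) = closed_form (a(j := t))"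
    proof (rule Suc.IH)
      show "J \<le> n" using Suc.prems(1) by simp
      show "radius * (\<Prod>r=1..n. norm ((a(j := t)) r)) < 1"
        using t by (simp add: U_def slice_def del: fun_upd_apply)
      show "\<exists>N>0. (a(j := t)) r = q ^ N" if "r \<in> {J<..n}" for r
        using that t Suc.prems(3)[of r] by (cases "r = j") (auto simp: U_def j_def)
    qed
    then show "f t = 0" by (simp add: f_def)
  qed
  then show ?case by (simp add: f_def fun_upd_triv)
qed

lemma has_sum_closed_form:
  assumes "radius * (\<Prod>r=1..n. norm (a r)) < 1"
  shows "(outer a has_sum closed_form a) (multi_indices n)"
  using outer_has_sum(1)[OF assms] infsum_closed_form_partial[of n a] assms by simp

end

theorem theorem1p10:
  fixes q \<alpha> \<beta> \<gamma> b c d :: complex and a x :: "nat \<Rightarrow> complex" and n :: nat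
  defines "A \<equiv> (\<Prod>r=1..n. a r)"
  assumes q: "0 < cmod q" "cmod q < 1"
    and n: "n \<ge> 1"
    and params:
      "(Max {cmod (\<alpha> * c), cmod (\<alpha> * d), cmod (\<alpha> * A * q powi (1 - int n)),
             cmod (\<alpha> * \<beta> * A / q ^ n), cmod (\<alpha> * \<gamma> * A / q ^ n)} < 1
        \<and> Max ((\<lambda>r. cmod (\<alpha> * b * x r)) ` {1..n}) < 1)
       \<or> (\<exists>N :: nat \<Rightarrow> nat. \<forall>r\<in>{1..n}. N r > 0 \<and> a r = q ^ N r)"
    and denom_lhs:
      "qpochs_inf q [\<alpha> * A * q powi (1 - int n), \<alpha> * c, \<alpha> * d,
                     \<alpha> * A * \<beta> / q ^ n, \<alpha> * A * \<gamma> / q ^ n] \<noteq> 0"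
      "\<forall>r\<in>{1..n}. qpoch_inf q (\<alpha> * b * x r) \<noteq> 0"
    and denom_x:
      "\<forall>s\<in>{1..n}. x s \<noteq> 0"
      "\<forall>s\<in>{1..n}. \<forall>r\<in>{1..<s}. 1 - x r / x s \<noteq> 0"
      "\<forall>r\<in>{1..n}. \<forall>s\<in>{1..n}. \<forall>j. qpoch q (q * x r / x s) j \<noteq> 0"
    and denom_rhs:
      "1 - \<alpha> \<noteq> 0"
      "\<forall>j. qpoch q (\<alpha> * A * q powi (1 - int n)) j \<noteq> 0"
      "\<forall>j. qpochs q [\<alpha> * c, \<alpha> * d] j \<noteq> 0"
      "\<forall>r\<in>{1..n}. \<forall>j. qpoch q (\<alpha> * b * x r) j \<noteq> 0"
  shows
    "((\<lambda>k. outer_term q n \<alpha> \<beta> \<gamma> a b c d x k) has_sum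
       (qpochs_inf q [\<alpha> * q, \<alpha> * A * c / q ^ n, \<alpha> * A * d / q ^ n, \<alpha> * \<beta>, \<alpha> * \<gamma>]
        / qpochs_inf q [\<alpha> * A * q powi (1 - int n), \<alpha> * c, \<alpha> * d,
                        \<alpha> * A * \<beta> / q ^ n, \<alpha> * A * \<gamma> / q ^ n]
        * (\<Prod>r=1..n. qpoch_inf q (\<alpha> * a r * b * x r / q) / qpoch_inf q (\<alpha> * b * x r))))
     (multi_indices n)"
proof -
  \<comment> \<open>The Vandermonde denominators exclude a coincidence with i = 0, and the
    factorials with base q x_s / x_r exclude those with i > 0.\<close>
  have x_neq: "x r \<noteq> x s * q ^ i" if rs: "r \<in> {1..n}" "s \<in> {1..n}" "r \<noteq> s" for r s i
  proof (cases i)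
    case 0
    consider "r < s" | "s < r" using rs(3) by linarith
    then have "x r \<noteq> x s"
    proof cases
      case 1
      then have "1 - x r / x s \<noteq> 0" using denom_x(2) rs by auto
      then show ?thesis using denom_x(1) rs(2) by auto
    next
      case 2
      then have "1 - x s / x r \<noteq> 0" using denom_x(2) rs by auto
      then show ?thesis using denom_x(1) rs(1) by auto
    qed
    then show ?thesis using 0 by simp
  next
    case (Suc i')
    have "qpoch q (q * x s / x r) (Suc i') \<noteq> 0" using denom_x(3) rs by blast
    then have "q * x s / x r * q ^ i' \<noteq> 1" by (auto simp: qpoch_Suc)
    then show ?thesis using Suc denom_x(1) rs(1) by (auto simp: field_simps)
  qed
  interpret q_strings q n x
  proof
    show "q \<noteq> 0" "norm q < 1" using q by auto
    show "x s \<noteq> 0" if "s \<in> {1..n}" for s using denom_x(1) that by blast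
    fix r s i j assume rs: "r \<in> {1..n}" "s \<in> {1..n}" and eq: "x r * q ^ i = x s * q ^ j"
    show "r = s"
    proof (rule ccontr)
      assume "r \<noteq> s"
      show False
      proof (cases "i \<le> j")
        case True
        then have "x r * q ^ i = x s * q ^ (j - i) * q ^ i" using eq by (simp add: mult.assoc flip: power_add)
        then show False using x_neq[OF rs \<open>r \<noteq> s\<close>, of "j - i"] q(1) by simp
      next
        case False
        then have "x r * q ^ (i - j) * q ^ j = x s * q ^ j" using eq by (simp add: mult.assoc flip: power_add)
        then show False using x_neq[OF rs(2,1), of "i - j"] \<open>r \<noteq> s\<close> q(1) by simp
      qed
    qed
  qed
  interpret expansion q n x \<alpha> \<beta> \<gamma> b c d
    by unfold_locales (use denom_rhs in \<open>auto simp: qpochs_def\<close>)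
  have "(outer a has_sum closed_form a) (multi_indices n)"
    using params
  proof
    assume "Max {cmod (\<alpha> * c), cmod (\<alpha> * d), cmod (\<alpha> * A * q powi (1 - int n)),
             cmod (\<alpha> * \<beta> * A / q ^ n), cmod (\<alpha> * \<gamma> * A / q ^ n)} < 1
        \<and> Max ((\<lambda>r. cmod (\<alpha> * b * x r)) ` {1..n}) < 1"
    then have less: "cmod (\<alpha> * A * q powi (1 - int n)) < 1" "cmod (\<alpha> * \<beta> * A / q ^ n) < 1" "cmod (\<alpha> * \<gamma> * A / q ^ n) < 1"
      by simp_all
    have "cmod (\<alpha> * q powi (1 - int n)) * cmod A < 1" "cmod (\<alpha> * \<beta> / q ^ n) * cmod A < 1" "cmod (\<alpha> * \<gamma> / q ^ n) * cmod A < 1"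
      using less by (simp_all add: norm_mult norm_divide mult_ac)
    then have "radius * cmod A < 1"
      by (auto simp: radius_def max_def)
    then show ?thesis
      by (intro has_sum_closed_form) (simp add: A_def prod_norm)
  next
    assume "\<exists>N :: nat \<Rightarrow> nat. \<forall>r\<in>{1..n}. N r > 0 \<and> a r = q ^ N r"
    then obtain N where "\<forall>r\<in>{1..n}. N r > 0 \<and> a r = q ^ N r" by blast
    then show ?thesis
      using denom_lhs(1) by (intro has_sum_closed_form_terminating[of N]) (auto simp: qpochs_inf_def A_def)
  qed
  then show ?thesis unfolding closed_form_def A_def .
qed

end
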